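(* In the setting described in the context, let $\mathscr A_1=[\theta_1^-,\theta_1^+]$, $\mathscr A_2=[\theta_2^-,\theta_2^+]$ be two intervals with $0\le\theta_1^-\le\theta_1^+<\theta_2^-\le\theta_2^+<1$ such that, for $i=1,2$, $V(\theta)<V(\theta_i^-)=V(\theta_i^+)<H$ for all $\theta\in(\theta_i^-,\theta_i^+)$ and $V'(\theta_i^-)<0<V'(\theta_i^+)$. Suppose that $\mathscr A_1$ and $\mathscr A_2$ belong to different landscapes. Then, as $\epsilon\to0$, $$\mathrm{cap}_\epsilon(\mathscr A_1,\mathscr A_2)=[1+o(1)]\,\frac{\epsilon}{Z_\epsilon}\,e^{-H/\epsilon}.$$
   Context: Model. $\mathbb T=[0,1)$ is the one-dimensional torus; functions on $\mathbb T$ are identified with $1$-periodic functions on $\mathbb R$. $b:\mathbb T\to\mathbb R$ is continuous and: (i) $\{b=0\}$ has finitely many connected components $I_j=[l_j,r_j]$, $1\le j\le p$, $0<l_1\le r_1<l_2\le\dots<l_p\le r_p<1$ (possibly $l_j=r_j$); (ii) $b$ is of class $C^2$ on $\mathbb T\setminus I$, $I=\cup_jI_j$; (iii) if $(c,d)$ is a connected component of $\mathbb T\setminus I$, the one-sided derivatives satisfy $b'(c+)\ne0$, $b'(d-)\neq0$ (when $l_j=r_j$ the left and right derivatives of $b$ there may differ). Moreover $B:=\int_{\mathbb T}b>0$. Let $S(x)=-\int_0^xb(y)dy$, so $S(x+1)=S(x)-B$; $z(x)=z_x$ is the largest point of $[x,\infty)$ at which $\max\{S(y):y\ge x\}$ is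 attained; $\widehat V(x)=S(x)-S(z_x)$, which is $1$-periodic; $H=-\min_{\mathbb T}\widehat V$; $V=\widehat V+H$; $\pi_\epsilon(x)=\int_x^{x+1}e^{[S(y)-S(x)]/\epsilon}dy$, $c(\epsilon)=\int_0^1\pi_\epsilon$, $m_\epsilon=\pi_\epsilon/c(\epsilon)$ (stationary density of the diffusion on $\mathbb T$ with generator $L_\epsilon f=bf'+\epsilon f''$). Capacity. For disjoint closed intervals $\mathscr A_1,\mathscr A_2\subset\mathbb T$, the equilibrium potential $h=h_{\mathscr A_1,\mathscr A_2}$ is the unique solution of $L_\epsilon h=0$ on $\mathbb T\setminus(\mathscr A_1\cup\mathscr A_2)$, $h=1$ on $\mathscr A_1$, $h=0$ on $\mathscr A_2$, and $\mathrm{cap}_\epsilon(\mathscr A_1,\mathscr A_2)=\epsilon\int_{\mathbb T}[h'(\theta)]^2m_\epsilon(\theta)\,d\theta$. Local extrema. $[\mathfrak M_k^-,\mathfrak M_k^+]$ (resp. $[\mathfrak m_k^-,\mathfrak m_k^+]$), $1\le k\le q$, are the connected components of $\{b=0\}$ in $[0,1)$ (possibly points) on which $S$ assumes a local maximum (resp. minimum), ordered as $0\le\mathfrak M_1^-\le\mathfrak M_1^+<\mathfrak m_1^-\le\mathfrak m_1^+<\mathfrak M_2^-\le\dots<\mathfrak m_q^-\le\mathfrak m_q^+<1$; $q\ge1$; put $\mathfrak M^\pm_{j+mq}=m+\mathfrak M^\pm_j$, $m\in\mathbb Z$. Landscapes. Let $\mathfrak L_n^\pm=\mathfrak M_{j(n)}^\pm$,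 $1\le n\le\boldsymbol m$, $1\le j(1)<\dots<j(\boldsymbol m)\le q$, be the local maxima with $z(\mathfrak M_k^+)=\mathfrak M_k^+$; the origin is chosen so that $\mathfrak L_1^+=\mathfrak M_1^+$; put $\mathfrak L^\pm_{n+r\boldsymbol m}=r+\mathfrak L^\pm_n$ and $j(n+r\boldsymbol m)=j(n)+rq$, $r\in\mathbb Z$. Let $\ell_n=\inf\{x\ge\mathfrak L_n^+:S(x)=S(\mathfrak L_{n+1}^+)\}$ and $\Lambda_n=[\ell_n,\mathfrak L_{n+1}^+]$, $1\le n\le\boldsymbol m$, regarded as subsets of $\mathbb T$; these are the landscapes. Under the conditions in the claim each $\mathscr A_i$ is contained in one landscape; belonging to different landscapes means $z(\theta_1^+)<z(\theta_2^+)<z(1+\theta_1^+)$. Let $\ell_n^-=\ell_n$, $\ell_n^+=\sup\{x\ge\ell_n:S(y)=S(\ell_n)\text{ for all }\ell_n\le y\le x\}$. Let $\ell_n^+<\mathfrak M^+_{a(n,1)}<\dots<\mathfrak M^+_{a(n,r_n-1)}<\mathfrak L^-_{n+1}$ enumerate the local maxima $\mathfrak M^+_k\in(\ell_n^+,\mathfrak L^-_{n+1})$ with $S(\mathfrak M_k^+)=S(\ell_n)$; put $a(n,r_n)=j(n+1)$, so $\mathfrak M^\pm_{a(n,r_n)}=\mathfrak L^\pm_{n+1}$, and $\mathfrak M^\pm_{a(n,0)}:=\ell_n^\pm$. Functions and constants. Put $\omega_\pm(x)=\sqrt{\pi/(2|b'(x\pm)|)}$, $\sigma(\mathfrak m_k^+)=\omega_+(\mathfrak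 m_k^+)+\omega_-(\mathfrak m_k^-)$. On $\Lambda_n$ (and extended $1$-periodically): $G_0(x)=\int_x^{\mathfrak L^+_{n+1}}\mathbf 1\{S(y)=S(\ell_n)\}dy$ and $$G_1(x)=\omega_+(\mathfrak M^+_{a(n,0)})\mathbf 1\{b(\mathfrak M^+_{a(n,0)})=0,\,x\le\mathfrak M^+_{a(n,0)}\}+\sum_{j=1}^{r_n}\Big[\omega_-(\mathfrak M^-_{a(n,j)})\mathbf 1\{x<\mathfrak M^-_{a(n,j)}\}+\omega_+(\mathfrak M^+_{a(n,j)})\mathbf 1\{x\le\mathfrak M^+_{a(n,j)}\}\Big].$$ With $\mathbb I=\{j\in\{1,\dots,q\}:\widehat V(\mathfrak m_j^+)=-H\}$, $Z_\epsilon=\sum_{j\in\mathbb I}\{G_0(\mathfrak m_j^+)+\sqrt\epsilon\,G_1(\mathfrak m_j^+)\}\{[\mathfrak m_j^+-\mathfrak m_j^-]+\sqrt\epsilon\,\sigma(\mathfrak m_j^+)\}$. *)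

theory Defs
  imports "HOL-Analysis.Analysis" "HOL-Library.Landau_Symbols"
begin

text \<open>
  The torus is represented by the fundamental domain \<open>{0..<1}\<close>, and functions on it by
  1-periodic functions on the reals.
\<close>

definition C2_on :: "(real \<Rightarrow> real) \<Rightarrow> real set \<Rightarrow> bool" where
  "C2_on f U \<longleftrightarrow> (\<exists>f' f''.
     (\<forall>x\<in>U. (f has_real_derivative f' x) (at x) \<and> (f' has_real_derivative f'' x) (at x)) \<and>
     continuous_on U f'')"

text \<open>
  Because \<open>0 < l 1\<close> and \<open>r p < 1\<close>, the drift does not vanish at the origin, so the
  components of its zero set on the torus are those of its zero set in \<open>{0..<1}\<close>, and the
  components of the complement lift to the bounded components of the complement in the reals.
\<close>

definition admissible_drift :: "(real \<Rightarrow> real) \<Rightarrow> bool" where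
  "admissible_drift b \<longleftrightarrow>
     (\<forall>x. b (x + 1) = b x) \<and> continuous_on UNIV b \<and>
     (\<exists>(p::nat) l r. 1 \<le> p \<and>
        components {x\<in>{0..<1}. b x = 0} = (\<lambda>j. {l j..r j}) ` {1..p} \<and>
        0 < l 1 \<and> (\<forall>j\<in>{1..p}. l j \<le> r j) \<and> (\<forall>j\<in>{1..<p}. r j < l (Suc j)) \<and> r p < 1) \<and>
     C2_on b {x. b x \<noteq> 0} \<and>
     (\<forall>c d. {c<..<d} \<in> components {x. b x \<noteq> 0} \<longrightarrow>
        (\<exists>D. D \<noteq> 0 \<and> (b has_real_derivative D) (at_right c)) \<and>
        (\<exists>D. D \<noteq> 0 \<and> (b has_real_derivative D) (at_left d))) \<and>
     integral {0..1} b > 0"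

text \<open>The interval integral is oriented, so this is \<open>S\<close> on the whole real line.\<close>

definition pot :: "(real \<Rightarrow> real) \<Rightarrow> real \<Rightarrow> real" where
  "pot b x = - (LBINT y=0..x. b y)"

definition zmax :: "(real \<Rightarrow> real) \<Rightarrow> real \<Rightarrow> real" where
  "zmax b x = (GREATEST y. y \<ge> x \<and> (\<forall>w\<ge>x. pot b w \<le> pot b y))"

definition Vhat :: "(real \<Rightarrow> real) \<Rightarrow> real \<Rightarrow> real" where
  "Vhat b x = pot b x - pot b (zmax b x)"

definition height :: "(real \<Rightarrow> real) \<Rightarrow> real" where
  "height b = - (INF x\<in>{0..<1}. Vhat b x)"

definition quasipot :: "(real \<Rightarrow> real) \<Rightarrow> real \<Rightarrow> real" where
  "quasipot b x = Vhat b x + height b"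

definition pi_eps :: "(real \<Rightarrow> real) \<Rightarrow> real \<Rightarrow> real \<Rightarrow> real" where
  "pi_eps b \<epsilon> x = integral {x..x + 1} (\<lambda>y. exp ((pot b y - pot b x) / \<epsilon>))"

definition c_eps :: "(real \<Rightarrow> real) \<Rightarrow> real \<Rightarrow> real" where
  "c_eps b \<epsilon> = integral {0..1} (pi_eps b \<epsilon>)"

definition m_eps :: "(real \<Rightarrow> real) \<Rightarrow> real \<Rightarrow> real \<Rightarrow> real" where
  "m_eps b \<epsilon> x = pi_eps b \<epsilon> x / c_eps b \<epsilon>"

definition generator :: "(real \<Rightarrow> real) \<Rightarrow> real \<Rightarrow> (real \<Rightarrow> real) \<Rightarrow> real \<Rightarrow> real" where
  "generator b \<epsilon> f x = b x * deriv f x + \<epsilon> * deriv (deriv f) x"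

definition periodic_lift :: "real set \<Rightarrow> real set" where
  "periodic_lift A = {x. \<exists>k::int. x + of_int k \<in> A}"

definition is_equilibrium_potential ::
  "(real \<Rightarrow> real) \<Rightarrow> real \<Rightarrow> real set \<Rightarrow> real set \<Rightarrow> (real \<Rightarrow> real) \<Rightarrow> bool" where
  "is_equilibrium_potential b \<epsilon> A\<^sub>1 A\<^sub>2 h \<longleftrightarrow>
     (\<forall>x. h (x + 1) = h x) \<and> continuous_on UNIV h \<and>
     (\<forall>x. x \<notin> periodic_lift A\<^sub>1 \<union> periodic_lift A\<^sub>2 \<longrightarrow>
        h differentiable at x \<and> deriv h differentiable at x \<and> generator b \<epsilon> h x = 0) \<and>
     (\<forall>x\<in>periodic_lift A\<^sub>1. h x = 1) \<and> (\<forall>x\<in>periodic_lift A\<^sub>2. h x = 0)"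

definition equilibrium_potential ::
  "(real \<Rightarrow> real) \<Rightarrow> real \<Rightarrow> real set \<Rightarrow> real set \<Rightarrow> real \<Rightarrow> real" where
  "equilibrium_potential b \<epsilon> A\<^sub>1 A\<^sub>2 = (THE h. is_equilibrium_potential b \<epsilon> A\<^sub>1 A\<^sub>2 h)"

text \<open>
  The equilibrium potential need not be differentiable at the endpoints of the two intervals;
  these finitely many points do not affect the integral.
\<close>

definition capacity :: "(real \<Rightarrow> real) \<Rightarrow> real \<Rightarrow> real set \<Rightarrow> real set \<Rightarrow> real" where
  "capacity b \<epsilon> A\<^sub>1 A\<^sub>2 =
     \<epsilon> * integral {0..1} (\<lambda>\<theta>. (deriv (equilibrium_potential b \<epsilon> A\<^sub>1 A\<^sub>2) \<theta>)\<^sup>2 * m_eps b \<epsilon> \<theta>)"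

text \<open>
  The extremality must hold at every point of the component: an interior point of a flat
  inflection piece of \<open>S\<close> is trivially a local maximum and a local minimum.
\<close>

definition max_components :: "(real \<Rightarrow> real) \<Rightarrow> real set set" where
  "max_components b = {C \<in> components {x\<in>{0..<1}. b x = 0}.
     \<forall>x\<in>C. \<forall>\<^sub>F y in nhds x. pot b y \<le> pot b x}"

definition min_components :: "(real \<Rightarrow> real) \<Rightarrow> real set set" where
  "min_components b = {C \<in> components {x\<in>{0..<1}. b x = 0}.
     \<forall>x\<in>C. \<forall>\<^sub>F y in nhds x. pot b y \<ge> pot b x}"

text \<open>
  \<open>[M\<^sub>m k, M\<^sub>p k]\<close> and \<open>[m\<^sub>m k, m\<^sub>p k]\<close> are the components carrying the local maxima and
  minima (subscript \<open>m\<close> for the left endpoint, \<open>p\<close> for the right one), enumerated by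
  \<open>1 \<le> k \<le> q\<close>; the maxima are indexed by all integers.
\<close>

definition local_extrema ::
  "(real \<Rightarrow> real) \<Rightarrow> int \<Rightarrow> (int \<Rightarrow> real) \<Rightarrow> (int \<Rightarrow> real) \<Rightarrow> (int \<Rightarrow> real) \<Rightarrow> (int \<Rightarrow> real) \<Rightarrow> bool"
where
  "local_extrema b q M\<^sub>m M\<^sub>p m\<^sub>m m\<^sub>p \<longleftrightarrow>
     1 \<le> q \<and>
     max_components b = (\<lambda>k. {M\<^sub>m k..M\<^sub>p k}) ` {1..q} \<and>
     min_components b = (\<lambda>k. {m\<^sub>m k..m\<^sub>p k}) ` {1..q} \<and>
     0 \<le> M\<^sub>m 1 \<and>
     (\<forall>k\<in>{1..q}. M\<^sub>m k \<le> M\<^sub>p k \<and> M\<^sub>p k < m\<^sub>m k \<and> m\<^sub>m k \<le> m\<^sub>p k) \<and>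
     (\<forall>k\<in>{1..<q}. m\<^sub>p k < M\<^sub>m (k + 1)) \<and>
     m\<^sub>p q < 1 \<and>
     (\<forall>k r. M\<^sub>m (k + r * q) = of_int r + M\<^sub>m k \<and> M\<^sub>p (k + r * q) = of_int r + M\<^sub>p k)"

text \<open>
  \<open>J 1 < \<dots> < J N\<close> enumerates the maxima with \<open>z(M\<^sub>p k) = M\<^sub>p k\<close>, so the \<open>n\<close>-th of them is
  \<open>[M\<^sub>m (J n), M\<^sub>p (J n)]\<close>; \<open>J 1 = 1\<close> expresses the choice of the origin.
\<close>

definition landscape_maxima ::
  "(real \<Rightarrow> real) \<Rightarrow> int \<Rightarrow> (int \<Rightarrow> real) \<Rightarrow> int \<Rightarrow> (int \<Rightarrow> int) \<Rightarrow> bool" where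
  "landscape_maxima b q M\<^sub>p N J \<longleftrightarrow>
     1 \<le> N \<and>
     strict_mono_on {1..N} J \<and>
     J ` {1..N} = {k\<in>{1..q}. zmax b (M\<^sub>p k) = M\<^sub>p k} \<and>
     J 1 = 1 \<and>
     (\<forall>n r. J (n + r * N) = J n + r * q)"

definition ell :: "(real \<Rightarrow> real) \<Rightarrow> (int \<Rightarrow> real) \<Rightarrow> (int \<Rightarrow> int) \<Rightarrow> int \<Rightarrow> real" where
  "ell b M\<^sub>p J n = Inf {x. x \<ge> M\<^sub>p (J n) \<and> pot b x = pot b (M\<^sub>p (J (n + 1)))}"

definition landscape :: "(real \<Rightarrow> real) \<Rightarrow> (int \<Rightarrow> real) \<Rightarrow> (int \<Rightarrow> int) \<Rightarrow> int \<Rightarrow> real set" where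
  "landscape b M\<^sub>p J n = {ell b M\<^sub>p J n..M\<^sub>p (J (n + 1))}"

definition in_different_landscapes :: "(real \<Rightarrow> real) \<Rightarrow> real \<Rightarrow> real \<Rightarrow> bool" where
  "in_different_landscapes b \<theta>\<^sub>1 \<theta>\<^sub>2 \<longleftrightarrow>
     zmax b \<theta>\<^sub>1 < zmax b \<theta>\<^sub>2 \<and> zmax b \<theta>\<^sub>2 < zmax b (1 + \<theta>\<^sub>1)"

definition ell_plus :: "(real \<Rightarrow> real) \<Rightarrow> (int \<Rightarrow> real) \<Rightarrow> (int \<Rightarrow> int) \<Rightarrow> int \<Rightarrow> real" where
  "ell_plus b M\<^sub>p J n = Sup {x. x \<ge> ell b M\<^sub>p J n \<and>
     (\<forall>y\<in>{ell b M\<^sub>p J n..x}. pot b y = pot b (ell b M\<^sub>p J n))}"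

definition level_maxima ::
  "(real \<Rightarrow> real) \<Rightarrow> (int \<Rightarrow> real) \<Rightarrow> (int \<Rightarrow> real) \<Rightarrow> (int \<Rightarrow> int) \<Rightarrow> int \<Rightarrow> int set" where
  "level_maxima b M\<^sub>m M\<^sub>p J n = {k. M\<^sub>p k \<in> {ell_plus b M\<^sub>p J n<..<M\<^sub>m (J (n + 1))} \<and>
     pot b (M\<^sub>p k) = pot b (ell b M\<^sub>p J n)}"

definition r_land ::
  "(real \<Rightarrow> real) \<Rightarrow> (int \<Rightarrow> real) \<Rightarrow> (int \<Rightarrow> real) \<Rightarrow> (int \<Rightarrow> int) \<Rightarrow> int \<Rightarrow> nat" where
  "r_land b M\<^sub>m M\<^sub>p J n = card (level_maxima b M\<^sub>m M\<^sub>p J n) + 1"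

text \<open>The index \<open>a(n,i)\<close> for \<open>1 \<le> i \<le> r\<^sub>n\<close>.\<close>

definition a_index ::
  "(real \<Rightarrow> real) \<Rightarrow> (int \<Rightarrow> real) \<Rightarrow> (int \<Rightarrow> real) \<Rightarrow> (int \<Rightarrow> int) \<Rightarrow> int \<Rightarrow> nat \<Rightarrow> int" where
  "a_index b M\<^sub>m M\<^sub>p J n i =
     (sorted_list_of_set (level_maxima b M\<^sub>m M\<^sub>p J n) @ [J (n + 1)]) ! (i - 1)"

text \<open>
  Since \<open>n\<close> ranges over all integers, the landscapes below are the lifts to the real line of
  those on the torus; they are pairwise disjoint. This builds the 1-periodic
  extension into \<open>G0\<close> and \<open>G1\<close>, which are meaningful on the landscapes only.
\<close>

definition landscape_index ::
  "(real \<Rightarrow> real) \<Rightarrow> (int \<Rightarrow> real) \<Rightarrow> (int \<Rightarrow> int) \<Rightarrow> real \<Rightarrow> int" where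
  "landscape_index b M\<^sub>p J x = (THE n. x \<in> landscape b M\<^sub>p J n)"

definition omega_plus :: "(real \<Rightarrow> real) \<Rightarrow> real \<Rightarrow> real" where
  "omega_plus b x = sqrt (pi / (2 * \<bar>vector_derivative b (at_right x)\<bar>))"

definition omega_minus :: "(real \<Rightarrow> real) \<Rightarrow> real \<Rightarrow> real" where
  "omega_minus b x = sqrt (pi / (2 * \<bar>vector_derivative b (at_left x)\<bar>))"

definition sigma :: "(real \<Rightarrow> real) \<Rightarrow> (int \<Rightarrow> real) \<Rightarrow> (int \<Rightarrow> real) \<Rightarrow> int \<Rightarrow> real" where
  "sigma b m\<^sub>m m\<^sub>p k = omega_plus b (m\<^sub>p k) + omega_minus b (m\<^sub>m k)"

definition G0 :: "(real \<Rightarrow> real) \<Rightarrow> (int \<Rightarrow> real) \<Rightarrow> (int \<Rightarrow> int) \<Rightarrow> real \<Rightarrow> real" where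
  "G0 b M\<^sub>p J x = (let n = landscape_index b M\<^sub>p J x in
     integral {x..M\<^sub>p (J (n + 1))} (indicator {y. pot b y = pot b (ell b M\<^sub>p J n)}))"

definition G1 ::
  "(real \<Rightarrow> real) \<Rightarrow> (int \<Rightarrow> real) \<Rightarrow> (int \<Rightarrow> real) \<Rightarrow> (int \<Rightarrow> int) \<Rightarrow> real \<Rightarrow> real" where
  "G1 b M\<^sub>m M\<^sub>p J x = (let n = landscape_index b M\<^sub>p J x; e = ell_plus b M\<^sub>p J n;
       a = a_index b M\<^sub>m M\<^sub>p J n in
     omega_plus b e * of_bool (b e = 0 \<and> x \<le> e) +
     (\<Sum>i=1..r_land b M\<^sub>m M\<^sub>p J n.
        omega_minus b (M\<^sub>m (a i)) * of_bool (x < M\<^sub>m (a i)) +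
        omega_plus b (M\<^sub>p (a i)) * of_bool (x \<le> M\<^sub>p (a i))))"

definition Z_eps ::
  "(real \<Rightarrow> real) \<Rightarrow> int \<Rightarrow> (int \<Rightarrow> real) \<Rightarrow> (int \<Rightarrow> real) \<Rightarrow> (int \<Rightarrow> real) \<Rightarrow> (int \<Rightarrow> real) \<Rightarrow>
     (int \<Rightarrow> int) \<Rightarrow> real \<Rightarrow> real" where
  "Z_eps b q M\<^sub>m M\<^sub>p m\<^sub>m m\<^sub>p J \<epsilon> = (\<Sum>j\<in>{j\<in>{1..q}. Vhat b (m\<^sub>p j) = - height b}.
     (G0 b M\<^sub>p J (m\<^sub>p j) + sqrt \<epsilon> * G1 b M\<^sub>m M\<^sub>p J (m\<^sub>p j)) *
     ((m\<^sub>p j - m\<^sub>m j) + sqrt \<epsilon> * sigma b m\<^sub>m m\<^sub>p j))"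

definition is_well :: "(real \<Rightarrow> real) \<Rightarrow> real \<Rightarrow> real \<Rightarrow> bool" where
  "is_well b \<theta>\<^sub>m \<theta>\<^sub>p \<longleftrightarrow>
     (\<forall>\<theta>\<in>{\<theta>\<^sub>m<..<\<theta>\<^sub>p}. quasipot b \<theta> < quasipot b \<theta>\<^sub>m) \<and>
     quasipot b \<theta>\<^sub>m = quasipot b \<theta>\<^sub>p \<and> quasipot b \<theta>\<^sub>p < height b \<and>
     (\<exists>D<0. (quasipot b has_real_derivative D) (at \<theta>\<^sub>m)) \<and>
     (\<exists>D>0. (quasipot b has_real_derivative D) (at \<theta>\<^sub>p))"

end

theory Submission
  imports Defs "HOL-Probability.Distributions"
begin

text \<open>
  On the complement of the two wells, \<open>L h = 0\<close> says that \<open>h'\<close> is a multiple of \<open>exp (S / \<epsilon>)\<close>. With an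
  antiderivative \<open>E\<close> of \<open>exp (S / \<epsilon>)\<close>, the equilibrium potential is therefore affine in \<open>E\<close> on each of the
  two gaps: it falls from 1 to 0 between the first well and the second, and rises back to 1 between the
  second well and the translate of the first. Since \<open>\<pi>_\<epsilon>(x) = exp (- S x / \<epsilon>) (E (x + 1) - E x)\<close>, the
  capacity equals \<open>\<epsilon> / c(\<epsilon>)\<close> times the sum, over the two gaps \<open>[p, r]\<close>, of
  \<open>\<integral> E'(x) (E (x + 1) - E x) dx / (E r - E p)\<^sup>2\<close> (lemma \<open>capacity_eq\<close>). Write
  \<open>E (x + 1) - E x = (E r - E x) + (E (x + 1) - E r)\<close>. The first summand contributes exactly 1/2. The
  second one only sees \<open>S\<close> to the right of the gap; as the wells belong to different landscapes, \<open>S\<close> reaches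
  in the gap a level that it never attains to the right of it, so this contribution is exponentially small
  (lemma \<open>gap_energy_limit\<close>). The capacity is thus asymptotic to \<open>\<epsilon> / c(\<epsilon>)\<close>.
  
  It remains to see that \<open>c(\<epsilon>)\<close> is asymptotic to \<open>Z_\<epsilon> exp (H / \<epsilon>)\<close> (lemma \<open>c_eps_asymp\<close>), which is
  Laplace's method for the double integral of \<open>exp ((S y - S x) / \<epsilon>)\<close> over \<open>x \<le> y \<le> x + 1\<close>. The exponent
  attains its maximum \<open>H\<close> exactly when \<open>x\<close> lies in a component of minima at which the well is deepest and
  \<open>y\<close> in a component at which \<open>S\<close> is maximal on \<open>[x, \<infinity>)\<close>. Near such a component of minima the integral
  factorises up to exponentially small errors (lemma \<open>well_contribution\<close>). Both factors are
  one-dimensional Laplace integrals over finitely many plateaus (lemma \<open>laplace_finite_plateaus\<close>): a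
  plateau contributes its length, and each of its two flanks \<open>sqrt \<epsilon>\<close> times a half Gaussian integral,
  because \<open>b\<close> has a non-zero one-sided derivative where it leaves its zero set. The integral over \<open>x\<close>
  yields the length of the component plus \<open>sqrt \<epsilon> * sigma\<close>, the one over \<open>y\<close> yields \<open>G0 + sqrt \<epsilon> * G1\<close>.
\<close>

section \<open>Laplace asymptotics\<close>

lemma half_gaussian_integral:
  fixes k :: real
  assumes "0 < k"
  shows "(\<integral>s. indicator {0..} s * exp (- k / 2 * s\<^sup>2) \<partial>lborel) = sqrt (pi / (2 * k))"
proof -
  define c where "c = sqrt (k / 2)"
  have c: "0 < c" "c\<^sup>2 = k / 2" using assms by (auto simp: c_def)
  have "has_bochner_integral lborel (\<lambda>x. indicator {0..} x *\<^sub>R exp (- x\<^sup>2)) (sqrt pi / 2)"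
    by (rule gaussian_moment_0)
  then have "sqrt pi / 2 = (\<integral>x. indicator {0..} x *\<^sub>R exp (- x\<^sup>2) \<partial>lborel)"
    by (simp add: has_bochner_integral_iff)
  also have "\<dots> = \<bar>c\<bar> *\<^sub>R (\<integral>x. indicator {0..} (0 + c * x) *\<^sub>R exp (- (0 + c * x)\<^sup>2) \<partial>lborel)"
    by (rule lborel_integral_real_affine) (use c in auto)
  also have "(\<lambda>x. indicator {0..} (0 + c * x) *\<^sub>R exp (- (0 + c * x)\<^sup>2)) =
      (\<lambda>s. indicator {0..} s * exp (- k / 2 * s\<^sup>2) :: real)"
    using c by (auto simp: fun_eq_iff power_mult_distrib indicator_def zero_le_mult_iff)
  finally have "(\<integral>s. indicator {0..} s * exp (- k / 2 * s\<^sup>2) \<partial>lborel) = sqrt pi / 2 / c"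
    using c by (simp add: field_simps)
  also have "\<dots> = sqrt (pi / (2 * k))"
    unfolding c_def using assms
    by (intro real_sqrt_unique[symmetric])
       (auto simp: power_divide power_mult_distrib field_simps)
  finally show ?thesis .
qed

lemma half_gaussian_integrable:
  fixes c :: real
  assumes "0 < c"
  shows "integrable lborel (\<lambda>s. indicator {0..} s * exp (- c * s\<^sup>2))"
proof (rule ccontr)
  assume "\<not> ?thesis"
  then have "(\<integral>s. indicator {0..} s * exp (- c * s\<^sup>2) \<partial>lborel) = 0"
    by (rule not_integrable_integral_eq)
  with half_gaussian_integral[of "2 * c"] assms show False by simp
qed

lemma negative_max_on_compact:
  fixes f :: "'a::topological_space \<Rightarrow> real"
  assumes "compact K" "continuous_on K f" "\<And>x. x \<in> K \<Longrightarrow> f x < 0"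
  obtains \<eta> where "0 < \<eta>" "\<And>x. x \<in> K \<Longrightarrow> f x \<le> - \<eta>"
proof (cases "K = {}")
  case True
  then show ?thesis using that[of 1] by auto
next
  case False
  then obtain x where "x \<in> K" "\<And>y. y \<in> K \<Longrightarrow> f y \<le> f x"
    using continuous_attains_sup[OF assms(1) _ assms(2)] by blast
  then show ?thesis using that[of "- f x"] assms(3)[of x] by auto
qed

text \<open>
  After the substitution \<open>t = sqrt \<epsilon> * s\<close> the integrand converges pointwise to the Gaussian
  \<open>exp (- k s\<^sup>2 / 2)\<close>; a uniform bound \<open>f t \<le> - c t\<^sup>2\<close> supplies the dominating function.
\<close>

lemma laplace_one_sided:
  fixes f :: "real \<Rightarrow> real"
  assumes "0 < \<delta>" "0 < k" and cont: "continuous_on UNIV f"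
    and neg: "\<And>t. t \<in> {0<..\<delta>} \<Longrightarrow> f t < 0"
    and quad: "((\<lambda>t. f t / t\<^sup>2) \<longlongrightarrow> - k / 2) (at_right 0)"
  shows "((\<lambda>\<epsilon>. integral {0..\<delta>} (\<lambda>t. exp (f t / \<epsilon>)) / sqrt \<epsilon>)
    \<longlongrightarrow> sqrt (pi / (2 * k))) (at_right 0)"
proof -
  have "\<forall>\<^sub>F t in at_right 0. f t / t\<^sup>2 < - k / 4"
    by (rule order_tendstoD(2)[OF quad]) (use \<open>0 < k\<close> in auto)
  then obtain d where d: "0 < d" "\<And>t. 0 < t \<Longrightarrow> t < d \<Longrightarrow> f t / t\<^sup>2 < - k / 4"
    by (auto simp: eventually_at_right_field)
  obtain \<mu> where \<mu>: "0 < \<mu>" "\<And>t. t \<in> {d..\<delta>} \<Longrightarrow> f t \<le> - \<mu>"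
    by (rule negative_max_on_compact[of "{d..\<delta>}" f])
       (use cont neg d(1) in \<open>auto intro: continuous_on_subset\<close>)
  define c where "c = min (k / 4) (\<mu> / \<delta>\<^sup>2)"
  have c: "0 < c" using \<open>0 < k\<close> \<open>0 < \<mu>\<close> \<open>0 < \<delta>\<close> by (auto simp: c_def)
  have c_le: "c \<le> k / 4" "c \<le> \<mu> / \<delta>\<^sup>2"
    unfolding c_def by (rule min.cobounded1 min.cobounded2)+
  have bound: "f t \<le> - c * t\<^sup>2" if "0 < t" "t \<le> \<delta>" for t
  proof (cases "t < d")
    case True
    then have "f t < - (k / 4) * t\<^sup>2" using d(2)[OF that(1)] that(1)
      by (simp add: field_simps)
    also have "\<dots> \<le> - c * t\<^sup>2"
      by (rule mult_right_mono) (use c_le in auto)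
    finally show ?thesis by simp
  next
    case False
    then have "f t \<le> - \<mu>" using \<mu>(2) that by auto
    also have "\<mu> / \<delta>\<^sup>2 * t\<^sup>2 \<le> \<mu>"
    proof -
      have "t\<^sup>2 \<le> \<delta>\<^sup>2" using that by (intro power_mono) auto
      then show ?thesis using \<open>0 < \<mu>\<close> \<open>0 < \<delta>\<close> by (simp add: field_simps)
    qed
    then have "- \<mu> \<le> - (\<mu> / \<delta>\<^sup>2) * t\<^sup>2" by simp
    also have "\<dots> \<le> - c * t\<^sup>2"
      by (rule mult_right_mono) (use c_le in auto)
    finally show ?thesis .
  qed
  have fm [measurable]: "f \<in> borel_measurable borel"
    using cont by (rule borel_measurable_continuous_onI)
  define g where "g \<tau> s = indicator {0..\<delta>} (s / sqrt \<tau>) * exp (\<tau> * f (s / sqrt \<tau>))" for \<tau> s :: real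
  have lim: "((\<lambda>\<tau>. integral\<^sup>L lborel (g \<tau>))
    \<longlongrightarrow> (\<integral>s. indicator {0..} s * exp (- k / 2 * s\<^sup>2) \<partial>lborel)) at_top"
  proof (rule integral_dominated_convergence_at_top)
    show "integrable lborel (\<lambda>s. indicator {0..} s * exp (- c * s\<^sup>2))"
      using c by (rule half_gaussian_integrable)
    show "(\<lambda>s. indicator {0..} s * exp (- k / 2 * s\<^sup>2)) \<in> borel_measurable lborel"
      by measurable
    show "g \<tau> \<in> borel_measurable lborel" for \<tau>
      unfolding g_def by measurable
    have ne: "AE s in lborel. s \<noteq> (0::real)"
      by (rule AE_lborel_singleton)
    show "AE s in lborel. ((\<lambda>\<tau>. g \<tau> s) \<longlongrightarrow> indicator {0..} s * exp (- k / 2 * s\<^sup>2)) at_top"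
      using ne
    proof eventually_elim
      fix s :: real assume "s \<noteq> 0"
      have to0: "filterlim (\<lambda>\<tau>. s / sqrt \<tau>) (at_right 0) at_top" if "0 < s"
      proof -
        have "((\<lambda>\<tau>. s / sqrt \<tau>) \<longlongrightarrow> 0) at_top"
          by (rule real_tendsto_divide_at_top[OF tendsto_const sqrt_at_top])
        then show ?thesis using that
          by (auto simp: filterlim_at intro!: eventually_mono[OF eventually_gt_at_top[of 0]])
      qed
      show "((\<lambda>\<tau>. g \<tau> s) \<longlongrightarrow> indicator {0..} s * exp (- k / 2 * s\<^sup>2)) at_top"
      proof (cases "0 < s")
        case True
        have "((\<lambda>\<tau>. exp (f (s / sqrt \<tau>) / (s / sqrt \<tau>)\<^sup>2 * s\<^sup>2)) \<longlongrightarrow> exp (- k / 2 * s\<^sup>2)) at_top"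
          by (intro tendsto_intros filterlim_compose[OF quad to0] True)
        moreover have "\<forall>\<^sub>F \<tau> in at_top. exp (f (s / sqrt \<tau>) / (s / sqrt \<tau>)\<^sup>2 * s\<^sup>2) = g \<tau> s"
        proof -
          have "\<forall>\<^sub>F x in at_right 0. x \<in> {0<..<\<delta>}"
            using \<open>0 < \<delta>\<close> by (rule eventually_at_right_real)
          then have "\<forall>\<^sub>F \<tau> in at_top. s / sqrt \<tau> \<in> {0<..<\<delta>}"
            by (rule eventually_compose_filterlim[OF _ to0[OF True]])
          then show ?thesis using eventually_gt_at_top[of 0]
            by eventually_elim (use True in \<open>auto simp: g_def power_divide field_simps\<close>)
        qed
        ultimately show ?thesis using True by (simp add: tendsto_cong)
      next
        case False
        then have "s < 0" using \<open>s \<noteq> 0\<close> by simp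
        have "\<forall>\<^sub>F \<tau> in at_top. g \<tau> s = 0"
          using eventually_gt_at_top[of 0]
          by eventually_elim (use \<open>s < 0\<close> in \<open>auto simp: g_def divide_neg_pos zero_le_divide_iff indicator_def\<close>)
        then show ?thesis using \<open>s < 0\<close> by (simp add: tendsto_eventually)
      qed
    qed
    show "\<forall>\<^sub>F \<tau> in at_top. AE s in lborel. norm (g \<tau> s) \<le> indicator {0..} s * exp (- c * s\<^sup>2)"
      using eventually_gt_at_top[of 0]
    proof eventually_elim
      fix \<tau> :: real assume \<tau>: "0 < \<tau>"
      show "AE s in lborel. norm (g \<tau> s) \<le> indicator {0..} s * exp (- c * s\<^sup>2)"
        using ne
      proof eventually_elim
        fix s :: real assume "s \<noteq> 0"
        show "norm (g \<tau> s) \<le> indicator {0..} s * exp (- c * s\<^sup>2)"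
        proof (cases "s / sqrt \<tau> \<in> {0..\<delta>}")
          case True
          with \<tau> \<open>s \<noteq> 0\<close> have "0 < s" by (auto simp: zero_le_divide_iff)
          with \<tau> have "0 < s / sqrt \<tau>" by simp
          with True have "f (s / sqrt \<tau>) \<le> - c * (s / sqrt \<tau>)\<^sup>2"
            by (intro bound) auto
          then have "\<tau> * f (s / sqrt \<tau>) \<le> \<tau> * (- c * (s / sqrt \<tau>)\<^sup>2)"
            using \<tau> by (intro mult_left_mono) auto
          also have "\<dots> = - c * s\<^sup>2" using \<tau> by (simp add: power_divide)
          finally show ?thesis using \<open>0 < s\<close> by (simp add: g_def indicator_def)
        qed (auto simp: g_def indicator_def)
      qed
    qed
  qed
  have "((\<lambda>\<epsilon>. integral\<^sup>L lborel (g (inverse \<epsilon>))) \<longlongrightarrow> sqrt (pi / (2 * k))) (at_right 0)"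
    using filterlim_compose[OF lim filterlim_inverse_at_top_right]
    by (simp only: half_gaussian_integral[OF \<open>0 < k\<close>])
  moreover have "\<forall>\<^sub>F \<epsilon> in at_right 0. integral\<^sup>L lborel (g (inverse \<epsilon>)) =
      integral {0..\<delta>} (\<lambda>t. exp (f t / \<epsilon>)) / sqrt \<epsilon>"
    using eventually_at_right_less[of 0]
  proof eventually_elim
    fix \<epsilon> :: real assume \<epsilon>: "0 < \<epsilon>"
    have "continuous_on {0..\<delta>} (\<lambda>t. exp (f t / \<epsilon>))"
      using cont \<epsilon> by (auto intro!: continuous_intros continuous_on_subset[of UNIV f])
    then have "set_integrable lborel {0..\<delta>} (\<lambda>t. exp (f t / \<epsilon>))"
      by (rule borel_integrable_atLeastAtMost')
    from set_borel_integral_eq_integral(2)[OF this]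
    have "integral {0..\<delta>} (\<lambda>t. exp (f t / \<epsilon>)) = (\<integral>t. indicator {0..\<delta>} t * exp (f t / \<epsilon>) \<partial>lborel)"
      by (simp add: set_lebesgue_integral_def)
    also have "\<dots> = \<bar>sqrt \<epsilon>\<bar> *\<^sub>R (\<integral>s. indicator {0..\<delta>} (0 + sqrt \<epsilon> * s) * exp (f (0 + sqrt \<epsilon> * s) / \<epsilon>) \<partial>lborel)"
      by (rule lborel_integral_real_affine) (use \<epsilon> in auto)
    also have "(\<lambda>s. indicator {0..\<delta>} (0 + sqrt \<epsilon> * s) * exp (f (0 + sqrt \<epsilon> * s) / \<epsilon>)) = g (inverse \<epsilon>)"
      using \<epsilon> by (auto simp: g_def fun_eq_iff real_sqrt_inverse divide_inverse mult.commute)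
    finally show "integral\<^sup>L lborel (g (inverse \<epsilon>)) = integral {0..\<delta>} (\<lambda>t. exp (f t / \<epsilon>)) / sqrt \<epsilon>"
      using \<epsilon> by simp
  qed
  ultimately show ?thesis by (simp add: tendsto_cong)
qed

text \<open>
  On the plateau \<open>[u, v]\<close> the integrand is 1, so it gives its length; each flank gives half a Gaussian.
\<close>

lemma laplace_plateau:
  fixes f :: "real \<Rightarrow> real"
  assumes "0 < \<delta>" "u \<le> v" "0 < k" "0 < k'" and cont: "continuous_on UNIV f"
    and zero: "\<And>t. t \<in> {u..v} \<Longrightarrow> f t = 0"
    and neg: "\<And>t. t \<in> {u - \<delta>..<u} \<Longrightarrow> f t < 0" "\<And>t. t \<in> {v<..v + \<delta>} \<Longrightarrow> f t < 0"
    and quad: "((\<lambda>t. f (u - t) / t\<^sup>2) \<longlongrightarrow> - k / 2) (at_right 0)"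
              "((\<lambda>t. f (v + t) / t\<^sup>2) \<longlongrightarrow> - k' / 2) (at_right 0)"
  shows "((\<lambda>\<epsilon>. (integral {u - \<delta>..v + \<delta>} (\<lambda>t. exp (f t / \<epsilon>)) - (v - u)) / sqrt \<epsilon>)
    \<longlongrightarrow> sqrt (pi / (2 * k)) + sqrt (pi / (2 * k'))) (at_right 0)"
proof -
  have 1: "((\<lambda>\<epsilon>. integral {0..\<delta>} (\<lambda>t. exp (f (u - t) / \<epsilon>)) / sqrt \<epsilon>)
      \<longlongrightarrow> sqrt (pi / (2 * k))) (at_right 0)"
    using assms by (intro laplace_one_sided)
      (auto intro!: continuous_on_compose2[OF cont] continuous_intros)
  have 2: "((\<lambda>\<epsilon>. integral {0..\<delta>} (\<lambda>t. exp (f (v + t) / \<epsilon>)) / sqrt \<epsilon>)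
      \<longlongrightarrow> sqrt (pi / (2 * k'))) (at_right 0)"
    using assms by (intro laplace_one_sided)
      (auto intro!: continuous_on_compose2[OF cont] continuous_intros)
  have "\<forall>\<^sub>F \<epsilon> in at_right 0.
      integral {0..\<delta>} (\<lambda>t. exp (f (u - t) / \<epsilon>)) / sqrt \<epsilon> +
      integral {0..\<delta>} (\<lambda>t. exp (f (v + t) / \<epsilon>)) / sqrt \<epsilon> =
      (integral {u - \<delta>..v + \<delta>} (\<lambda>t. exp (f t / \<epsilon>)) - (v - u)) / sqrt \<epsilon>"
    using eventually_at_right_less[of 0]
  proof eventually_elim
    fix \<epsilon> :: real assume \<epsilon>: "0 < \<epsilon>"
    let ?g = "\<lambda>t. exp (f t / \<epsilon>)"
    have int: "?g integrable_on {a..c}" for a c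
      using cont \<epsilon> by (auto intro!: integrable_continuous_real continuous_intros continuous_on_subset[of UNIV f])
    have gi: "(?g has_integral integral {a..c} ?g) {a..c}" for a c
      using int by (rule integrable_integral)
    have "integral {u - \<delta>..v + \<delta>} ?g =
      integral {u - \<delta>..u} ?g + (integral {u..v} ?g + integral {v..v + \<delta>} ?g)"
    proof -
      have "integral {u..v} ?g + integral {v..v + \<delta>} ?g = integral {u..v + \<delta>} ?g"
        by (rule Henstock_Kurzweil_Integration.integral_combine) (use assms int in auto)
      moreover have "integral {u - \<delta>..u} ?g + integral {u..v + \<delta>} ?g = integral {u - \<delta>..v + \<delta>} ?g"
        by (rule Henstock_Kurzweil_Integration.integral_combine) (use assms int in auto)
      ultimately show ?thesis by simp
    qed
    moreover have "integral {u..v} ?g = v - u"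
    proof -
      have "integral {u..v} ?g = integral {u..v} (\<lambda>t. 1)"
        by (rule integral_cong) (auto simp: zero)
      then show ?thesis using \<open>u \<le> v\<close> by simp
    qed
    moreover have "integral {u - \<delta>..u} ?g = integral {0..\<delta>} (\<lambda>t. ?g (u - t))"
    proof -
      have "((\<lambda>x. ?g ((-1) *\<^sub>R x + u)) has_integral (1 / \<bar>-1\<bar> ^ DIM(real)) *\<^sub>R integral (cbox (u - \<delta>) u) ?g)
         ((\<lambda>x. (1 / (-1)) *\<^sub>R x + - ((1 / (-1)) *\<^sub>R u)) ` cbox (u - \<delta>) u)"
        by (rule has_integral_affinity) (use gi in auto)
      moreover have "(\<lambda>x::real. (1 / (-1)) *\<^sub>R x + - ((1 / (-1)) *\<^sub>R u)) ` cbox (u - \<delta>) u = {0..\<delta>}"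
      proof -
        have "(\<lambda>x::real. - x + u) ` {u - \<delta>..u} = {0..\<delta>}"
          using image_affinity_atLeastAtMost[of "-1" u "u - \<delta>" u] \<open>0 < \<delta>\<close> by (simp add: algebra_simps)
        then show ?thesis by simp
      qed
      ultimately have "((\<lambda>x. ?g (u - x)) has_integral integral {u - \<delta>..u} ?g) {0..\<delta>}"
        by (simp add: algebra_simps)
      then show ?thesis by (simp add: integral_unique)
    qed
    moreover have "integral {v..v + \<delta>} ?g = integral {0..\<delta>} (\<lambda>t. ?g (v + t))"
      using integral_shift_Icc_real[of 0 \<delta> ?g v] by (simp add: o_def add.commute)
    ultimately show "integral {0..\<delta>} (\<lambda>t. ?g (u - t)) / sqrt \<epsilon> + integral {0..\<delta>} (\<lambda>t. ?g (v + t)) / sqrt \<epsilon> =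
      (integral {u - \<delta>..v + \<delta>} ?g - (v - u)) / sqrt \<epsilon>"
      by (simp add: add_divide_distrib diff_divide_distrib)
  qed
  with tendsto_add[OF 1 2] show ?thesis by (simp add: tendsto_cong)
qed

lemma exp_neg_inverse_small:
  fixes \<eta> :: real
  assumes "0 < \<eta>"
  shows "((\<lambda>\<epsilon>. exp (- \<eta> / \<epsilon>) / \<epsilon>) \<longlongrightarrow> 0) (at_right 0)"
    and "((\<lambda>\<epsilon>. exp (- \<eta> / \<epsilon>) / sqrt \<epsilon>) \<longlongrightarrow> 0) (at_right 0)"
    and "((\<lambda>\<epsilon>. exp (- \<eta> / \<epsilon>)) \<longlongrightarrow> 0) (at_right 0)"
proof -
  have top: "filterlim (\<lambda>\<epsilon>. \<eta> * inverse \<epsilon>) at_top (at_right 0)"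
    by (rule filterlim_tendsto_pos_mult_at_top[OF tendsto_const assms filterlim_inverse_at_top_right])
  have "((\<lambda>\<epsilon>. inverse \<eta> * ((\<eta> * inverse \<epsilon>) ^ 1 / exp (\<eta> * inverse \<epsilon>))) \<longlongrightarrow> inverse \<eta> * 0) (at_right 0)"
    by (intro tendsto_mult tendsto_const filterlim_compose[OF tendsto_power_div_exp_0 top])
  then show 1: "((\<lambda>\<epsilon>. exp (- \<eta> / \<epsilon>) / \<epsilon>) \<longlongrightarrow> 0) (at_right 0)"
    using assms by (simp add: field_simps exp_minus)
  have sq: "((\<lambda>\<epsilon>. sqrt \<epsilon>) \<longlongrightarrow> 0) (at_right 0)"
    using tendsto_real_sqrt[OF tendsto_ident_at, of "0" "{0<..}"] by simp
  have "((\<lambda>\<epsilon>. exp (- \<eta> / \<epsilon>) / \<epsilon> * sqrt \<epsilon>) \<longlongrightarrow> 0 * 0) (at_right 0)"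
    by (rule tendsto_mult[OF 1 sq])
  moreover have "\<forall>\<^sub>F \<epsilon> in at_right 0. exp (- \<eta> / \<epsilon>) / \<epsilon> * sqrt \<epsilon> = exp (- \<eta> / \<epsilon>) / sqrt \<epsilon>"
    using eventually_at_right_less[of 0]
    by eventually_elim (auto simp: field_simps)
  ultimately show 2: "((\<lambda>\<epsilon>. exp (- \<eta> / \<epsilon>) / sqrt \<epsilon>) \<longlongrightarrow> 0) (at_right 0)"
    by (simp add: tendsto_cong)
  have "((\<lambda>\<epsilon>. exp (- \<eta> / \<epsilon>) / sqrt \<epsilon> * sqrt \<epsilon>) \<longlongrightarrow> 0 * 0) (at_right 0)"
    by (rule tendsto_mult[OF 2 sq])
  moreover have "\<forall>\<^sub>F \<epsilon> in at_right 0. exp (- \<eta> / \<epsilon>) / sqrt \<epsilon> * sqrt \<epsilon> = exp (- \<eta> / \<epsilon>)"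
    using eventually_at_right_less[of 0]
    by eventually_elim (auto simp: field_simps)
  ultimately show "((\<lambda>\<epsilon>. exp (- \<eta> / \<epsilon>)) \<longlongrightarrow> 0) (at_right 0)"
    by (simp add: tendsto_cong)
qed

lemma integral_concentrates:
  fixes G :: "real \<Rightarrow> real" and u v :: "'i \<Rightarrow> real"
  assumes "finite A" "a \<le> c" "0 \<le> K"
    and disj: "\<And>i j. i \<in> A \<Longrightarrow> j \<in> A \<Longrightarrow> i \<noteq> j \<Longrightarrow> {u i..v i} \<inter> {u j..v j} = {}"
    and sub: "\<And>i. i \<in> A \<Longrightarrow> {u i..v i} \<subseteq> {a..c}"
    and cont: "continuous_on {a..c} G"
    and bound: "\<And>x. x \<in> {a..c} \<Longrightarrow> (\<And>i. i \<in> A \<Longrightarrow> x \<notin> {u i..v i}) \<Longrightarrow> \<bar>G x\<bar> \<le> K"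
  shows "\<bar>integral {a..c} G - (\<Sum>i\<in>A. integral {u i..v i} G)\<bar> \<le> K * (c - a)"
proof -
  have hG: "(G has_integral integral {a..c} G) {a..c}"
    using cont by (intro integrable_integral integrable_continuous_real)
  have "((\<lambda>x. if x \<in> {u i..v i} then G x else 0) has_integral integral {u i..v i} G) {a..c}"
    if "i \<in> A" for i
  proof -
    have "(G has_integral integral {u i..v i} G) {u i..v i}"
      using cont sub[OF that] by (intro integrable_integral integrable_continuous_real)
        (blast intro: continuous_on_subset)
    then show ?thesis using has_integral_restrict[OF sub[OF that], of G] by simp
  qed
  then have "((\<lambda>x. \<Sum>i\<in>A. if x \<in> {u i..v i} then G x else 0) has_integral
      (\<Sum>i\<in>A. integral {u i..v i} G)) {a..c}"
    by (intro has_integral_sum \<open>finite A\<close>)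
  from has_integral_diff[OF hG this]
  have D: "((\<lambda>x. G x - (\<Sum>i\<in>A. if x \<in> {u i..v i} then G x else 0)) has_integral
      integral {a..c} G - (\<Sum>i\<in>A. integral {u i..v i} G)) {a..c}" .
  have "norm (integral {a..c} G - (\<Sum>i\<in>A. integral {u i..v i} G)) \<le> K * measure lborel {a..c}"
  proof (rule has_integral_bound_real[OF \<open>0 \<le> K\<close> finite.emptyI D])
    fix x assume x: "x \<in> {a..c} - {}"
    show "norm (G x - (\<Sum>i\<in>A. if x \<in> {u i..v i} then G x else 0)) \<le> K"
    proof (cases "\<exists>i\<in>A. x \<in> {u i..v i}")
      case True
      then obtain i where i: "i \<in> A" "x \<in> {u i..v i}" by blast
      have "(\<Sum>j\<in>A. if x \<in> {u j..v j} then G x else 0) = (\<Sum>j\<in>A. if j = i then G x else 0)"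
        using disj i by (intro sum.cong refl) fastforce
      also have "\<dots> = G x" using i \<open>finite A\<close> by simp
      finally show ?thesis using \<open>0 \<le> K\<close> by simp
    next
      case False
      then have "(\<Sum>j\<in>A. if x \<in> {u j..v j} then G x else 0) = 0"
        by (intro sum.neutral) auto
      then show ?thesis using bound[of x] x False by auto
    qed
  qed
  then show ?thesis using \<open>a \<le> c\<close> by simp
qed

lemma eventually_separated_neighbourhoods:
  fixes u v :: "'i \<Rightarrow> real"
  assumes "finite A" and "\<And>i. i \<in> A \<Longrightarrow> u i \<le> v i"
    and disj: "\<And>i j. i \<in> A \<Longrightarrow> j \<in> A \<Longrightarrow> i \<noteq> j \<Longrightarrow> {u i..v i} \<inter> {u j..v j} = {}"
    and sub: "\<And>i. i \<in> A \<Longrightarrow> {u i..v i} \<subseteq> {a<..<c}"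
  shows "\<forall>\<^sub>F \<delta> in at_right 0. (\<forall>i\<in>A. \<forall>j\<in>A. i \<noteq> j \<longrightarrow>
      {u i - \<delta>..v i + \<delta>} \<inter> {u j - \<delta>..v j + \<delta>} = {}) \<and>
      (\<forall>i\<in>A. {u i - \<delta>..v i + \<delta>} \<subseteq> {a..c})"
proof -
  have small: "\<forall>\<^sub>F \<delta> in at_right 0. \<delta> < g \<and> 0 < \<delta>" if "0 < g" for g :: real
    using eventually_at_right_real[OF that] by (rule eventually_mono) auto
  have "\<forall>\<^sub>F \<delta> in at_right 0. i \<noteq> j \<longrightarrow> {u i - \<delta>..v i + \<delta>} \<inter> {u j - \<delta>..v j + \<delta>} = {}"
    if "i \<in> A" "j \<in> A" for i j
  proof (cases "i = j")
    case False
    have "u i \<le> v i" "u j \<le> v j" "{u i..v i} \<inter> {u j..v j} = {}"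
      using assms that False by auto
    then consider "v i < u j" | "v j < u i"
      by (metis (full_types) Int_iff atLeastAtMost_iff empty_iff linorder_not_less nle_le)
    then show ?thesis
    proof cases
      case 1
      then have "0 < (u j - v i) / 2" by simp
      from small[OF this] show ?thesis by eventually_elim (auto simp: field_simps)
    next
      case 2
      then have "0 < (u i - v j) / 2" by simp
      from small[OF this] show ?thesis by eventually_elim (auto simp: field_simps)
    qed
  qed auto
  then have "\<forall>\<^sub>F \<delta> in at_right 0. \<forall>i\<in>A. \<forall>j\<in>A. i \<noteq> j \<longrightarrow>
      {u i - \<delta>..v i + \<delta>} \<inter> {u j - \<delta>..v j + \<delta>} = {}"
    using \<open>finite A\<close> by (intro eventually_ball_finite ballI)
  moreover have "\<forall>\<^sub>F \<delta> in at_right 0. {u i - \<delta>..v i + \<delta>} \<subseteq> {a..c}" if "i \<in> A" for i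
  proof -
    have "u i \<in> {a<..<c}" "v i \<in> {a<..<c}" using assms(2)[OF that] sub[OF that] by auto
    then have "0 < min (u i - a) (c - v i)" by auto
    from small[OF this] show ?thesis by eventually_elim auto
  qed
  then have "\<forall>\<^sub>F \<delta> in at_right 0. \<forall>i\<in>A. {u i - \<delta>..v i + \<delta>} \<subseteq> {a..c}"
    using \<open>finite A\<close> by (intro eventually_ball_finite ballI)
  ultimately show ?thesis by (rule eventually_conj)
qed

text \<open>
  The plateaus have disjoint neighbourhoods, and off these \<open>f\<close> stays below a negative constant by
  compactness. So only the neighbourhoods count, up to an exponentially small error.
\<close>

lemma laplace_finite_plateaus:
  fixes f :: "real \<Rightarrow> real" and u v k k' :: "'i \<Rightarrow> real"
  assumes "finite A" "a \<le> c" and cont: "continuous_on UNIV f"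
    and uv: "\<And>i. i \<in> A \<Longrightarrow> u i \<le> v i"
    and disj: "\<And>i j. i \<in> A \<Longrightarrow> j \<in> A \<Longrightarrow> i \<noteq> j \<Longrightarrow> {u i..v i} \<inter> {u j..v j} = {}"
    and sub: "\<And>i. i \<in> A \<Longrightarrow> {u i..v i} \<subseteq> {a<..<c}"
    and nonpos: "\<And>x. x \<in> {a..c} \<Longrightarrow> f x \<le> 0"
    and zero: "\<And>x. x \<in> {a..c} \<Longrightarrow> f x = 0 \<longleftrightarrow> (\<exists>i\<in>A. x \<in> {u i..v i})"
    and pos: "\<And>i. i \<in> A \<Longrightarrow> 0 < k i" "\<And>i. i \<in> A \<Longrightarrow> 0 < k' i"
    and quad: "\<And>i. i \<in> A \<Longrightarrow> ((\<lambda>t. f (u i - t) / t\<^sup>2) \<longlongrightarrow> - k i / 2) (at_right 0)"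
              "\<And>i. i \<in> A \<Longrightarrow> ((\<lambda>t. f (v i + t) / t\<^sup>2) \<longlongrightarrow> - k' i / 2) (at_right 0)"
  shows "((\<lambda>\<epsilon>. (integral {a..c} (\<lambda>t. exp (f t / \<epsilon>)) - (\<Sum>i\<in>A. v i - u i)) / sqrt \<epsilon>)
    \<longlongrightarrow> (\<Sum>i\<in>A. sqrt (pi / (2 * k i)) + sqrt (pi / (2 * k' i)))) (at_right 0)"
proof -
  have "\<forall>\<^sub>F \<delta> in at_right (0::real). 0 < \<delta>" by (rule eventually_at_right_less)
  moreover have "\<forall>\<^sub>F \<delta> in at_right 0. (\<forall>i\<in>A. \<forall>j\<in>A. i \<noteq> j \<longrightarrow>
      {u i - \<delta>..v i + \<delta>} \<inter> {u j - \<delta>..v j + \<delta>} = {}) \<and>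
      (\<forall>i\<in>A. {u i - \<delta>..v i + \<delta>} \<subseteq> {a..c})"
    by (rule eventually_separated_neighbourhoods[OF \<open>finite A\<close> uv disj sub]) auto
  ultimately have "\<forall>\<^sub>F \<delta> in at_right 0. ((\<forall>i\<in>A. \<forall>j\<in>A. i \<noteq> j \<longrightarrow>
      {u i - \<delta>..v i + \<delta>} \<inter> {u j - \<delta>..v j + \<delta>} = {}) \<and>
      (\<forall>i\<in>A. {u i - \<delta>..v i + \<delta>} \<subseteq> {a..c})) \<and> 0 < \<delta>"
    by (rule eventually_elim2) blast
  then have "\<exists>\<delta>. ((\<forall>i\<in>A. \<forall>j\<in>A. i \<noteq> j \<longrightarrow>
      {u i - \<delta>..v i + \<delta>} \<inter> {u j - \<delta>..v j + \<delta>} = {}) \<and>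
      (\<forall>i\<in>A. {u i - \<delta>..v i + \<delta>} \<subseteq> {a..c})) \<and> 0 < \<delta>"
    by (rule eventually_happens'[rotated]) simp
  then obtain \<delta> where *: "((\<forall>i\<in>A. \<forall>j\<in>A. i \<noteq> j \<longrightarrow>
      {u i - \<delta>..v i + \<delta>} \<inter> {u j - \<delta>..v j + \<delta>} = {}) \<and>
      (\<forall>i\<in>A. {u i - \<delta>..v i + \<delta>} \<subseteq> {a..c})) \<and> 0 < \<delta>" ..
  from * have \<delta>: "0 < \<delta>" ..
  have disj': "\<And>i j. i \<in> A \<Longrightarrow> j \<in> A \<Longrightarrow> i \<noteq> j \<Longrightarrow> {u i - \<delta>..v i + \<delta>} \<inter> {u j - \<delta>..v j + \<delta>} = {}"
    using *[THEN conjunct1, THEN conjunct1] by metis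
  have sub': "\<And>i. i \<in> A \<Longrightarrow> {u i - \<delta>..v i + \<delta>} \<subseteq> {a..c}"
    using *[THEN conjunct1, THEN conjunct2] by metis
  define rest where "rest = {a..c} - (\<Union>i\<in>A. {u i - \<delta><..<v i + \<delta>})"
  have "compact rest" unfolding rest_def by (intro compact_diff) auto
  moreover have "f x < 0" if "x \<in> rest" for x
    using that nonpos[of x] zero[of x] \<delta> by (force simp: rest_def)
  ultimately obtain \<eta> where \<eta>: "0 < \<eta>" "\<And>x. x \<in> rest \<Longrightarrow> f x \<le> - \<eta>"
    using negative_max_on_compact continuous_on_subset[OF cont] by (metis top_greatest)
  let ?g = "\<lambda>\<epsilon> t. exp (f t / \<epsilon>)"
  let ?P = "\<lambda>\<epsilon>. \<Sum>i\<in>A. (integral {u i - \<delta>..v i + \<delta>} (?g \<epsilon>) - (v i - u i)) / sqrt \<epsilon>"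
  have main: "(?P \<longlongrightarrow> (\<Sum>i\<in>A. sqrt (pi / (2 * k i)) + sqrt (pi / (2 * k' i)))) (at_right 0)"
  proof (intro tendsto_sum laplace_plateau)
    fix i assume i: "i \<in> A"
    show "f t = 0" if "t \<in> {u i..v i}" for t
      using that zero[of t] sub[OF i] i by force
    have nz: "f t < 0" if "t \<in> {u i - \<delta>..v i + \<delta>}" "t \<notin> {u i..v i}" for t
    proof -
      have "t \<notin> {u j..v j}" if "j \<in> A" for j
        using disj'[OF i that] \<open>t \<in> {u i - \<delta>..v i + \<delta>}\<close> \<open>t \<notin> {u i..v i}\<close> \<delta>
        by (cases "i = j") (auto simp: set_eq_iff dest!: spec[of _ t])
      then show ?thesis using zero[of t] nonpos[of t] sub'[OF i] that by force
    qed
    show "f t < 0" if "t \<in> {u i - \<delta>..<u i}" for t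
      using nz[of t] that uv[OF i] \<delta> by auto
    show "f t < 0" if "t \<in> {v i<..v i + \<delta>}" for t
      using nz[of t] that uv[OF i] \<delta> by auto
  qed (use assms \<delta> in auto)
  have "((\<lambda>\<epsilon>. (integral {a..c} (?g \<epsilon>) - (\<Sum>i\<in>A. v i - u i)) / sqrt \<epsilon> - ?P \<epsilon>) \<longlongrightarrow> 0) (at_right 0)"
  proof (rule Lim_null_comparison)
    show "((\<lambda>\<epsilon>. (c - a) * (exp (- \<eta> / \<epsilon>) / sqrt \<epsilon>)) \<longlongrightarrow> 0) (at_right 0)"
      using tendsto_mult[OF tendsto_const exp_neg_inverse_small(2)[OF \<eta>(1)], of "c - a"] by simp
    show "\<forall>\<^sub>F \<epsilon> in at_right 0. norm ((integral {a..c} (?g \<epsilon>) - (\<Sum>i\<in>A. v i - u i)) / sqrt \<epsilon> - ?P \<epsilon>)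
        \<le> (c - a) * (exp (- \<eta> / \<epsilon>) / sqrt \<epsilon>)"
      using eventually_at_right_less[of 0]
    proof eventually_elim
      fix \<epsilon> :: real assume \<epsilon>: "0 < \<epsilon>"
      have "\<bar>integral {a..c} (?g \<epsilon>) - (\<Sum>i\<in>A. integral {u i - \<delta>..v i + \<delta>} (?g \<epsilon>))\<bar> \<le> exp (- \<eta> / \<epsilon>) * (c - a)"
      proof (rule integral_concentrates[OF \<open>finite A\<close> \<open>a \<le> c\<close> _ disj' sub'])
        show "continuous_on {a..c} (?g \<epsilon>)"
          using cont \<epsilon> by (auto intro!: continuous_intros continuous_on_subset[of UNIV f])
        fix x assume x: "x \<in> {a..c}" and "\<And>i. i \<in> A \<Longrightarrow> x \<notin> {u i - \<delta>..v i + \<delta>}"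
        then have "x \<in> rest" by (force simp: rest_def)
        then show "\<bar>?g \<epsilon> x\<bar> \<le> exp (- \<eta> / \<epsilon>)"
          using \<eta>(2)[of x] divide_right_mono[of "f x" "- \<eta>" \<epsilon>] \<epsilon> by simp
      qed auto
      moreover have "(integral {a..c} (?g \<epsilon>) - (\<Sum>i\<in>A. v i - u i)) / sqrt \<epsilon> - ?P \<epsilon> =
          (integral {a..c} (?g \<epsilon>) - (\<Sum>i\<in>A. integral {u i - \<delta>..v i + \<delta>} (?g \<epsilon>))) / sqrt \<epsilon>"
        by (simp add: sum_divide_distrib[symmetric] sum_subtractf diff_divide_distrib)
      ultimately show "norm ((integral {a..c} (?g \<epsilon>) - (\<Sum>i\<in>A. v i - u i)) / sqrt \<epsilon> - ?P \<epsilon>)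
        \<le> (c - a) * (exp (- \<eta> / \<epsilon>) / sqrt \<epsilon>)"
        using \<epsilon> by (simp add: abs_divide divide_right_mono mult.commute)
    qed
  qed
  from tendsto_add[OF this main] show ?thesis by simp
qed

text \<open>
  The positivity of \<open>W\<close> turns the absolute error \<open>o(sqrt \<epsilon>)\<close> into a relative one, also when \<open>A = 0\<close>.
\<close>

lemma asymp_equiv_of_expansion:
  fixes I :: "real \<Rightarrow> real"
  assumes "((\<lambda>\<epsilon>. (I \<epsilon> - A) / sqrt \<epsilon>) \<longlongrightarrow> W) (at_right 0)" "0 \<le> A" "0 < W"
  shows "I \<sim>[at_right 0] (\<lambda>\<epsilon>. A + sqrt \<epsilon> * W)"
proof (rule asymp_equivI')
  have "((\<lambda>\<epsilon>. \<bar>(I \<epsilon> - A) / sqrt \<epsilon> - W\<bar> / W) \<longlongrightarrow> \<bar>W - W\<bar> / W) (at_right 0)"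
    by (intro tendsto_intros assms(1)) (use assms in auto)
  then have lim0: "((\<lambda>\<epsilon>. \<bar>(I \<epsilon> - A) / sqrt \<epsilon> - W\<bar> / W) \<longlongrightarrow> 0) (at_right 0)" by simp
  have "((\<lambda>\<epsilon>. I \<epsilon> / (A + sqrt \<epsilon> * W) - 1) \<longlongrightarrow> 0) (at_right 0)"
  proof (rule Lim_null_comparison[OF _ lim0])
    show "\<forall>\<^sub>F \<epsilon> in at_right 0. norm (I \<epsilon> / (A + sqrt \<epsilon> * W) - 1) \<le> \<bar>(I \<epsilon> - A) / sqrt \<epsilon> - W\<bar> / W"
      using eventually_at_right_less[of 0]
    proof eventually_elim
      fix \<epsilon> :: real assume \<epsilon>: "0 < \<epsilon>"
      then have p: "0 < sqrt \<epsilon> * W" "0 < A + sqrt \<epsilon> * W" using assms by (auto intro: add_nonneg_pos)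
      have "I \<epsilon> / (A + sqrt \<epsilon> * W) - 1 = (I \<epsilon> - A - sqrt \<epsilon> * W) / (A + sqrt \<epsilon> * W)"
        using p by (simp add: field_simps)
      then have "norm (I \<epsilon> / (A + sqrt \<epsilon> * W) - 1) = \<bar>I \<epsilon> - A - sqrt \<epsilon> * W\<bar> / (A + sqrt \<epsilon> * W)"
        using p by simp
      also have "\<dots> \<le> \<bar>I \<epsilon> - A - sqrt \<epsilon> * W\<bar> / (sqrt \<epsilon> * W)"
        using p assms by (intro divide_left_mono) auto
      also have "\<dots> = \<bar>(I \<epsilon> - A - sqrt \<epsilon> * W) / (sqrt \<epsilon> * W)\<bar>"
        using p by simp
      also have "(I \<epsilon> - A - sqrt \<epsilon> * W) / (sqrt \<epsilon> * W) = ((I \<epsilon> - A) / sqrt \<epsilon> - W) / W"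
        using \<epsilon> assms by (simp add: field_simps)
      finally show "norm (I \<epsilon> / (A + sqrt \<epsilon> * W) - 1) \<le> \<bar>(I \<epsilon> - A) / sqrt \<epsilon> - W\<bar> / W"
        using assms by simp
    qed
  qed
  from tendsto_add[OF this tendsto_const[of 1]]
  show "((\<lambda>\<epsilon>. I \<epsilon> / (A + sqrt \<epsilon> * W)) \<longlongrightarrow> 1) (at_right 0)" by simp
qed

text \<open>
  Positivity excludes cancellation: every summand is bounded by the whole sum.
\<close>

lemma asymp_equiv_sum_pos:
  fixes f g :: "'i \<Rightarrow> 'a \<Rightarrow> real"
  assumes "finite A"
    and eq: "\<And>i. i \<in> A \<Longrightarrow> f i \<sim>[F] g i"
    and pos: "\<And>i. i \<in> A \<Longrightarrow> \<forall>\<^sub>F x in F. 0 < g i x"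
  shows "(\<lambda>x. \<Sum>i\<in>A. f i x) \<sim>[F] (\<lambda>x. \<Sum>i\<in>A. g i x)"
  using assms
proof (induction A rule: finite_induct)
  case (insert j A)
  have IH: "(\<lambda>x. \<Sum>i\<in>A. f i x) \<sim>[F] (\<lambda>x. \<Sum>i\<in>A. g i x)"
    using insert by auto
  have g: "\<forall>\<^sub>F x in F. \<forall>i\<in>insert j A. 0 < g i x"
    using insert by (intro eventually_ball_finite) auto
  have "(\<lambda>x. f j x - g j x) \<in> o[F](\<lambda>x. \<Sum>i\<in>insert j A. g i x)"
  proof (rule landau_o.small_big_trans)
    show "(\<lambda>x. f j x - g j x) \<in> o[F](g j)"
      using insert.prems(1)[of j] by (intro asymp_equiv_imp_diff_smallo) auto
    show "g j \<in> O[F](\<lambda>x. \<Sum>i\<in>insert j A. g i x)"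
    proof (rule bigoI[of _ 1], use g in eventually_elim)
      fix x assume *: "\<forall>i\<in>insert j A. 0 < g i x"
      then have "0 \<le> (\<Sum>i\<in>A. g i x)" by (intro sum_nonneg) (auto intro: less_imp_le)
      with * show "norm (g j x) \<le> 1 * norm (\<Sum>i\<in>insert j A. g i x)"
        using insert.hyps by auto
    qed
  qed
  moreover have "(\<lambda>x. (\<Sum>i\<in>A. f i x) - (\<Sum>i\<in>A. g i x)) \<in> o[F](\<lambda>x. \<Sum>i\<in>insert j A. g i x)"
  proof (rule landau_o.small_big_trans)
    show "(\<lambda>x. (\<Sum>i\<in>A. f i x) - (\<Sum>i\<in>A. g i x)) \<in> o[F](\<lambda>x. \<Sum>i\<in>A. g i x)"
      using IH by (rule asymp_equiv_imp_diff_smallo)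
    show "(\<lambda>x. \<Sum>i\<in>A. g i x) \<in> O[F](\<lambda>x. \<Sum>i\<in>insert j A. g i x)"
    proof (rule bigoI[of _ 1], use g in eventually_elim)
      fix x assume *: "\<forall>i\<in>insert j A. 0 < g i x"
      then have "0 \<le> (\<Sum>i\<in>A. g i x)" by (intro sum_nonneg) (auto intro: less_imp_le)
      with * show "norm (\<Sum>i\<in>A. g i x) \<le> 1 * norm (\<Sum>i\<in>insert j A. g i x)"
        using insert.hyps by auto
    qed
  qed
  ultimately have "(\<lambda>x. (f j x - g j x) + ((\<Sum>i\<in>A. f i x) - (\<Sum>i\<in>A. g i x)))
      \<in> o[F](\<lambda>x. \<Sum>i\<in>insert j A. g i x)"
    by (rule sum_in_smallo)
  then show ?case
    unfolding asymp_equiv_altdef using insert.hyps by (simp add: algebra_simps)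
qed auto

lemma filterlim_add_at_right: "filterlim (\<lambda>t. v + t) (at_right v) (at_right (0::real))"
proof -
  have "((\<lambda>t. v + t) \<longlongrightarrow> v + 0) (at_right 0)" by (intro tendsto_intros)
  then show ?thesis
    by (auto simp: filterlim_at intro: eventually_mono[OF eventually_at_right_less[of 0]])
qed

lemma filterlim_diff_at_left: "filterlim (\<lambda>t. u - t) (at_left u) (at_right (0::real))"
proof -
  have "((\<lambda>t. u - t) \<longlongrightarrow> u - 0) (at_right 0)" by (intro tendsto_intros)
  then show ?thesis
    by (auto simp: filterlim_at intro: eventually_mono[OF eventually_at_right_less[of 0]])
qed

text \<open>
  L'Hopital's rule gives the limit \<open>- D / 2\<close> of \<open>g t / t\<^sup>2\<close>, and the sign condition then forces
  \<open>\<sigma> * D = \<bar>D\<bar>\<close>. The factor \<open>\<sigma>\<close> is 1 at a maximum and -1 at a minimum of the potential.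
\<close>

lemma quadratic_flank:
  fixes g :: "real \<Rightarrow> real"
  assumes "\<bar>\<sigma>\<bar> = 1" "D \<noteq> 0"
    and g: "\<And>t. (g has_real_derivative g' t) (at t)" "((\<lambda>t. g' t / t) \<longlongrightarrow> - D) (at_right 0)" "g 0 = 0"
    and sgn: "\<forall>\<^sub>F t in at_right 0. \<sigma> * g t \<le> 0"
  shows "((\<lambda>t. \<sigma> * g t / t\<^sup>2) \<longlongrightarrow> - \<bar>D\<bar> / 2) (at_right 0)"
proof -
  have lim: "((\<lambda>t. g t / t\<^sup>2) \<longlongrightarrow> - D / 2) (at_right 0)"
  proof (rule lhopital_right_0[where f' = g' and g' = "\<lambda>t. 2 * t"])
    have "isCont g 0" using g(1) by (rule DERIV_isCont)
    then show "(g \<longlongrightarrow> 0) (at_right 0)"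
      using g(3) by (auto simp: isCont_def filterlim_at_split)
    have "((\<lambda>t. t\<^sup>2 :: real) \<longlongrightarrow> 0\<^sup>2) (at_right 0)" by (intro tendsto_intros)
    then show "((\<lambda>t. t\<^sup>2 :: real) \<longlongrightarrow> 0) (at_right 0)" by simp
    show "\<forall>\<^sub>F x::real in at_right 0. x\<^sup>2 \<noteq> 0" "\<forall>\<^sub>F x::real in at_right 0. 2 * x \<noteq> 0"
      using eventually_at_right_less[of "0::real"] by (auto elim: eventually_mono)
    show "\<forall>\<^sub>F x in at_right 0. (g has_real_derivative g' x) (at x)" using g(1) by simp
    show "\<forall>\<^sub>F x::real in at_right 0. ((\<lambda>t. t\<^sup>2) has_real_derivative 2 * x) (at x)"
      by (intro always_eventually allI) (auto intro!: derivative_eq_intros)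
    have "((\<lambda>t. g' t / t / 2) \<longlongrightarrow> - D / 2) (at_right 0)" by (intro tendsto_intros g(2)) simp
    then show "((\<lambda>x. g' x / (2 * x)) \<longlongrightarrow> - D / 2) (at_right 0)" by (simp add: mult.commute)
  qed
  then have lim': "((\<lambda>t. \<sigma> * (g t / t\<^sup>2)) \<longlongrightarrow> \<sigma> * (- D / 2)) (at_right 0)"
    by (rule tendsto_mult[OF tendsto_const])
  have "\<forall>\<^sub>F t in at_right 0. \<sigma> * (g t / t\<^sup>2) \<le> 0"
    using sgn by eventually_elim (simp add: divide_le_0_iff)
  then have "\<sigma> * (- D / 2) \<le> 0"
    by (intro tendsto_upperbound[OF lim']) auto
  then have "\<sigma> * (- D / 2) = - \<bar>D\<bar> / 2" using assms(1) by (auto simp: abs_if split: if_splits)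
  with lim' show ?thesis by simp
qed

section \<open>The potential, its future maximum and the height\<close>

lemma interval_integral_has_real_derivative:
  fixes g :: "real \<Rightarrow> real"
  assumes "continuous_on UNIV g"
  shows "((\<lambda>u. LBINT y=0..u. g y) has_real_derivative g x) (at x)"
proof -
  define a c where "a = min 0 x - 1" and "c = max 0 x + 1"
  have le: "a \<le> 0" "0 \<le> c" "a \<le> x" "x \<le> c" unfolding a_def c_def by linarith+
  have "continuous_on {a..c} g" using assms by (rule continuous_on_subset) simp
  then have "((\<lambda>u. LBINT y=0..u. g y) has_vector_derivative g x) (at x within {a..c})"
    using interval_integral_FTC2[OF le(1,2) _ le(3,4)] by (simp add: zero_ereal_def)
  moreover have "at x within {a..c} = at x"
    by (rule at_within_Icc_at) (auto simp: a_def c_def)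
  ultimately show ?thesis
    by (simp only: has_real_derivative_iff_has_vector_derivative)
qed

lemma periodic_int:
  fixes f :: "real \<Rightarrow> 'a"
  assumes "\<And>x. f (x + 1) = f x"
  shows "f (x + of_int k) = f x"
proof -
  have nat: "f (x + of_nat n) = f x" for x n
  proof (induction n)
    case (Suc n)
    then show ?case using assms[of "x + of_nat n"] by (simp add: add_ac)
  qed auto
  show ?thesis
    using nat[of x "nat k"] nat[of "x + of_int k" "nat (- k)"] by (cases "0 \<le> k") auto
qed

lemma eventually_nhds_less: "x < c \<Longrightarrow> \<forall>\<^sub>F y in nhds x. y < c" for x c :: real
  using eventually_nhds_in_open[of "{..<c}" x] by auto

lemma eventually_nhds_greater: "c < x \<Longrightarrow> \<forall>\<^sub>F y in nhds x. c < y" for x c :: real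
  using eventually_nhds_in_open[of "{c<..}" x] by auto

locale torus_drift =
  fixes b :: "real \<Rightarrow> real"
  assumes admissible: "admissible_drift b"
begin

abbreviation S :: "real \<Rightarrow> real" where "S \<equiv> pot b"

abbreviation z :: "real \<Rightarrow> real" where "z \<equiv> zmax b"

abbreviation H :: real where "H \<equiv> height b"

lemma b_periodic: "b (x + 1) = b x"
  and b_continuous: "continuous_on UNIV b"
  and b_integral_pos: "integral {0..1} b > 0"
  using admissible by (auto simp: admissible_drift_def)

lemma b_continuous_on: "continuous_on A b"
  using b_continuous by (rule continuous_on_subset) simp

lemma b_periodic_int: "b (x + of_int k) = b x"
  by (rule periodic_int) (rule b_periodic)

lemma S_deriv: "(S has_real_derivative - b x) (at x)"
  using DERIV_minus[OF interval_integral_has_real_derivative[OF b_continuous]]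
  by (simp add: pot_def[abs_def])

lemma S_continuous_on [continuous_intros]: "continuous_on A S"
  using S_deriv by (meson DERIV_continuous_on has_field_derivative_at_within)

lemma S_continuous_compose [continuous_intros]:
  "continuous_on A f \<Longrightarrow> continuous_on A (\<lambda>x. S (f x))"
  by (rule continuous_on_compose2[OF S_continuous_on[of UNIV]]) auto

lemma S_isCont: "isCont S x"
  using S_deriv by (rule DERIV_isCont)

definition B :: real where "B = integral {0..1} b"

lemma B_pos: "0 < B"
  using b_integral_pos by (simp add: B_def)

lemma S_shift: "S (x + 1) = S x - B"
proof -
  have "((\<lambda>x. S (x + 1) - S x) has_real_derivative - b (x + 1) - (- b x)) (at x)" for x
    by (intro DERIV_diff S_deriv) (rule DERIV_shift[THEN iffD1, OF S_deriv])
  then have "((\<lambda>x. S (x + 1) - S x) has_real_derivative 0) (at x)" for x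
    by (simp add: b_periodic)
  then have "S (x + 1) - S x = S (0 + 1) - S 0"
    by (intro DERIV_isconst_all) blast
  moreover have "S 0 = 0" by (simp add: pot_def zero_ereal_def)
  moreover have "S 1 = - B"
  proof -
    have "set_integrable lborel {0..1} b"
      by (rule borel_integrable_atLeastAtMost') (rule b_continuous_on)
    then have "(LBINT y=0..1. b y) = integral {0..1} b"
      using interval_integral_eq_integral[of 0 1 b] by (simp add: zero_ereal_def one_ereal_def)
    then show ?thesis by (simp add: pot_def B_def one_ereal_def zero_ereal_def)
  qed
  ultimately show ?thesis by simp
qed

lemma S_shift_int: "S (x + of_int k) = S x - of_int k * B"
proof -
  have "(\<lambda>x. S x + x * B) (x + of_int k) = S x + x * B"
    by (rule periodic_int[of "\<lambda>x. S x + x * B"]) (simp add: S_shift algebra_simps)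
  then show ?thesis by (simp add: algebra_simps)
qed

text \<open>
  Every point to the right of \<open>x\<close> is an integer translate of a point of \<open>[x, x + 1)\<close>, where \<open>S\<close>
  is larger; so only \<open>[x, x + 1]\<close> matters for the maximum of \<open>S\<close> on \<open>[x, \<infinity>)\<close>.
\<close>

lemma zmax_exists: "\<exists>y. y \<ge> x \<and> (\<forall>w\<ge>x. S w \<le> S y) \<and> (\<forall>w>y. S w < S y)"
proof -
  obtain y0 where y0: "y0 \<in> {x..x + 1}" "\<And>w. w \<in> {x..x + 1} \<Longrightarrow> S w \<le> S y0"
    using continuous_attains_sup[of "{x..x + 1}" S] S_continuous_on by auto
  have glob: "S w \<le> S y0" "w \<ge> x + 1 \<Longrightarrow> S w < S y0" if "w \<ge> x" for w
  proof -
    define k where "k = \<lfloor>w - x\<rfloor>"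
    have k: "0 \<le> k" "x \<le> w - of_int k" "w - of_int k \<le> x + 1"
      using that unfolding k_def by linarith+
    have "S w = S (w - of_int k) - of_int k * B"
      using S_shift_int[of "w - of_int k" k] by simp
    moreover have "S (w - of_int k) \<le> S y0" using k by (intro y0) auto
    moreover have "0 \<le> of_int k * B" using k B_pos by simp
    ultimately show "S w \<le> S y0" by simp
    assume "w \<ge> x + 1"
    then have "1 \<le> k" unfolding k_def by linarith
    then have "0 < of_int k * B" using B_pos by simp
    with \<open>S w = _\<close> \<open>S (w - of_int k) \<le> S y0\<close> show "S w < S y0" by simp
  qed
  define M where "M = {x..x + 1} \<inter> S -` {S y0}"
  have "compact M"
    unfolding M_def by (rule compact_Int_closed[OF compact_Icc])
      (rule continuous_closed_vimage[OF closed_singleton S_isCont])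
  moreover have "M \<noteq> {}" using y0 by (auto simp: M_def)
  ultimately obtain y where y: "y \<in> M" "\<And>w. w \<in> M \<Longrightarrow> w \<le> y"
    using compact_attains_sup[of M] by blast
  have Sy: "S y = S y0" "x \<le> y" using y(1) by (auto simp: M_def)
  have "S w < S y" if "w > y" for w
  proof (cases "w \<le> x + 1")
    case True
    then have "w \<notin> M" using y(2)[of w] that by auto
    then have "S w \<noteq> S y0" using True that Sy by (auto simp: M_def)
    then show ?thesis using glob(1)[of w] that Sy by simp
  next
    case False
    then show ?thesis using glob(2)[of w] that Sy by simp
  qed
  then show ?thesis using Sy glob(1) by auto
qed

lemma zmax_eqI:
  assumes "y \<ge> x" "\<And>w. w \<ge> x \<Longrightarrow> S w \<le> S y" "\<And>w. w > y \<Longrightarrow> S w < S y"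
  shows "z x = y"
  unfolding zmax_def
proof (rule Greatest_equality)
  show "y' \<le> y" if "y' \<ge> x \<and> (\<forall>w\<ge>x. S w \<le> S y')" for y'
    using that assms(1) assms(3)[of y'] by (meson linorder_not_less order.strict_trans2 order_less_irrefl)
qed (use assms in auto)

lemma zmax_ge: "x \<le> z x"
  and zmax_max: "x \<le> w \<Longrightarrow> S w \<le> S (z x)"
  and zmax_greatest: "z x < w \<Longrightarrow> S w < S (z x)"
proof -
  obtain y where y: "y \<ge> x" "\<And>w. w \<ge> x \<Longrightarrow> S w \<le> S y" "\<And>w. w > y \<Longrightarrow> S w < S y"
    using zmax_exists[of x] by blast
  then have "z x = y" by (rule zmax_eqI)
  with y show "x \<le> z x" "x \<le> w \<Longrightarrow> S w \<le> S (z x)" "z x < w \<Longrightarrow> S w < S (z x)" by auto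
qed

lemma zmax_constant: "x \<le> y \<Longrightarrow> y \<le> z x \<Longrightarrow> z y = z x"
  by (rule zmax_eqI) (auto intro: zmax_max zmax_greatest)

lemma zmax_idem: "z (z x) = z x"
  by (rule zmax_constant) (auto intro: zmax_ge)

lemma zmax_shift: "z (x + of_int k) = z x + of_int k"
proof (rule zmax_eqI)
  show "x + of_int k \<le> z x + of_int k" using zmax_ge by simp
  show "S w \<le> S (z x + of_int k)" if "w \<ge> x + of_int k" for w
    using zmax_max[of x "w - of_int k"] that S_shift_int[of "w - of_int k" k]
    by (simp add: S_shift_int)
  show "S w < S (z x + of_int k)" if "w > z x + of_int k" for w
    using zmax_greatest[of x "w - of_int k"] that S_shift_int[of "w - of_int k" k]
    by (simp add: S_shift_int)
qed

lemma zmax_less: "z x < x + 1"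
proof (rule ccontr)
  assume "\<not> z x < x + 1"
  then have "S (z x - 1) \<le> S (z x)" by (intro zmax_max) auto
  then show False using S_shift[of "z x - 1"] B_pos by simp
qed

lemma Vhat_shift: "Vhat b (x + of_int k) = Vhat b x"
  by (simp add: Vhat_def zmax_shift S_shift_int)

text \<open>
  Modulo integer translations a climb starts in \<open>[0, 1]\<close>, and the best one from \<open>x\<close> ends in \<open>[x, x + 1]\<close>;
  so the infimum that defines the height is governed by a continuous function on a compact square.
\<close>

lemma height_attained: "\<exists>x\<in>{0..<1}. S (z x) - S x = H"
  and climb_le_height: "x \<le> y \<Longrightarrow> S y - S x \<le> H"
proof -
  let ?K = "{0..1::real} \<times> {0..1::real}"
  let ?g = "\<lambda>p. S (fst p + snd p) - S (fst p)"
  have "compact ?K" by (intro compact_Times compact_Icc)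
  moreover have "continuous_on ?K ?g" by (intro continuous_intros)
  ultimately obtain p where p: "p \<in> ?K" "\<And>r. r \<in> ?K \<Longrightarrow> ?g r \<le> ?g p"
    using continuous_attains_sup[of ?K ?g] by auto
  have low: "Vhat b x \<ge> - ?g p" for x
  proof -
    define x' where "x' = x - of_int \<lfloor>x\<rfloor>"
    have x': "0 \<le> x'" "x' \<le> 1" unfolding x'_def by linarith+
    have "(x', z x' - x') \<in> ?K" using x' zmax_ge[of x'] zmax_less[of x'] by auto
    from p(2)[OF this] have "- ?g p \<le> Vhat b x'" by (simp add: Vhat_def)
    also have "Vhat b x' = Vhat b x" using Vhat_shift[of x' "\<lfloor>x\<rfloor>"] by (simp add: x'_def)
    finally show ?thesis .
  qed
  \<comment> \<open>The first coordinate 1 represents the same point of the torus as 0.\<close>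
  define x0 where "x0 = (if fst p = 1 then 0 else fst p)"
  have x0: "x0 \<in> {0..<1}" using p(1) by (auto simp: x0_def)
  have "Vhat b x0 = Vhat b (fst p)"
    using Vhat_shift[of 0 1] by (simp add: x0_def)
  also have "\<dots> \<le> - ?g p"
    using zmax_max[of "fst p" "fst p + snd p"] p(1) by (auto simp: Vhat_def)
  finally have x0': "Vhat b x0 = - ?g p" using low[of x0] by simp
  have "(INF x\<in>{0..<1}. Vhat b x) = - ?g p"
    by (rule cInf_eq_minimum) (use x0 x0' low in \<open>auto intro!: image_eqI[of _ _ x0]\<close>)
  then have H: "H = ?g p" by (simp add: height_def)
  show "S y - S x \<le> H" if "x \<le> y" for x y
    using low[of x] zmax_max[OF that] H by (simp add: Vhat_def)
  show "\<exists>x\<in>{0..<1}. S (z x) - S x = H"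
    using x0 x0' H by (intro bexI[of _ x0]) (simp_all add: Vhat_def)
qed

text \<open>
  If \<open>S\<close> were smaller than \<open>S x\<close> somewhere to the left of \<open>y\<close>, the climb from there to \<open>y\<close> would exceed
  \<open>H\<close>; the argument for the end of the climb is symmetric.
\<close>

lemma max_climb_min: "S y - S x = H \<Longrightarrow> w \<le> y \<Longrightarrow> S x \<le> S w"
  using climb_le_height[of w y] by simp

lemma max_climb_max: "S y - S x = H \<Longrightarrow> x \<le> w \<Longrightarrow> S w \<le> S y"
  using climb_le_height[of x w] by simp

lemma max_climb_zmax:
  assumes "S y - S x = H" "x \<le> y"
  shows "S (z x) = S y" "S (z x) - S x = H"
  using max_climb_max[OF assms(1) zmax_ge] zmax_max[OF assms(2)] assms(1) by auto

lemma local_extremum_zero: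
  assumes "(\<forall>\<^sub>F y in nhds x. S y \<le> S x) \<or> (\<forall>\<^sub>F y in nhds x. S x \<le> S y)"
  shows "b x = 0"
proof -
  consider "\<forall>\<^sub>F y in nhds x. S y \<le> S x" | "\<forall>\<^sub>F y in nhds x. S x \<le> S y"
    using assms by blast
  then show ?thesis
  proof cases
    case 1
    then obtain d where "0 < d" "\<And>y. dist y x < d \<Longrightarrow> S y \<le> S x"
      by (auto simp: eventually_nhds_metric)
    then show ?thesis using DERIV_local_max[OF S_deriv, of d x] by (auto simp: dist_real_def abs_minus_commute)
  next
    case 2
    then obtain d where "0 < d" "\<And>y. dist y x < d \<Longrightarrow> S x \<le> S y"
      by (auto simp: eventually_nhds_metric)
    then show ?thesis using DERIV_local_min[OF S_deriv, of d x] by (auto simp: dist_real_def abs_minus_commute)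
  qed
qed

end

section \<open>Components of the zero set of the drift\<close>

context torus_drift
begin

abbreviation Z :: "real set" where "Z \<equiv> {x\<in>{0..<1}. b x = 0}"

lemma components_Z_Icc: "C \<in> components Z \<Longrightarrow> \<exists>u v. 0 < u \<and> u \<le> v \<and> v < 1 \<and> C = {u..v}"
  and finite_components_Z: "finite (components Z)"
  and components_Z_nonempty: "components Z \<noteq> {}"
proof -
  obtain p :: nat and l r where p: "1 \<le> p" and C: "components Z = (\<lambda>j. {l j..r j}) ` {1..p}"
    and l1: "0 < l 1" and lr: "\<And>j. j \<in> {1..p} \<Longrightarrow> l j \<le> r j"
    and rl: "\<And>j. j \<in> {1..<p} \<Longrightarrow> r j < l (Suc j)" and rp: "r p < 1"
    using admissible unfolding admissible_drift_def by metis
  have l: "0 < l j" if "j \<in> {1..p}" for j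
    using that
  proof (induction j)
    case (Suc j)
    show ?case
    proof (cases "j = 0")
      case False
      then show ?thesis using Suc lr[of j] rl[of j] by auto
    qed (use l1 in auto)
  qed auto
  have r: "r j < 1" if "j \<le> p" "1 \<le> j" for j
    using that
  proof (induction j rule: inc_induct)
    case (step n)
    then show ?case using lr[of "Suc n"] rl[of n] by auto
  qed (rule rp)
  show "finite (components Z)" "components Z \<noteq> {}" unfolding C using p by auto
  show "\<exists>u v. 0 < u \<and> u \<le> v \<and> v < 1 \<and> C = {u..v}" if "C \<in> components Z"
    using that l r lr unfolding C by auto
qed

lemma Z_interior: "x \<in> Z \<Longrightarrow> 0 < x"
  using components_Z_Icc[of "connected_component_set Z x"]
  by (force simp: componentsI intro!: connected_component_refl dest: equalityD1)

lemma b_zero_ne: "b 0 \<noteq> 0"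
  using Z_interior[of 0] by auto

text \<open>
  An isolated interval of zeros, described without reference to a fundamental domain so that the
  notion is invariant under integer translations.
\<close>

definition zero_block :: "real \<Rightarrow> real \<Rightarrow> bool" where
  "zero_block u v \<longleftrightarrow> u \<le> v \<and> (\<forall>x\<in>{u..v}. b x = 0) \<and>
     (\<forall>\<^sub>F t in at_right 0. b (v + t) \<noteq> 0) \<and> (\<forall>\<^sub>F t in at_right 0. b (u - t) \<noteq> 0)"

lemma zero_block_shift:
  assumes "zero_block u v"
  shows "zero_block (of_int k + u) (of_int k + v)"
proof -
  have b: "b (of_int k + x) = b x" for x using b_periodic_int[of x k] by (simp add: add.commute)
  have "b x = 0" if "x \<in> {of_int k + u..of_int k + v}" for x
  proof -
    have "x - of_int k \<in> {u..v}" using that by auto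
    then have "b (x - of_int k) = 0" using assms unfolding zero_block_def by blast
    then show ?thesis using b[of "x - of_int k"] by simp
  qed
  moreover have "b (of_int k + v + t) = b (v + t)" "b (of_int k + u - t) = b (u - t)" for t
    using b[of "v + t"] b[of "u - t"] by (simp_all add: algebra_simps)
  ultimately show ?thesis using assms by (simp add: zero_block_def)
qed

text \<open>
  The other components are finitely many closed sets, so they keep a positive distance from \<open>{u..v}\<close>.
\<close>

lemma component_zero_block:
  assumes "{u..v} \<in> components Z" "u \<le> v"
  shows "zero_block u v"
proof -
  have uv: "0 < u" "v < 1"
    using components_Z_Icc[OF assms(1)] assms(2) by (auto simp: Icc_eq_Icc)
  define U where "U = \<Union>(components Z - {{u..v}})"
  have "closed U" unfolding U_def
    using finite_components_Z components_Z_Icc by (intro closed_Union) auto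
  have nU: "x \<notin> U" if "x \<in> {u..v}" for x
  proof
    assume "x \<in> U"
    then obtain C where "C \<in> components Z" "C \<noteq> {u..v}" "x \<in> C" by (auto simp: U_def)
    with components_nonoverlap[OF this(1) assms(1)] that show False by blast
  qed
  have zero: "x \<in> {u..v}" if "x \<in> Z" "x \<notin> U" for x
  proof -
    from that(1) obtain C where "C \<in> components Z" "x \<in> C"
      using Union_components[of Z] by blast
    then show ?thesis using that(2) by (auto simp: U_def)
  qed
  have ev: "\<forall>\<^sub>F y in nhds x. y \<notin> U \<and> 0 < y \<and> y < 1" if "x \<in> {u..v}" for x
    using eventually_nhds_in_open[of "- U" x] eventually_nhds_less[of x 1] eventually_nhds_greater[of 0 x]
      nU[OF that] \<open>closed U\<close> that uv by (auto simp: eventually_conj_iff open_Compl)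
  have "\<forall>\<^sub>F y in at_right v. y \<notin> U \<and> 0 < y \<and> y < 1" "\<forall>\<^sub>F y in at_left u. y \<notin> U \<and> 0 < y \<and> y < 1"
    using ev[of v] ev[of u] assms(2)
    by (auto simp: eventually_at_filter elim: eventually_mono)
  from eventually_compose_filterlim[OF this(1) filterlim_add_at_right]
    eventually_compose_filterlim[OF this(2) filterlim_diff_at_left]
  have 1: "\<forall>\<^sub>F t in at_right 0. v + t \<notin> U \<and> 0 < v + t \<and> v + t < 1"
    and 2: "\<forall>\<^sub>F t in at_right 0. u - t \<notin> U \<and> 0 < u - t \<and> u - t < 1" .
  have "\<forall>\<^sub>F t in at_right 0. b (v + t) \<noteq> 0"
    using 1 eventually_at_right_less[of 0]
  proof eventually_elim
    case (elim t)
    then show ?case using zero[of "v + t"] by auto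
  qed
  moreover have "\<forall>\<^sub>F t in at_right 0. b (u - t) \<noteq> 0"
    using 2 eventually_at_right_less[of 0]
  proof eventually_elim
    case (elim t)
    then show ?case using zero[of "u - t"] by auto
  qed
  moreover have "\<forall>x\<in>{u..v}. b x = 0" using in_components_subset[OF assms(1)] by auto
  ultimately show ?thesis using assms(2) by (simp add: zero_block_def)
qed

lemma zero_gap:
  assumes "b w \<noteq> 0"
  shows "\<exists>c d. c < w \<and> w < d \<and> b c = 0 \<and> b d = 0 \<and> (\<forall>x\<in>{c<..<d}. b x \<noteq> 0)"
proof -
  obtain x0 where x0: "b x0 = 0"
  proof -
    obtain C where C: "C \<in> components Z" using components_Z_nonempty by blast
    from in_components_nonempty[OF this] obtain x where "x \<in> C" by blast
    with in_components_subset[OF C] have "b x = 0" by blast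
    then show ?thesis by (rule that)
  qed
  have closed: "closed {x. b x = 0}"
    using continuous_closed_preimage_constant[OF b_continuous closed_UNIV, of 0] by simp
  define R where "R = {w..} \<inter> {x. b x = 0}"
  define L where "L = {..w} \<inter> {x. b x = 0}"
  have "x0 + of_int \<lceil>w - x0\<rceil> \<in> R" "x0 + of_int \<lfloor>w - x0\<rfloor> \<in> L"
    using b_periodic_int[of x0] x0 by (auto simp: R_def L_def) linarith+
  then have ne: "R \<noteq> {}" "L \<noteq> {}" by auto
  have cl: "closed R" "closed L" unfolding R_def L_def by (intro closed_Int closed closed_atLeast closed_atMost)+
  have bdd: "bdd_below R" "bdd_above L" by (auto simp: R_def L_def)
  have mem: "Inf R \<in> R" "Sup L \<in> L"
    using closed_contains_Inf[OF ne(1) bdd(1) cl(1)] closed_contains_Sup[OF ne(2) bdd(2) cl(2)] by auto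
  have bz: "b (Inf R) = 0" "b (Sup L) = 0" "w \<le> Inf R" "Sup L \<le> w"
    using mem unfolding R_def L_def by simp_all
  have "b x \<noteq> 0" if "x \<in> {Sup L<..<Inf R}" for x
  proof
    assume "b x = 0"
    then have "x \<in> R \<or> x \<in> L" unfolding R_def L_def by auto
    then show False using that cInf_lower[OF _ bdd(1), of x] cSup_upper[OF _ bdd(2), of x] by auto
  qed
  moreover have "Sup L < w" "w < Inf R"
    using bz assms by (metis order.order_iff_strict)+
  ultimately show ?thesis using bz by blast
qed

lemma gap_derivatives:
  assumes "c < d" "b c = 0" "b d = 0" "\<And>x. x \<in> {c<..<d} \<Longrightarrow> b x \<noteq> 0"
  shows "\<exists>D. D \<noteq> 0 \<and> (b has_real_derivative D) (at_right c)"
    and "\<exists>D. D \<noteq> 0 \<and> (b has_real_derivative D) (at_left d)"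
proof -
  have "{c<..<d} \<in> components {x. b x \<noteq> 0}"
    unfolding in_components_maximal
  proof (intro conjI allI impI)
    fix K assume K: "K \<noteq> {} \<and> {c<..<d} \<subseteq> K \<and> K \<subseteq> {x. b x \<noteq> 0} \<and> connected K"
    define w where "w = (c + d) / 2"
    have w: "c < w" "w < d" using assms(1) by (auto simp: w_def)
    then have w': "w \<in> K" using K by auto
    have "y \<in> {c<..<d}" if "y \<in> K" for y
    proof (rule ccontr)
      assume "y \<notin> {c<..<d}"
      then have "c \<in> {y..w} \<or> d \<in> {w..y}" using w by auto
      moreover have "{y..w} \<subseteq> K" "{w..y} \<subseteq> K"
        using connected_contains_Icc K that w' by blast+
      ultimately show False using K assms(2,3) by auto
    qed
    then show "K = {c<..<d}" using K by auto
  qed (use assms in auto)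
  then show "\<exists>D. D \<noteq> 0 \<and> (b has_real_derivative D) (at_right c)"
    and "\<exists>D. D \<noteq> 0 \<and> (b has_real_derivative D) (at_left d)"
    using admissible unfolding admissible_drift_def by blast+
qed

text \<open>
  Just outside the block \<open>b\<close> does not vanish, so each endpoint of the block is also an endpoint of a
  component of \<open>{b \<noteq> 0}\<close>.
\<close>

lemma zero_block_derivatives:
  assumes "zero_block u v"
  shows "\<exists>D. D \<noteq> 0 \<and> (b has_real_derivative D) (at_right v)"
    and "\<exists>D. D \<noteq> 0 \<and> (b has_real_derivative D) (at_left u)"
proof -
  have uv: "b u = 0" "b v = 0" using assms by (auto simp: zero_block_def)
  obtain d where d: "0 < d" "\<And>t. 0 < t \<Longrightarrow> t < d \<Longrightarrow> b (v + t) \<noteq> 0"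
    using assms by (auto simp: zero_block_def eventually_at_right_field)
  obtain c e where ce: "c < v + d / 2" "v + d / 2 < e" "b c = 0" "b e = 0" "\<And>x. x \<in> {c<..<e} \<Longrightarrow> b x \<noteq> 0"
    using zero_gap[of "v + d / 2"] d(2)[of "d / 2"] d(1) by auto
  have "c \<le> v" using d(2)[of "c - v"] ce d(1) by force
  moreover have "v \<le> c" using ce(5)[of v] uv ce(2) d(1) by force
  ultimately show "\<exists>D. D \<noteq> 0 \<and> (b has_real_derivative D) (at_right v)"
    using gap_derivatives(1)[of c e] ce by force
  obtain d where d: "0 < d" "\<And>t. 0 < t \<Longrightarrow> t < d \<Longrightarrow> b (u - t) \<noteq> 0"
    using assms by (auto simp: zero_block_def eventually_at_right_field)
  obtain c e where ce: "c < u - d / 2" "u - d / 2 < e" "b c = 0" "b e = 0" "\<And>x. x \<in> {c<..<e} \<Longrightarrow> b x \<noteq> 0"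
    using zero_gap[of "u - d / 2"] d(2)[of "d / 2"] d(1) by auto
  have "u \<le> e" using d(2)[of "u - e"] ce d(1) by force
  moreover have "e \<le> u" using ce(5)[of u] uv ce(1) d(1) by force
  ultimately show "\<exists>D. D \<noteq> 0 \<and> (b has_real_derivative D) (at_left u)"
    using gap_derivatives(2)[of c e] ce by force
qed

lemma vector_derivative_one_sided:
  "(b has_real_derivative D) (at_right v) \<Longrightarrow> vector_derivative b (at_right v) = D"
  "(b has_real_derivative D) (at_left v) \<Longrightarrow> vector_derivative b (at_left v) = D"
  by (rule vector_derivative_within;
      simp add: has_real_derivative_iff_has_vector_derivative trivial_limit_at_right_real trivial_limit_at_left_real)+

lemma flank_right:
  assumes "zero_block u v" "\<bar>\<sigma>\<bar> = 1"
    and "\<forall>\<^sub>F t in at_right 0. \<sigma> * (S (v + t) - S v) \<le> 0"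
  shows "\<exists>k>0. omega_plus b v = sqrt (pi / (2 * k)) \<and>
    ((\<lambda>t. \<sigma> * (S (v + t) - S v) / t\<^sup>2) \<longlongrightarrow> - k / 2) (at_right 0)"
proof -
  obtain D where D: "D \<noteq> 0" "(b has_real_derivative D) (at_right v)"
    using zero_block_derivatives(1)[OF assms(1)] by blast
  have bv: "b v = 0" using assms(1) by (auto simp: zero_block_def)
  have "((\<lambda>y. b y / (y - v)) \<longlongrightarrow> D) (at_right v)"
    using D(2) bv by (simp add: has_field_derivative_iff)
  from filterlim_compose[OF this filterlim_add_at_right]
  have "((\<lambda>t. b (v + t) / t) \<longlongrightarrow> D) (at_right 0)" by simp
  then have lim: "((\<lambda>t. - b (v + t) / t) \<longlongrightarrow> - D) (at_right 0)"
    using tendsto_minus by fastforce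
  have "((\<lambda>t. \<sigma> * (S (v + t) - S v) / t\<^sup>2) \<longlongrightarrow> - \<bar>D\<bar> / 2) (at_right 0)"
    by (rule quadratic_flank[OF assms(2) D(1) _ lim])
       (use assms(3) in \<open>auto intro!: derivative_eq_intros DERIV_chain2[OF S_deriv]\<close>)
  then show ?thesis using D vector_derivative_one_sided(1)[OF D(2)]
    by (intro exI[of _ "\<bar>D\<bar>"]) (simp add: omega_plus_def)
qed

lemma flank_left:
  assumes "zero_block u v" "\<bar>\<sigma>\<bar> = 1"
    and "\<forall>\<^sub>F t in at_right 0. \<sigma> * (S (u - t) - S u) \<le> 0"
  shows "\<exists>k>0. omega_minus b u = sqrt (pi / (2 * k)) \<and>
    ((\<lambda>t. \<sigma> * (S (u - t) - S u) / t\<^sup>2) \<longlongrightarrow> - k / 2) (at_right 0)"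
proof -
  obtain D where D: "D \<noteq> 0" "(b has_real_derivative D) (at_left u)"
    using zero_block_derivatives(2)[OF assms(1)] by blast
  have bu: "b u = 0" using assms(1) by (auto simp: zero_block_def)
  have "((\<lambda>y. b y / (y - u)) \<longlongrightarrow> D) (at_left u)"
    using D(2) bu by (simp add: has_field_derivative_iff)
  from filterlim_compose[OF this filterlim_diff_at_left]
  have "((\<lambda>t. - (b (u - t) / t)) \<longlongrightarrow> D) (at_right 0)" by simp
  then have lim: "((\<lambda>t. b (u - t) / t) \<longlongrightarrow> - D) (at_right 0)"
    using tendsto_minus by fastforce
  have "((\<lambda>t. \<sigma> * (S (u - t) - S u) / t\<^sup>2) \<longlongrightarrow> - \<bar>D\<bar> / 2) (at_right 0)"
    by (rule quadratic_flank[OF assms(2) D(1) _ lim])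
       (use assms(3) in \<open>auto intro!: derivative_eq_intros DERIV_chain2[OF S_deriv]\<close>)
  then show ?thesis using D vector_derivative_one_sided(2)[OF D(2)]
    by (intro exI[of _ "\<bar>D\<bar>"]) (simp add: omega_minus_def)
qed

lemma S_constant_on_block:
  assumes "\<And>x. x \<in> {u..v} \<Longrightarrow> b x = 0" "x \<in> {u..v}" "y \<in> {u..v}"
  shows "S x = S y"
proof -
  have "(S has_real_derivative 0) (at x within {u..v})" if "x \<in> {u..v}" for x
    using has_field_derivative_at_within[OF S_deriv[of x]] assms(1)[OF that] by simp
  then have "\<exists>c. \<forall>x\<in>{u..v}. S x = c"
    by (intro has_field_derivative_zero_constant) auto
  then show ?thesis using assms by auto
qed

lemma S_leaves_block:
  assumes "zero_block u v"
  shows "\<forall>\<^sub>F t in at_right 0. S (v + t) \<noteq> S v" "\<forall>\<^sub>F t in at_right 0. S (u - t) \<noteq> S u"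
proof -
  obtain d where d: "0 < d" "\<And>t. 0 < t \<Longrightarrow> t < d \<Longrightarrow> b (v + t) \<noteq> 0"
    using assms by (auto simp: zero_block_def eventually_at_right_field)
  have "S (v + t) \<noteq> S v" if t: "0 < t" "t < d" for t
  proof
    assume "S (v + t) = S v"
    then obtain y where "v < y" "y < v + t" "b y = 0"
      using MVT2[of v "v + t" S "\<lambda>y. - b y"] t S_deriv by auto
    then show False using d(2)[of "y - v"] t by auto
  qed
  then show "\<forall>\<^sub>F t in at_right 0. S (v + t) \<noteq> S v"
    unfolding eventually_at_right_field using d(1) by auto
  obtain d where d: "0 < d" "\<And>t. 0 < t \<Longrightarrow> t < d \<Longrightarrow> b (u - t) \<noteq> 0"
    using assms by (auto simp: zero_block_def eventually_at_right_field)
  have "S (u - t) \<noteq> S u" if t: "0 < t" "t < d" for t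
  proof
    assume "S (u - t) = S u"
    then obtain y where "u - t < y" "y < u" "b y = 0"
      using MVT2[of "u - t" u S "\<lambda>y. - b y"] t S_deriv by auto
    then show False using d(2)[of "u - y"] t by auto
  qed
  then show "\<forall>\<^sub>F t in at_right 0. S (u - t) \<noteq> S u"
    unfolding eventually_at_right_field using d(1) by auto
qed

lemma zero_in_component:
  assumes "b y = 0"
  shows "\<exists>C\<in>components Z. y - of_int \<lfloor>y\<rfloor> \<in> C"
proof -
  have "y - of_int \<lfloor>y\<rfloor> \<in> Z"
    using b_periodic_int[of "y - of_int \<lfloor>y\<rfloor>" "\<lfloor>y\<rfloor>"] assms by (auto, linarith+)
  then show ?thesis using Union_components[of Z] by blast
qed

end

section \<open>Landscapes and the functions G0 and G1\<close>

lemma strict_mono_int_succ: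
  fixes f :: "int \<Rightarrow> 'a::order"
  assumes "\<And>k. f k < f (k + 1)"
  shows "strict_mono f"
proof (rule strict_monoI)
  fix i j :: int assume "i < j"
  then show "f i < f j"
  proof (induction j rule: int_gr_induct)
    case (step j)
    then show ?case using assms[of j] by (meson order.strict_trans)
  qed (rule assms)
qed

lemma int_as_representative_plus_period:
  fixes q :: int
  assumes "1 \<le> q"
  shows "\<exists>k' r. k' \<in> {1..q} \<and> k = k' + r * q"
proof (intro exI conjI)
  show "(k - 1) mod q + 1 \<in> {1..q}"
    unfolding atLeastAtMost_iff
    using assms pos_mod_bound[of q "k - 1"] pos_mod_sign[of q "k - 1"] by linarith
  show "k = (k - 1) mod q + 1 + (k - 1) div q * q"
    using div_mult_mod_eq[of "k - 1" q] by linarith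
qed

lemma sum_nth_eq_sum_set:
  assumes "distinct xs"
  shows "(\<Sum>i=1..length xs. g (xs ! (i - 1))) = (\<Sum>x\<in>set xs. g x)"
proof -
  have "(\<Sum>i=1..length xs. g (xs ! (i - 1))) = (\<Sum>i<length xs. g (xs ! i))"
    by (rule sum.reindex_bij_witness[of _ Suc "\<lambda>i. i - 1"]) auto
  also have "\<dots> = (\<Sum>x\<in>set xs. g x)"
    using assms by (intro sum.reindex_bij_betw bij_betw_nth) auto
  finally show ?thesis .
qed

locale landscapes = torus_drift b for b +
  fixes q N :: int and M\<^sub>m M\<^sub>p m\<^sub>m m\<^sub>p :: "int \<Rightarrow> real" and J :: "int \<Rightarrow> int"
  assumes local_extrema: "local_extrema b q M\<^sub>m M\<^sub>p m\<^sub>m m\<^sub>p"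
    and landscape_maxima: "landscape_maxima b q M\<^sub>p N J"
begin

lemma q_pos: "1 \<le> q"
  and M_comps: "max_components b = (\<lambda>k. {M\<^sub>m k..M\<^sub>p k}) ` {1..q}"
  and m_comps: "min_components b = (\<lambda>k. {m\<^sub>m k..m\<^sub>p k}) ` {1..q}"
  and extrema_order: "k \<in> {1..q} \<Longrightarrow> M\<^sub>m k \<le> M\<^sub>p k \<and> M\<^sub>p k < m\<^sub>m k \<and> m\<^sub>m k \<le> m\<^sub>p k"
    "k \<in> {1..<q} \<Longrightarrow> m\<^sub>p k < M\<^sub>m (k + 1)"
  and extrema_bounds: "0 \<le> M\<^sub>m 1" "m\<^sub>p q < 1"
  and M_shift: "M\<^sub>m (k + r * q) = of_int r + M\<^sub>m k" "M\<^sub>p (k + r * q) = of_int r + M\<^sub>p k"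
  using local_extrema unfolding local_extrema_def by blast+

lemma N_pos: "1 \<le> N"
  and J_mono_on: "strict_mono_on {1..N} J"
  and J_image: "J ` {1..N} = {k\<in>{1..q}. zmax b (M\<^sub>p k) = M\<^sub>p k}"
  and J_1: "J 1 = 1"
  and J_shift: "J (n + r * N) = J n + r * q"
  using landscape_maxima unfolding landscape_maxima_def by blast+

lemma M_le: "M\<^sub>m k \<le> M\<^sub>p k"
  and M_less_Suc: "M\<^sub>p k < M\<^sub>m (k + 1)"
proof -
  obtain k' r where k: "k' \<in> {1..q}" "k = k' + r * q"
    using int_as_representative_plus_period[OF q_pos] by blast
  show "M\<^sub>m k \<le> M\<^sub>p k" using extrema_order(1)[OF k(1)] by (simp add: k(2) M_shift)
  show "M\<^sub>p k < M\<^sub>m (k + 1)"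
  proof (cases "k' = q")
    case True
    have "k + 1 = 1 + (r + 1) * q" using True k(2) by (simp add: algebra_simps)
    then have "M\<^sub>m (k + 1) = of_int (r + 1) + M\<^sub>m 1" by (simp only: M_shift)
    then show ?thesis
      using extrema_order(1)[OF k(1)] extrema_bounds True by (simp add: k(2) M_shift)
  next
    case False
    then have k': "k' \<in> {1..<q}" using k(1) by auto
    have "k + 1 = (k' + 1) + r * q" using k(2) by simp
    then have "M\<^sub>m (k + 1) = of_int r + M\<^sub>m (k' + 1)" by (simp only: M_shift)
    then show ?thesis
      using extrema_order(1)[OF k(1)] extrema_order(2)[OF k'] by (simp add: k(2) M_shift)
  qed
qed

lemma M\<^sub>p_strict_mono: "strict_mono M\<^sub>p"
  and M\<^sub>m_strict_mono: "strict_mono M\<^sub>m"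
  using M_le M_less_Suc
  by (intro strict_mono_int_succ; meson order.strict_trans1 order.strict_trans2)+

lemma M_less: "k < k' \<Longrightarrow> M\<^sub>p k < M\<^sub>m k'"
  using M_less_Suc[of k] strict_mono_less_eq[OF M\<^sub>m_strict_mono, of "k + 1" k'] by linarith

lemma M_disjoint: "k \<noteq> k' \<Longrightarrow> {M\<^sub>m k..M\<^sub>p k} \<inter> {M\<^sub>m k'..M\<^sub>p k'} = {}"
  using M_less[of k k'] M_less[of k' k] by (cases k k' rule: linorder_cases) auto

lemma J_strict_mono: "strict_mono J"
proof (rule strict_mono_int_succ)
  fix n
  obtain n' r where n: "n' \<in> {1..N}" "n = n' + r * N"
    using int_as_representative_plus_period[OF N_pos] by blast
  show "J n < J (n + 1)"
  proof (cases "n' = N")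
    case True
    have "n + 1 = 1 + (r + 1) * N" using True n(2) by (simp add: algebra_simps)
    then have "J (n + 1) = 1 + (r + 1) * q" by (simp only: J_shift J_1)
    moreover have "J N \<in> J ` {1..N}" using N_pos by (intro imageI) simp
    then have "J N \<le> q" unfolding J_image by simp
    moreover have "J n = J N + r * q" using True n(2) J_shift by simp
    ultimately show ?thesis by (simp add: ring_distribs)
  next
    case False
    then have "J n' < J (n' + 1)" using strict_mono_onD[OF J_mono_on] n(1) by auto
    moreover have "n + 1 = (n' + 1) + r * N" using n(2) by simp
    then have "J (n + 1) = J (n' + 1) + r * q" by (simp only: J_shift)
    ultimately show ?thesis by (simp add: n(2) J_shift)
  qed
qed

lemma zmax_M_J: "z (M\<^sub>p (J n)) = M\<^sub>p (J n)"
proof -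
  obtain n' r where n: "n' \<in> {1..N}" "n = n' + r * N"
    using int_as_representative_plus_period[OF N_pos] by blast
  have "J n' \<in> J ` {1..N}" using n(1) by (rule imageI)
  then have "z (M\<^sub>p (J n')) = M\<^sub>p (J n')" unfolding J_image by simp
  then show ?thesis using zmax_shift[of "M\<^sub>p (J n')" r] by (simp add: n(2) J_shift M_shift add.commute)
qed

lemma M_J_ex:
  assumes "z (M\<^sub>p k) = M\<^sub>p k"
  shows "\<exists>n. k = J n"
proof -
  obtain k' r where k: "k' \<in> {1..q}" "k = k' + r * q"
    using int_as_representative_plus_period[OF q_pos] by blast
  have "z (M\<^sub>p k') = M\<^sub>p k'"
    using assms zmax_shift[of "M\<^sub>p k'" r] by (simp add: k(2) M_shift add.commute)
  then have "k' \<in> J ` {1..N}" unfolding J_image using k(1) by simp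
  then obtain n where "k' = J n" by blast
  then have "k = J (n + r * N)" using J_shift[of n r] k(2) by simp
  then show ?thesis by blast
qed

lemma M_component: "k \<in> {1..q} \<Longrightarrow> {M\<^sub>m k..M\<^sub>p k} \<in> components Z"
  using M_comps unfolding max_components_def by blast

lemma M_zero_block: "zero_block (M\<^sub>m k) (M\<^sub>p k)"
proof -
  obtain k' r where k: "k' \<in> {1..q}" "k = k' + r * q"
    using int_as_representative_plus_period[OF q_pos] by blast
  have "zero_block (M\<^sub>m k') (M\<^sub>p k')"
    using M_component[OF k(1)] M_le by (rule component_zero_block)
  then show ?thesis using zero_block_shift by (simp add: k(2) M_shift)
qed

lemma S_constant_on_M: "x \<in> {M\<^sub>m k..M\<^sub>p k} \<Longrightarrow> y \<in> {M\<^sub>m k..M\<^sub>p k} \<Longrightarrow> S x = S y"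
  using M_zero_block[of k] unfolding zero_block_def by (intro S_constant_on_block[of "M\<^sub>m k" "M\<^sub>p k"]) auto

text \<open>
  The component of \<open>{b = 0}\<close> containing \<open>y\<close> cannot reach \<open>m\<close>, because \<open>S\<close> is constant on it; hence
  all its points are maxima of \<open>S\<close> on \<open>[m, \<infinity>)\<close>.
\<close>

lemma future_max_in_M:
  assumes "m < y" "S m < S y" and max: "\<And>w. m \<le> w \<Longrightarrow> S w \<le> S y"
  shows "\<exists>k. y \<in> {M\<^sub>m k..M\<^sub>p k} \<and> m < M\<^sub>m k"
proof -
  have "\<forall>\<^sub>F w in nhds y. S w \<le> S y"
    using eventually_nhds_greater[OF assms(1)] by eventually_elim (simp add: max)
  then have "b y = 0" using local_extremum_zero by blast
  then obtain C where C: "C \<in> components Z" "y - of_int \<lfloor>y\<rfloor> \<in> C"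
    using zero_in_component by blast
  define r where "r = \<lfloor>y\<rfloor>"
  obtain u v where uv: "u \<le> v" "C = {u..v}" using components_Z_Icc[OF C(1)] by blast
  have "zero_block (of_int r + u) (of_int r + v)"
    using component_zero_block C(1) uv zero_block_shift by blast
  then have const: "S x = S x'" if "x \<in> {of_int r + u..of_int r + v}" "x' \<in> {of_int r + u..of_int r + v}" for x x'
    using that unfolding zero_block_def by (intro S_constant_on_block[of "of_int r + u" "of_int r + v"]) auto
  have y: "y \<in> {of_int r + u..of_int r + v}" using C(2) uv by (auto simp: r_def)
  have m: "m < of_int r + u"
  proof (rule ccontr)
    assume "\<not> m < of_int r + u"
    then have "m \<in> {of_int r + u..of_int r + v}" using y assms(1) by auto
    from const[OF this y] show False using assms(2) by simp
  qed
  have "C \<in> max_components b"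
    unfolding max_components_def
  proof (intro CollectI conjI ballI C(1))
    fix x assume "x \<in> C"
    then have x: "x + of_int r \<in> {of_int r + u..of_int r + v}" using uv by auto
    then have "m - of_int r < x" using m by auto
    from eventually_nhds_greater[OF this] show "\<forall>\<^sub>F w in nhds x. S w \<le> S x"
    proof eventually_elim
      case (elim w)
      then have "S (w + of_int r) \<le> S y" by (intro max) auto
      also have "S y = S (x + of_int r)" using const[OF y x] .
      finally show ?case by (simp add: S_shift_int)
    qed
  qed
  then obtain k where k: "k \<in> {1..q}" "C = {M\<^sub>m k..M\<^sub>p k}" using M_comps by blast
  then have "u = M\<^sub>m k" "v = M\<^sub>p k" using uv M_le[of k] by (auto simp: Icc_eq_Icc)
  then have "y \<in> {M\<^sub>m (k + r * q)..M\<^sub>p (k + r * q)} \<and> m < M\<^sub>m (k + r * q)"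
    using y m by (simp add: M_shift)
  then show ?thesis by blast
qed

text \<open>
  The point \<open>z m\<close> lies in a component of maxima; as the last maximum point it is the right end of that
  component, and it is its own \<open>z\<close>.
\<close>

lemma zmax_in_M:
  assumes "S m < S (z m)"
  shows "\<exists>n. z m = M\<^sub>p (J (n + 1))"
proof -
  have "m < z m" using zmax_ge[of m] assms by (cases "z m = m") auto
  then obtain k where k: "z m \<in> {M\<^sub>m k..M\<^sub>p k}" "m < M\<^sub>m k"
    using future_max_in_M[of m "z m"] assms zmax_max by blast
  have "S (M\<^sub>p k) = S (z m)" using S_constant_on_M[of "M\<^sub>p k" k "z m"] k M_le[of k] by auto
  then have "z m = M\<^sub>p k" using zmax_greatest[of m "M\<^sub>p k"] k by force
  moreover have "z (M\<^sub>p k) = M\<^sub>p k" using zmax_idem[of m] calculation by simp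
  then obtain n where "k = J n" using M_J_ex by blast
  ultimately have "z m = M\<^sub>p (J ((n - 1) + 1))" by simp
  then show ?thesis by blast
qed

text \<open>
  At the preceding landscape maximum \<open>S\<close> exceeds \<open>S (z m)\<close>, and at \<open>m\<close> it is smaller, so the level
  \<open>S (z m)\<close> is crossed in between and \<open>ell\<close> lies to the left of \<open>m\<close>. The plateau that starts at \<open>ell\<close> has
  this level and hence ends before \<open>m\<close>; this is why the first term of \<open>G1\<close> vanishes at \<open>m\<close>.
\<close>

lemma landscape_of_point:
  assumes "S m < S (z m)" "z m = M\<^sub>p (J (n + 1))"
  shows "landscape_index b M\<^sub>p J m = n"
    and "S (ell b M\<^sub>p J n) = S (z m)"
    and "ell_plus b M\<^sub>p J n < m"
proof -
  have "m < z m" using zmax_ge[of m] assms by (cases "z m = m") auto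
  have Jn: "M\<^sub>p (J i) < M\<^sub>p (J j)" if "i < j" for i j
    using that strict_monoD[OF J_strict_mono] strict_monoD[OF M\<^sub>p_strict_mono] by blast
  have Jn_le: "M\<^sub>p (J i) \<le> M\<^sub>p (J j)" if "i \<le> j" for i j
    using Jn[of i j] that by (cases "i = j") auto
  have left: "M\<^sub>p (J n) < m"
  proof (rule ccontr)
    assume "\<not> M\<^sub>p (J n) < m"
    then have "z (M\<^sub>p (J n)) = z m"
      using Jn[of n "n + 1"] assms(2) by (intro zmax_constant) auto
    then show False using Jn[of n "n + 1"] zmax_M_J[of n] assms(2) by simp
  qed
  let ?X = "\<lambda>i. {x. x \<ge> M\<^sub>p (J i) \<and> S x = S (M\<^sub>p (J (i + 1)))}"
  have X: "ell b M\<^sub>p J i \<in> ?X i" "ell b M\<^sub>p J i \<le> x" if "x \<in> ?X i" for i x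
  proof -
    have "?X i = {M\<^sub>p (J i)..} \<inter> S -` {S (M\<^sub>p (J (i + 1)))}" by auto
    moreover have "closed ({M\<^sub>p (J i)..} \<inter> S -` {S (M\<^sub>p (J (i + 1)))})"
      by (intro closed_Int closed_atLeast continuous_closed_vimage[OF closed_singleton S_isCont])
    ultimately have cl: "closed (?X i)" by simp
    have bdd: "bdd_below (?X i)" by (rule bdd_belowI[of _ "M\<^sub>p (J i)"]) simp
    have ne: "?X i \<noteq> {}" using that by blast
    show "ell b M\<^sub>p J i \<in> ?X i" unfolding ell_def by (rule closed_contains_Inf[OF ne bdd cl])
    show "ell b M\<^sub>p J i \<le> x" unfolding ell_def by (rule cInf_lower[OF that bdd])
  qed
  have ell_ge: "M\<^sub>p (J i) \<le> ell b M\<^sub>p J i" for i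
    using X(1)[of "M\<^sub>p (J (i + 1))" i] Jn_le[of i "i + 1"] by auto
  have "S (z m) < S (M\<^sub>p (J n))"
    using zmax_greatest[of "M\<^sub>p (J n)" "z m"] Jn[of n "n + 1"] zmax_M_J[of n] assms(2) by simp
  then obtain x where x: "M\<^sub>p (J n) \<le> x" "x \<le> m" "S x = S (z m)"
    using IVT2'[of S m "S (z m)" "M\<^sub>p (J n)"] left assms(1) S_continuous_on by auto
  then have "x \<in> ?X n" using assms(2) by simp
  from X[OF this] have ell: "S (ell b M\<^sub>p J n) = S (z m)" "ell b M\<^sub>p J n \<le> m"
    using x assms(2) by auto
  show "S (ell b M\<^sub>p J n) = S (z m)" by (rule ell)
  have mem: "m \<in> landscape b M\<^sub>p J n"
    using ell(2) \<open>m < z m\<close> assms(2) by (simp add: landscape_def)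
  show "landscape_index b M\<^sub>p J m = n"
    unfolding landscape_index_def
  proof (rule the_equality[where P = "\<lambda>n. m \<in> landscape b M\<^sub>p J n", OF mem])
    fix n' assume "m \<in> landscape b M\<^sub>p J n'"
    then have n': "M\<^sub>p (J n') \<le> m" "m \<le> M\<^sub>p (J (n' + 1))"
      using ell_ge[of n'] by (auto simp: landscape_def)
    show "n' = n"
    proof (cases n' n rule: linorder_cases)
      case less
      then show ?thesis using n'(2) left Jn_le[of "n' + 1" n] by simp
    next
      case greater
      then show ?thesis using n'(1) \<open>m < z m\<close> assms(2) Jn_le[of "n + 1" n'] by simp
    qed
  qed
  let ?E = "{x. x \<ge> ell b M\<^sub>p J n \<and> (\<forall>y\<in>{ell b M\<^sub>p J n..x}. S y = S (ell b M\<^sub>p J n))}"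
  have E_le: "x \<le> m" if "x \<in> ?E" for x
  proof (rule ccontr)
    assume "\<not> x \<le> m"
    then have "m \<in> {ell b M\<^sub>p J n..x}" using ell(2) by simp
    then have "S m = S (ell b M\<^sub>p J n)" using that by blast
    then show False using ell(1) assms(1) by simp
  qed
  have ne: "?E \<noteq> {}" by (rule ex_in_conv[THEN iffD1]) (rule exI[of _ "ell b M\<^sub>p J n"], simp)
  have bdd: "bdd_above ?E" using E_le by (rule bdd_aboveI)
  have "Sup ?E \<in> closure ?E" using ne bdd by (rule closure_contains_Sup)
  moreover have "closure ?E \<subseteq> S -` {S (z m)}"
    using ell(1) by (intro closure_minimal continuous_closed_vimage[OF closed_singleton S_isCont]) auto
  ultimately have "S (Sup ?E) = S (z m)" by auto
  moreover have "Sup ?E \<le> m" using ne E_le by (rule cSup_least)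
  ultimately show "ell_plus b M\<^sub>p J n < m"
    unfolding ell_plus_def using assms(1) by (cases "Sup ?E = m") auto
qed

definition future_maxima :: "real \<Rightarrow> int set" where
  "future_maxima m = {k. m < M\<^sub>m k \<and> M\<^sub>p k \<le> z m \<and> S (M\<^sub>p k) = S (z m)}"

lemma finite_M_between: "finite {k. a \<le> M\<^sub>p k \<and> M\<^sub>p k \<le> c}"
proof (rule finite_subset)
  define r where "r = \<lceil>c - M\<^sub>p 0\<rceil>"
  define r' where "r' = \<lfloor>a - M\<^sub>p 0\<rfloor>"
  have 1: "c \<le> M\<^sub>p (0 + r * q)" by (simp only: M_shift) (simp add: r_def, linarith)
  have 2: "M\<^sub>p (0 + r' * q) \<le> a" by (simp only: M_shift) (simp add: r'_def, linarith)
  show "{k. a \<le> M\<^sub>p k \<and> M\<^sub>p k \<le> c} \<subseteq> {r' * q..r * q}"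
    using 1 2 strict_mono_less_eq[OF M\<^sub>p_strict_mono] by (auto, (meson order_trans)+)
qed auto

lemma finite_future_maxima: "finite (future_maxima m)"
  by (rule finite_subset[OF _ finite_M_between[of m "z m"]])
    (use M_le in \<open>auto simp: future_maxima_def intro: order_trans less_imp_le\<close>)

lemma future_maxima_iff:
  assumes "S m < S (z m)" "m \<le> y"
  shows "S y = S (z m) \<longleftrightarrow> (\<exists>k\<in>future_maxima m. y \<in> {M\<^sub>m k..M\<^sub>p k})"
proof
  assume y: "S y = S (z m)"
  then have "m < y" using assms by (cases "m = y") auto
  then obtain k where k: "y \<in> {M\<^sub>m k..M\<^sub>p k}" "m < M\<^sub>m k"
    using future_max_in_M[of m y] y assms zmax_max by auto
  have Sk: "S (M\<^sub>p k) = S (z m)" using S_constant_on_M[of "M\<^sub>p k" k y] k M_le[of k] y by auto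
  then have "M\<^sub>p k \<le> z m" using zmax_greatest[of m "M\<^sub>p k"] by force
  then show "\<exists>k\<in>future_maxima m. y \<in> {M\<^sub>m k..M\<^sub>p k}" using k Sk by (auto simp: future_maxima_def)
next
  assume "\<exists>k\<in>future_maxima m. y \<in> {M\<^sub>m k..M\<^sub>p k}"
  then obtain k where "k \<in> future_maxima m" "y \<in> {M\<^sub>m k..M\<^sub>p k}" by blast
  then show "S y = S (z m)" using S_constant_on_M[of y k "M\<^sub>p k"] M_le[of k] by (auto simp: future_maxima_def)
qed

lemma G0_eq:
  assumes "S m < S (z m)"
  shows "G0 b M\<^sub>p J m = (\<Sum>k\<in>future_maxima m. M\<^sub>p k - M\<^sub>m k)"
proof -
  obtain n where n: "z m = M\<^sub>p (J (n + 1))" using zmax_in_M[OF assms] by blast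
  note land = landscape_of_point[OF assms n]
  have "((\<lambda>x. if x \<in> {M\<^sub>m k..M\<^sub>p k} then 1 else 0) has_integral M\<^sub>p k - M\<^sub>m k) {m..z m}"
    if "k \<in> future_maxima m" for k
  proof -
    have "{M\<^sub>m k..M\<^sub>p k} \<subseteq> {m..z m}" using that by (auto simp: future_maxima_def)
    moreover have "((\<lambda>x. 1::real) has_integral M\<^sub>p k - M\<^sub>m k) {M\<^sub>m k..M\<^sub>p k}"
      using has_integral_const_real[of "1::real" "M\<^sub>m k" "M\<^sub>p k"] M_le[of k] by simp
    ultimately show ?thesis using has_integral_restrict[of "{M\<^sub>m k..M\<^sub>p k}" "{m..z m}" "\<lambda>x. 1::real"] by simp
  qed
  then have "((\<lambda>x. \<Sum>k\<in>future_maxima m. if x \<in> {M\<^sub>m k..M\<^sub>p k} then 1 else 0) has_integral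
      (\<Sum>k\<in>future_maxima m. M\<^sub>p k - M\<^sub>m k)) {m..z m}"
    by (intro has_integral_sum finite_future_maxima)
  then have "(indicator {y. S y = S (ell b M\<^sub>p J n)} has_integral (\<Sum>k\<in>future_maxima m. M\<^sub>p k - M\<^sub>m k)) {m..z m}"
  proof (rule has_integral_eq[rotated])
    fix x assume x: "x \<in> {m..z m}"
    have iff: "S x = S (z m) \<longleftrightarrow> (\<exists>k\<in>future_maxima m. x \<in> {M\<^sub>m k..M\<^sub>p k})"
      using x by (intro future_maxima_iff assms) auto
    show "(\<Sum>k\<in>future_maxima m. if x \<in> {M\<^sub>m k..M\<^sub>p k} then 1 else 0) = (indicator {y. S y = S (ell b M\<^sub>p J n)} x :: real)"
    proof (cases "\<exists>k\<in>future_maxima m. x \<in> {M\<^sub>m k..M\<^sub>p k}")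
      case True
      then obtain k where k: "k \<in> future_maxima m" "x \<in> {M\<^sub>m k..M\<^sub>p k}" by blast
      have "(\<Sum>k'\<in>future_maxima m. if x \<in> {M\<^sub>m k'..M\<^sub>p k'} then 1 else 0) =
          (\<Sum>k'\<in>future_maxima m. if k' = k then 1 else (0::real))"
        using M_disjoint k by (intro sum.cong refl if_cong) fastforce+
      then show ?thesis using k iff land(2) finite_future_maxima by auto
    next
      case False
      then have "(\<Sum>k'\<in>future_maxima m. if x \<in> {M\<^sub>m k'..M\<^sub>p k'} then 1 else 0) = (0::real)"
        by (intro sum.neutral) auto
      then show ?thesis using False iff land(2) by simp
    qed
  qed
  then show ?thesis
    unfolding G0_def Let_def land(1) n[symmetric] by (rule integral_unique)
qed

text \<open>
  The indicators in \<open>G1\<close> remove the maxima to the left of \<open>m\<close>; no component of maxima of the level of \<open>z m\<close>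
  contains \<open>m\<close>, so both indicators of a component agree. The index \<open>J (n + 1)\<close> is the component of \<open>z m\<close>.
\<close>

lemma G1_eq:
  assumes "S m < S (z m)"
  shows "G1 b M\<^sub>m M\<^sub>p J m = (\<Sum>k\<in>future_maxima m. omega_minus b (M\<^sub>m k) + omega_plus b (M\<^sub>p k))"
proof -
  obtain n where n: "z m = M\<^sub>p (J (n + 1))" using zmax_in_M[OF assms] by blast
  note land = landscape_of_point[OF assms n]
  define L where "L = level_maxima b M\<^sub>m M\<^sub>p J n"
  define xs where "xs = sorted_list_of_set L @ [J (n + 1)]"
  have L: "k \<in> L \<longleftrightarrow> ell_plus b M\<^sub>p J n < M\<^sub>p k \<and> M\<^sub>p k < M\<^sub>m (J (n + 1)) \<and> S (M\<^sub>p k) = S (z m)" for k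
    using land(2) by (auto simp: L_def level_maxima_def)
  have "finite L"
    by (rule finite_subset[OF _ finite_M_between[of "ell_plus b M\<^sub>p J n" "M\<^sub>m (J (n + 1))"]]) (auto simp: L)
  have xs: "set xs = insert (J (n + 1)) L" "distinct xs" "length xs = r_land b M\<^sub>m M\<^sub>p J n"
    using \<open>finite L\<close> M_le[of "J (n + 1)"] by (auto simp: xs_def L r_land_def L_def[symmetric])
  let ?w = "\<lambda>k. omega_minus b (M\<^sub>m k) * of_bool (m < M\<^sub>m k) + omega_plus b (M\<^sub>p k) * of_bool (m \<le> M\<^sub>p k)"
  have "G1 b M\<^sub>m M\<^sub>p J m = (\<Sum>i=1..length xs. ?w (xs ! (i - 1)))"
    using land(3) by (simp add: G1_def Let_def land(1) a_index_def L_def[symmetric] xs_def[symmetric] xs(3))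
  also have "\<dots> = (\<Sum>k\<in>insert (J (n + 1)) L. ?w k)"
    using sum_nth_eq_sum_set[OF xs(2)] xs(1) by simp
  also have "\<dots> = (\<Sum>k\<in>future_maxima m. omega_minus b (M\<^sub>m k) + omega_plus b (M\<^sub>p k))"
  proof (rule sum.mono_neutral_cong_right)
    show "finite (insert (J (n + 1)) L)" using \<open>finite L\<close> by simp
    have top: "k = J (n + 1) \<or> M\<^sub>p k < M\<^sub>m (J (n + 1))" if "M\<^sub>p k \<le> z m" for k
      using that M_less[of k "J (n + 1)"] strict_monoD[OF M\<^sub>p_strict_mono, of "J (n + 1)" k] n
      by (cases k "J (n + 1)" rule: linorder_cases) auto
    show "future_maxima m \<subseteq> insert (J (n + 1)) L"
    proof
      fix k assume k: "k \<in> future_maxima m"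
      then have "ell_plus b M\<^sub>p J n < M\<^sub>p k" using land(3) M_le[of k] by (auto simp: future_maxima_def)
      then show "k \<in> insert (J (n + 1)) L" using top[of k] k by (auto simp: future_maxima_def L)
    qed
    have mem: "S (M\<^sub>p k) = S (z m) \<and> M\<^sub>p k \<le> z m" if "k \<in> insert (J (n + 1)) L" for k
      using that n M_le[of "J (n + 1)"] by (auto simp: L)
    have out: "M\<^sub>p k < m" if "k \<in> insert (J (n + 1)) L" "\<not> m < M\<^sub>m k" for k
    proof (rule ccontr)
      assume "\<not> M\<^sub>p k < m"
      then have "m \<in> {M\<^sub>m k..M\<^sub>p k}" using that(2) by auto
      then have "S m = S (M\<^sub>p k)" using S_constant_on_M[of m k "M\<^sub>p k"] M_le[of k] by auto
      then show False using mem[OF that(1)] assms by simp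
    qed
    show "\<forall>k\<in>insert (J (n + 1)) L - future_maxima m. ?w k = 0"
      using mem out by (fastforce simp: future_maxima_def)
    show "?w k = omega_minus b (M\<^sub>m k) + omega_plus b (M\<^sub>p k)" if "k \<in> future_maxima m" for k
      using that M_le[of k] by (auto simp: future_maxima_def)
  qed
  finally show ?thesis .
qed

lemma future_maxima_nonempty:
  assumes "S m < S (z m)"
  shows "future_maxima m \<noteq> {}"
  using future_maxima_iff[OF assms zmax_ge] by auto

end

section \<open>Asymptotics of the normalising constant\<close>

context torus_drift
begin

definition E :: "real \<Rightarrow> real \<Rightarrow> real" where
  "E \<epsilon> x = (LBINT y=0..x. exp (S y / \<epsilon>))"

lemma exp_S_continuous: "\<epsilon> \<noteq> 0 \<Longrightarrow> continuous_on A (\<lambda>y. exp (S y / \<epsilon>))"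
  by (intro continuous_intros) auto

lemma E_deriv: "\<epsilon> \<noteq> 0 \<Longrightarrow> (E \<epsilon> has_real_derivative exp (S x / \<epsilon>)) (at x)"
  unfolding E_def[abs_def]
  by (rule interval_integral_has_real_derivative[where g = "\<lambda>y. exp (S y / \<epsilon>)"]) (rule exp_S_continuous)

lemma E_continuous: "\<epsilon> \<noteq> 0 \<Longrightarrow> continuous_on A (E \<epsilon>)"
  using E_deriv by (meson DERIV_continuous_on has_field_derivative_at_within)

lemma E_has_integral:
  assumes "\<epsilon> \<noteq> 0" "x \<le> y"
  shows "((\<lambda>w. exp (S w / \<epsilon>)) has_integral E \<epsilon> y - E \<epsilon> x) {x..y}"
proof (rule fundamental_theorem_of_calculus[OF assms(2)])
  show "(E \<epsilon> has_vector_derivative exp (S w / \<epsilon>)) (at w within {x..y})" for w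
    unfolding has_real_derivative_iff_has_vector_derivative[symmetric]
    by (rule has_field_derivative_at_within[OF E_deriv[OF assms(1)]])
qed

lemma E_strict_mono:
  assumes "\<epsilon> \<noteq> 0" "x < y"
  shows "E \<epsilon> x < E \<epsilon> y"
  using assms(2)
proof (rule DERIV_pos_imp_increasing)
  show "\<exists>D. (E \<epsilon> has_real_derivative D) (at w) \<and> 0 < D" for w
    by (intro exI conjI, rule E_deriv[OF assms(1)]) simp
qed

lemma pi_eps_eq:
  assumes "\<epsilon> \<noteq> 0"
  shows "pi_eps b \<epsilon> x = exp (- S x / \<epsilon>) * (E \<epsilon> (x + 1) - E \<epsilon> x)"
proof -
  have "((\<lambda>w. exp (- S x / \<epsilon>) * exp (S w / \<epsilon>)) has_integral exp (- S x / \<epsilon>) * (E \<epsilon> (x + 1) - E \<epsilon> x)) {x..x + 1}"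
    using assms by (intro has_integral_mult_right E_has_integral) auto
  then show ?thesis
    unfolding pi_eps_def
    by (intro integral_unique) (simp add: exp_add[symmetric] diff_divide_distrib add.commute)
qed

lemma pi_eps_continuous:
  assumes "\<epsilon> \<noteq> 0"
  shows "continuous_on A (pi_eps b \<epsilon>)"
proof -
  have "pi_eps b \<epsilon> = (\<lambda>x. exp (- S x / \<epsilon>) * (E \<epsilon> (x + 1) - E \<epsilon> x))"
    by (rule ext) (rule pi_eps_eq[OF assms])
  moreover have "continuous_on A (\<lambda>x. E \<epsilon> (x + 1))"
    by (rule continuous_on_compose2[OF E_continuous[OF assms, of UNIV]]) (auto intro!: continuous_intros)
  ultimately show ?thesis
    using assms by (auto intro!: continuous_intros E_continuous)
qed

lemma pi_eps_pos: "\<epsilon> \<noteq> 0 \<Longrightarrow> 0 < pi_eps b \<epsilon> x"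
  by (simp add: pi_eps_eq E_strict_mono)

text \<open>
  The two windows differ by \<open>[a, c]\<close> and its translate by one period, where \<open>S\<close> is smaller still.
\<close>

lemma window_integral_change:
  assumes "0 < \<epsilon>" "a \<le> c" "c \<le> a + 1" and le: "\<And>y. y \<in> {a..c} \<Longrightarrow> S y \<le> L - \<eta>"
  shows "\<bar>integral {a..a + 1} (\<lambda>y. exp ((S y - L) / \<epsilon>)) -
    integral {c..c + 1} (\<lambda>y. exp ((S y - L) / \<epsilon>))\<bar> \<le> exp (- \<eta> / \<epsilon>)"
proof -
  let ?g = "\<lambda>y. exp ((S y - L) / \<epsilon>)"
  have int: "?g integrable_on {u..v}" for u v
    using assms(1) by (intro integrable_continuous_real continuous_intros) auto
  have 1: "integral {a..c} ?g + integral {c..a + 1} ?g = integral {a..a + 1} ?g"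
    by (rule Henstock_Kurzweil_Integration.integral_combine) (use assms int in auto)
  have 2: "integral {c..a + 1} ?g + integral {a + 1..c + 1} ?g = integral {c..c + 1} ?g"
    by (rule Henstock_Kurzweil_Integration.integral_combine) (use assms int in auto)
  have bound: "0 \<le> integral {u..v} ?g \<and> integral {u..v} ?g \<le> exp (- \<eta> / \<epsilon>)"
    if "u \<le> v" "v \<le> u + 1" "\<And>y. y \<in> {u..v} \<Longrightarrow> S y \<le> L - \<eta>" for u v
  proof
    show "0 \<le> integral {u..v} ?g" by (intro integral_nonneg int) auto
    have "integral {u..v} ?g \<le> integral {u..v} (\<lambda>_. exp (- \<eta> / \<epsilon>))"
    proof (intro integral_le int)
      fix y assume "y \<in> {u..v}"
      then have "S y - L \<le> - \<eta>" using that(3) by force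
      from divide_right_mono[OF this, of \<epsilon>] show "?g y \<le> exp (- \<eta> / \<epsilon>)" using assms(1) by simp
    qed auto
    also have "\<dots> = (v - u) * exp (- \<eta> / \<epsilon>)" using that(1) by simp
    also have "\<dots> \<le> 1 * exp (- \<eta> / \<epsilon>)" using that by (intro mult_right_mono) auto
    finally show "integral {u..v} ?g \<le> exp (- \<eta> / \<epsilon>)" by simp
  qed
  have "S y \<le> L - \<eta>" if "y \<in> {a + 1..c + 1}" for y
    using le[of "y - 1"] that S_shift[of "y - 1"] B_pos by auto
  then have "0 \<le> integral {a + 1..c + 1} ?g \<and> integral {a + 1..c + 1} ?g \<le> exp (- \<eta> / \<epsilon>)"
    using assms by (intro bound) auto
  moreover have "0 \<le> integral {a..c} ?g \<and> integral {a..c} ?g \<le> exp (- \<eta> / \<epsilon>)"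
    using assms by (intro bound) auto
  ultimately show ?thesis using 1 2 by linarith
qed

end

context landscapes
begin

lemma m_component: "k \<in> {1..q} \<Longrightarrow> {m\<^sub>m k..m\<^sub>p k} \<in> components Z"
  using m_comps unfolding min_components_def by blast

lemma m_le: "k \<in> {1..q} \<Longrightarrow> m\<^sub>m k \<le> m\<^sub>p k"
  using extrema_order(1) by blast

lemma m_zero_block: "k \<in> {1..q} \<Longrightarrow> zero_block (m\<^sub>m k) (m\<^sub>p k)"
  by (rule component_zero_block[OF m_component m_le])

lemma m_bounds: "k \<in> {1..q} \<Longrightarrow> {m\<^sub>m k..m\<^sub>p k} \<subseteq> {0<..<1}"
  using components_Z_Icc[OF m_component[of k]] m_le[of k] by (auto simp: Icc_eq_Icc)

lemma m_disjoint:
  assumes "i \<in> {1..q}" "j \<in> {1..q}" "i \<noteq> j"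
  shows "{m\<^sub>m i..m\<^sub>p i} \<inter> {m\<^sub>m j..m\<^sub>p j} = {}"
proof -
  have less: "m\<^sub>p i < m\<^sub>m j" if "i \<in> {1..q}" "j \<in> {1..q}" "i < j" for i j
  proof -
    have "m\<^sub>p i < M\<^sub>m (i + 1)" using extrema_order(2)[of i] that by auto
    also have "\<dots> \<le> M\<^sub>m j" using strict_mono_less_eq[OF M\<^sub>m_strict_mono] that by simp
    also have "\<dots> \<le> M\<^sub>p j" by (rule M_le)
    also have "\<dots> < m\<^sub>m j" using extrema_order(1) that by blast
    finally show ?thesis .
  qed
  show ?thesis using less[of i j] less[of j i] assms by (cases i j rule: linorder_cases) auto
qed

text \<open>
  To the right of a component of minima \<open>S\<close> has to increase.
\<close>

lemma height_pos: "0 < H"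
proof -
  have 1: "1 \<in> {1..q}" using q_pos by simp
  have "{m\<^sub>m 1..m\<^sub>p 1} \<in> min_components b" using m_comps 1 by blast
  then have "\<forall>\<^sub>F y in nhds (m\<^sub>p 1). S (m\<^sub>p 1) \<le> S y"
    using m_le[OF 1] by (auto simp: min_components_def)
  then have "\<forall>\<^sub>F y in at_right (m\<^sub>p 1). S (m\<^sub>p 1) \<le> S y"
    by (auto simp: eventually_at_filter elim: eventually_mono)
  then have "\<forall>\<^sub>F t in at_right 0. S (m\<^sub>p 1) \<le> S (m\<^sub>p 1 + t)"
    by (rule eventually_compose_filterlim[OF _ filterlim_add_at_right])
  with S_leaves_block(1)[OF m_zero_block[OF 1]] eventually_at_right_less[of "0::real"]
  have "\<forall>\<^sub>F t in at_right 0. 0 < t \<and> S (m\<^sub>p 1) < S (m\<^sub>p 1 + t)"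
    by eventually_elim auto
  then obtain t where "0 < t" "S (m\<^sub>p 1) < S (m\<^sub>p 1 + t)"
    using eventually_happens'[of "at_right (0::real)"] by (auto simp: trivial_limit_at_right_real)
  then show ?thesis using climb_le_height[of "m\<^sub>p 1" "m\<^sub>p 1 + t"] by simp
qed

definition deepest :: "int set" where
  "deepest = {j\<in>{1..q}. Vhat b (m\<^sub>p j) = - height b}"

lemma deepest_index: "j \<in> deepest \<Longrightarrow> j \<in> {1..q}"
  by (simp add: deepest_def)

lemma deepest_climb: "j \<in> deepest \<Longrightarrow> S (z (m\<^sub>p j)) - S (m\<^sub>p j) = H"
  by (simp add: deepest_def Vhat_def)

lemma deepest_below: "j \<in> deepest \<Longrightarrow> S (m\<^sub>p j) < S (z (m\<^sub>p j))"
  using deepest_climb[of j] height_pos by simp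

text \<open>
  The start of a maximal climb minimises \<open>S\<close> to the left of the end of the climb. As \<open>H > 0\<close>, the
  component of zeros containing the start does not reach that end, so it consists of minima.
\<close>

lemma max_climb_start:
  assumes "x \<in> {0..1}" "x \<le> y" "S y - S x = H"
  shows "\<exists>j\<in>deepest. x \<in> {m\<^sub>m j..m\<^sub>p j}"
proof -
  have "x < y" using assms height_pos by (cases "x = y") auto
  have min: "\<forall>\<^sub>F w' in nhds w. S w \<le> S w'" if "S w = S x" "w < y" for w
    using eventually_nhds_less[OF that(2)]
    by eventually_elim (use that(1) max_climb_min[OF assms(3)] in auto)
  then have "b x = 0" using \<open>x < y\<close> local_extremum_zero by blast
  moreover have "b 1 \<noteq> 0" using b_zero_ne b_periodic[of 0] by simp
  ultimately have "x \<in> Z" using assms(1) by (cases "x = 1") auto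
  then obtain C where C: "C \<in> components Z" "x \<in> C" using Union_components[of Z] by blast
  obtain u v where uv: "u \<le> v" "C = {u..v}" using components_Z_Icc[OF C(1)] by blast
  have const: "S w = S x" if "w \<in> C" for w
    using component_zero_block[of u v] C that uv unfolding zero_block_def
    by (intro S_constant_on_block[of u v]) auto
  have less: "w < y" if "w \<in> C" for w
  proof (rule ccontr)
    assume "\<not> w < y"
    then have "y \<in> C" using that C(2) \<open>x < y\<close> uv by auto
    then show False using const assms(3) height_pos by auto
  qed
  have "C \<in> min_components b"
    unfolding min_components_def using C(1) min const less by blast
  then obtain j where j: "j \<in> {1..q}" "C = {m\<^sub>m j..m\<^sub>p j}" using m_comps by blast
  then have "m\<^sub>p j \<in> C" using m_le by auto
  then have "S (z (m\<^sub>p j)) - S (m\<^sub>p j) = H"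
    using const[of "m\<^sub>p j"] less[of "m\<^sub>p j"] assms(3) by (intro max_climb_zmax(2)[of y]) auto
  then have "j \<in> deepest" using j(1) by (simp add: deepest_def Vhat_def)
  then show ?thesis using C(2) j(2) by blast
qed

lemma deepest_nonempty: "deepest \<noteq> {}"
  using height_attained max_climb_start zmax_ge by fastforce

lemma finite_deepest: "finite deepest"
  by (rule finite_subset[of _ "{1..q}"]) (auto simp: deepest_def)

lemma S_constant_on_m: "k \<in> {1..q} \<Longrightarrow> x \<in> {m\<^sub>m k..m\<^sub>p k} \<Longrightarrow> S x = S (m\<^sub>p k)"
  using m_zero_block[of k] unfolding zero_block_def
  by (intro S_constant_on_block[of "m\<^sub>m k" "m\<^sub>p k"]) auto

text \<open>
  Seen from \<open>m\<close>, the integral of \<open>exp (S / \<epsilon>)\<close> over one period is carried by the plateaus at which \<open>S\<close>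
  attains its maximum over \<open>[m, \<infinity>)\<close>; \<open>G0\<close> is their total length and \<open>G1\<close> the sum of their flanks.
\<close>

lemma window_expansion:
  assumes "S m < S (z m)"
  shows "((\<lambda>\<epsilon>. (integral {m..m + 1} (\<lambda>y. exp ((S y - S (z m)) / \<epsilon>)) - G0 b M\<^sub>p J m) / sqrt \<epsilon>)
      \<longlongrightarrow> G1 b M\<^sub>m M\<^sub>p J m) (at_right 0)"
    and "0 \<le> G0 b M\<^sub>p J m" "0 < G1 b M\<^sub>m M\<^sub>p J m"
proof -
  let ?K = "future_maxima m"
  have K: "m < M\<^sub>m k" "M\<^sub>p k < m + 1" "S (M\<^sub>p k) = S (z m)" "S (M\<^sub>m k) = S (z m)" if "k \<in> ?K" for k
    using that zmax_less[of m] S_constant_on_M[of "M\<^sub>m k" k "M\<^sub>p k"] M_le[of k]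
    by (auto simp: future_maxima_def)
  have "\<exists>k>0. omega_minus b (M\<^sub>m i) = sqrt (pi / (2 * k)) \<and>
      ((\<lambda>t. (S (M\<^sub>m i - t) - S (z m)) / t\<^sup>2) \<longlongrightarrow> - k / 2) (at_right 0)" if i: "i \<in> ?K" for i
  proof -
    have "0 < M\<^sub>m i - m" using K(1)[OF i] by simp
    from eventually_at_right_real[OF this]
    have "\<forall>\<^sub>F t in at_right 0. 1 * (S (M\<^sub>m i - t) - S (M\<^sub>m i)) \<le> 0"
      by (rule eventually_mono) (auto simp: K(4)[OF i] intro!: zmax_max)
    from flank_left[OF M_zero_block _ this] show ?thesis by (simp add: K(4)[OF i])
  qed
  then have "\<forall>i\<in>?K. \<exists>k. 0 < k \<and> omega_minus b (M\<^sub>m i) = sqrt (pi / (2 * k)) \<and>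
      ((\<lambda>t. (S (M\<^sub>m i - t) - S (z m)) / t\<^sup>2) \<longlongrightarrow> - k / 2) (at_right 0)" by blast
  then have "\<exists>k. \<forall>i\<in>?K. 0 < k i \<and> omega_minus b (M\<^sub>m i) = sqrt (pi / (2 * k i)) \<and>
      ((\<lambda>t. (S (M\<^sub>m i - t) - S (z m)) / t\<^sup>2) \<longlongrightarrow> - k i / 2) (at_right 0)" by (rule bchoice)
  then obtain k where "\<forall>i\<in>?K. 0 < k i \<and> omega_minus b (M\<^sub>m i) = sqrt (pi / (2 * k i)) \<and>
      ((\<lambda>t. (S (M\<^sub>m i - t) - S (z m)) / t\<^sup>2) \<longlongrightarrow> - k i / 2) (at_right 0)" ..
  then have k: "\<And>i. i \<in> ?K \<Longrightarrow> 0 < k i"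
    "\<And>i. i \<in> ?K \<Longrightarrow> omega_minus b (M\<^sub>m i) = sqrt (pi / (2 * k i))"
    "\<And>i. i \<in> ?K \<Longrightarrow> ((\<lambda>t. (S (M\<^sub>m i - t) - S (z m)) / t\<^sup>2) \<longlongrightarrow> - k i / 2) (at_right 0)"
    by blast+
  have "\<exists>k>0. omega_plus b (M\<^sub>p i) = sqrt (pi / (2 * k)) \<and>
      ((\<lambda>t. (S (M\<^sub>p i + t) - S (z m)) / t\<^sup>2) \<longlongrightarrow> - k / 2) (at_right 0)" if i: "i \<in> ?K" for i
  proof -
    have "\<forall>\<^sub>F t in at_right 0. 1 * (S (M\<^sub>p i + t) - S (M\<^sub>p i)) \<le> 0"
      using eventually_at_right_less[of "0::real"]
      by (rule eventually_mono) (use K[OF i] M_le[of i] in \<open>auto intro!: zmax_max\<close>)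
    from flank_right[OF M_zero_block _ this] show ?thesis by (simp add: K(3)[OF i])
  qed
  then have "\<forall>i\<in>?K. \<exists>k. 0 < k \<and> omega_plus b (M\<^sub>p i) = sqrt (pi / (2 * k)) \<and>
      ((\<lambda>t. (S (M\<^sub>p i + t) - S (z m)) / t\<^sup>2) \<longlongrightarrow> - k / 2) (at_right 0)" by blast
  then have "\<exists>k. \<forall>i\<in>?K. 0 < k i \<and> omega_plus b (M\<^sub>p i) = sqrt (pi / (2 * k i)) \<and>
      ((\<lambda>t. (S (M\<^sub>p i + t) - S (z m)) / t\<^sup>2) \<longlongrightarrow> - k i / 2) (at_right 0)" by (rule bchoice)
  then obtain k' where "\<forall>i\<in>?K. 0 < k' i \<and> omega_plus b (M\<^sub>p i) = sqrt (pi / (2 * k' i)) \<and>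
      ((\<lambda>t. (S (M\<^sub>p i + t) - S (z m)) / t\<^sup>2) \<longlongrightarrow> - k' i / 2) (at_right 0)" ..
  then have k': "\<And>i. i \<in> ?K \<Longrightarrow> 0 < k' i"
    "\<And>i. i \<in> ?K \<Longrightarrow> omega_plus b (M\<^sub>p i) = sqrt (pi / (2 * k' i))"
    "\<And>i. i \<in> ?K \<Longrightarrow> ((\<lambda>t. (S (M\<^sub>p i + t) - S (z m)) / t\<^sup>2) \<longlongrightarrow> - k' i / 2) (at_right 0)"
    by blast+
  have "((\<lambda>\<epsilon>. (integral {m..m + 1} (\<lambda>y. exp ((S y - S (z m)) / \<epsilon>)) - (\<Sum>i\<in>?K. M\<^sub>p i - M\<^sub>m i)) / sqrt \<epsilon>)
      \<longlongrightarrow> (\<Sum>i\<in>?K. sqrt (pi / (2 * k i)) + sqrt (pi / (2 * k' i)))) (at_right 0)"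
  proof (rule laplace_finite_plateaus[OF finite_future_maxima])
    show "continuous_on UNIV (\<lambda>y. S y - S (z m))" by (intro continuous_intros)
    show "{M\<^sub>m i..M\<^sub>p i} \<subseteq> {m<..<m + 1}" if "i \<in> ?K" for i using K[OF that] by auto
    show "S x - S (z m) \<le> 0" if "x \<in> {m..m + 1}" for x using that zmax_max[of m x] by simp
    show "S x - S (z m) = 0 \<longleftrightarrow> (\<exists>i\<in>?K. x \<in> {M\<^sub>m i..M\<^sub>p i})" if "x \<in> {m..m + 1}" for x
      using that future_maxima_iff[OF assms, of x] by simp
  qed (use k k' M_le M_disjoint in auto)
  then show "((\<lambda>\<epsilon>. (integral {m..m + 1} (\<lambda>y. exp ((S y - S (z m)) / \<epsilon>)) - G0 b M\<^sub>p J m) / sqrt \<epsilon>)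
      \<longlongrightarrow> G1 b M\<^sub>m M\<^sub>p J m) (at_right 0)"
    using k k' by (simp add: G0_eq[OF assms] G1_eq[OF assms])
  show "0 \<le> G0 b M\<^sub>p J m" unfolding G0_eq[OF assms] by (intro sum_nonneg) (simp add: M_le)
  show "0 < G1 b M\<^sub>m M\<^sub>p J m"
    unfolding G1_eq[OF assms]
    by (intro sum_pos finite_future_maxima future_maxima_nonempty assms) (use k k' in \<open>auto intro!: add_pos_pos\<close>)
qed

lemma well_expansion:
  assumes j: "j \<in> deepest" and "0 < \<delta>"
    and above: "\<And>x. x \<in> {m\<^sub>m j - \<delta>..m\<^sub>p j + \<delta>} \<Longrightarrow> x \<notin> {m\<^sub>m j..m\<^sub>p j} \<Longrightarrow> S (m\<^sub>p j) < S x"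
  shows "((\<lambda>\<epsilon>. (integral {m\<^sub>m j - \<delta>..m\<^sub>p j + \<delta>} (\<lambda>x. exp ((S (m\<^sub>p j) - S x) / \<epsilon>)) - (m\<^sub>p j - m\<^sub>m j)) / sqrt \<epsilon>)
      \<longlongrightarrow> sigma b m\<^sub>m m\<^sub>p j) (at_right 0)"
    and "0 < sigma b m\<^sub>m m\<^sub>p j"
proof -
  note jq = deepest_index[OF j]
  have Sm: "S (m\<^sub>m j) = S (m\<^sub>p j)" using S_constant_on_m[OF jq, of "m\<^sub>m j"] m_le[OF jq] by simp
  have small: "\<forall>\<^sub>F t in at_right 0. 0 < t \<and> t < \<delta>"
    using eventually_at_right_real[OF \<open>0 < \<delta>\<close>] by (rule eventually_mono) auto
  have "\<forall>\<^sub>F t in at_right 0. -1 * (S (m\<^sub>m j - t) - S (m\<^sub>m j)) \<le> 0"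
    using small
  proof eventually_elim
    case (elim t)
    then show ?case using above[of "m\<^sub>m j - t"] m_le[OF jq] Sm by auto
  qed
  from flank_left[OF m_zero_block[OF jq] _ this]
  obtain k where k: "0 < k" "omega_minus b (m\<^sub>m j) = sqrt (pi / (2 * k))"
    "((\<lambda>t. (S (m\<^sub>p j) - S (m\<^sub>m j - t)) / t\<^sup>2) \<longlongrightarrow> - k / 2) (at_right 0)"
    by (auto simp: Sm)
  have "\<forall>\<^sub>F t in at_right 0. -1 * (S (m\<^sub>p j + t) - S (m\<^sub>p j)) \<le> 0"
    using small
  proof eventually_elim
    case (elim t)
    then show ?case using above[of "m\<^sub>p j + t"] m_le[OF jq] by auto
  qed
  from flank_right[OF m_zero_block[OF jq] _ this]
  obtain k' where k': "0 < k'" "omega_plus b (m\<^sub>p j) = sqrt (pi / (2 * k'))"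
    "((\<lambda>t. (S (m\<^sub>p j) - S (m\<^sub>p j + t)) / t\<^sup>2) \<longlongrightarrow> - k' / 2) (at_right 0)"
    by auto
  have "((\<lambda>\<epsilon>. (integral {m\<^sub>m j - \<delta>..m\<^sub>p j + \<delta>} (\<lambda>x. exp ((S (m\<^sub>p j) - S x) / \<epsilon>)) - (m\<^sub>p j - m\<^sub>m j)) / sqrt \<epsilon>)
      \<longlongrightarrow> sqrt (pi / (2 * k)) + sqrt (pi / (2 * k'))) (at_right 0)"
  proof (rule laplace_plateau[OF \<open>0 < \<delta>\<close> m_le[OF jq] k(1) k'(1) _ _ _ _ k(3) k'(3)])
    show "continuous_on UNIV (\<lambda>x. S (m\<^sub>p j) - S x)" by (intro continuous_intros)
    show "S (m\<^sub>p j) - S t = 0" if "t \<in> {m\<^sub>m j..m\<^sub>p j}" for t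
      using S_constant_on_m[OF jq that] by simp
    show "S (m\<^sub>p j) - S t < 0" if "t \<in> {m\<^sub>m j - \<delta>..<m\<^sub>m j}" for t
      using above[of t] that m_le[OF jq] \<open>0 < \<delta>\<close> by auto
    show "S (m\<^sub>p j) - S t < 0" if "t \<in> {m\<^sub>p j<..m\<^sub>p j + \<delta>}" for t
      using above[of t] that m_le[OF jq] \<open>0 < \<delta>\<close> by auto
  qed
  then show "((\<lambda>\<epsilon>. (integral {m\<^sub>m j - \<delta>..m\<^sub>p j + \<delta>} (\<lambda>x. exp ((S (m\<^sub>p j) - S x) / \<epsilon>)) - (m\<^sub>p j - m\<^sub>m j)) / sqrt \<epsilon>)
      \<longlongrightarrow> sigma b m\<^sub>m m\<^sub>p j) (at_right 0)"
    by (simp add: sigma_def k k' add.commute)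
  show "0 < sigma b m\<^sub>m m\<^sub>p j" using k k' by (simp add: sigma_def add_pos_pos)
qed

definition well_term :: "int \<Rightarrow> real \<Rightarrow> real" where
  "well_term j \<epsilon> = (G0 b M\<^sub>p J (m\<^sub>p j) + sqrt \<epsilon> * G1 b M\<^sub>m M\<^sub>p J (m\<^sub>p j)) *
     ((m\<^sub>p j - m\<^sub>m j) + sqrt \<epsilon> * sigma b m\<^sub>m m\<^sub>p j)"

lemma Z_eps_eq: "Z_eps b q M\<^sub>m M\<^sub>p m\<^sub>m m\<^sub>p J \<epsilon> = (\<Sum>j\<in>deepest. well_term j \<epsilon>)"
  by (simp add: Z_eps_def well_term_def deepest_def)

text \<open>
  Near a deepest minimum the double integral factorises up to an exponentially small relative error,
  because moving the window \<open>[x, x + 1]\<close> changes it only where \<open>S\<close> is well below its maximum.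
\<close>

lemma well_contribution:
  assumes j: "j \<in> deepest" and "0 < \<delta>" and sub: "{m\<^sub>m j - \<delta>..m\<^sub>p j + \<delta>} \<subseteq> {0..1}"
    and above: "\<And>x. x \<in> {m\<^sub>m j - \<delta>..m\<^sub>p j + \<delta>} \<Longrightarrow> x \<notin> {m\<^sub>m j..m\<^sub>p j} \<Longrightarrow> S (m\<^sub>p j) < S x"
    and below: "\<And>x. x \<in> {m\<^sub>m j - \<delta>..m\<^sub>p j + \<delta>} \<Longrightarrow> S x < S (z (m\<^sub>p j))"
  shows "(\<lambda>\<epsilon>. integral {m\<^sub>m j - \<delta>..m\<^sub>p j + \<delta>} (\<lambda>x. pi_eps b \<epsilon> x * exp (- H / \<epsilon>)))
    \<sim>[at_right 0] well_term j"
proof -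
  note jq = deepest_index[OF j]
  define m where "m = m\<^sub>p j"
  define U where "U = {m\<^sub>m j - \<delta>..m\<^sub>p j + \<delta>}"
  have mU: "m \<in> U" using m_le[OF jq] \<open>0 < \<delta>\<close> by (auto simp: m_def U_def)
  have Sm: "S m < S (z m)" "S (z m) - S m = H" using deepest_below[OF j] deepest_climb[OF j] by (auto simp: m_def)
  obtain \<eta> where \<eta>: "0 < \<eta>" "\<And>x. x \<in> U \<Longrightarrow> S x - S (z m) \<le> - \<eta>"
    by (rule negative_max_on_compact[of U "\<lambda>x. S x - S (z m)"])
       (use below in \<open>auto simp: U_def m_def intro!: continuous_intros\<close>)
  define X where "X \<epsilon> = integral U (\<lambda>x. exp ((S m - S x) / \<epsilon>))" for \<epsilon>
  define P where "P \<epsilon> x = integral {x..x + 1} (\<lambda>y. exp ((S y - S (z m)) / \<epsilon>))" for \<epsilon> x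
  define I where "I \<epsilon> = integral U (\<lambda>x. pi_eps b \<epsilon> x * exp (- H / \<epsilon>))" for \<epsilon>
  have X: "((\<lambda>\<epsilon>. (X \<epsilon> - (m\<^sub>p j - m\<^sub>m j)) / sqrt \<epsilon>) \<longlongrightarrow> sigma b m\<^sub>m m\<^sub>p j) (at_right 0)"
    and sigma: "0 < sigma b m\<^sub>m m\<^sub>p j"
    using well_expansion[OF j \<open>0 < \<delta>\<close> above] by (simp_all add: X_def U_def m_def)
  note win = window_expansion[OF Sm(1)]
  have est: "0 < X \<epsilon> \<and> \<bar>I \<epsilon> / X \<epsilon> - P \<epsilon> m\<bar> \<le> exp (- \<eta> / \<epsilon>)" if \<epsilon>: "0 < \<epsilon>" for \<epsilon>
  proof
    have cont: "continuous_on U (\<lambda>x. exp ((S m - S x) / \<epsilon>))"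
      using \<epsilon> by (intro continuous_intros) auto
    then have Xint: "((\<lambda>x. exp ((S m - S x) / \<epsilon>)) has_integral X \<epsilon>) U"
      unfolding X_def U_def by (intro integrable_integral integrable_continuous_real)
    show Xpos: "0 < X \<epsilon>"
    proof -
      have "compact U" "U \<noteq> {}" using mU by (auto simp: U_def)
      from continuous_attains_inf[OF this cont]
      obtain x where "\<forall>y\<in>U. exp ((S m - S x) / \<epsilon>) \<le> exp ((S m - S y) / \<epsilon>)" by blast
      then have x: "\<And>y. y \<in> U \<Longrightarrow> exp ((S m - S x) / \<epsilon>) \<le> exp ((S m - S y) / \<epsilon>)" by blast
      have "((\<lambda>_. exp ((S m - S x) / \<epsilon>)) has_integral (m\<^sub>p j + \<delta> - (m\<^sub>m j - \<delta>)) *\<^sub>R exp ((S m - S x) / \<epsilon>)) U"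
        unfolding U_def using m_le[OF jq] \<open>0 < \<delta>\<close> by (intro has_integral_const_real[THEN has_integral_eq_rhs]) simp
      from has_integral_le[OF this Xint x] have "(m\<^sub>p j + \<delta> - (m\<^sub>m j - \<delta>)) * exp ((S m - S x) / \<epsilon>) \<le> X \<epsilon>" by simp
      moreover have "0 < (m\<^sub>p j + \<delta> - (m\<^sub>m j - \<delta>)) * exp ((S m - S x) / \<epsilon>)"
        using m_le[OF jq] \<open>0 < \<delta>\<close> by simp
      ultimately show ?thesis by linarith
    qed
    have close: "\<bar>P \<epsilon> x - P \<epsilon> m\<bar> \<le> exp (- \<eta> / \<epsilon>)" if x: "x \<in> U" for x
    proof -
      have between: "S y \<le> S (z m) - \<eta>" if "y \<in> {min x m..max x m}" for y
        using \<eta>(2)[of y] that x mU by (auto simp: U_def min_def max_def split: if_splits)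
      have "\<bar>x - m\<bar> \<le> 1" using x mU sub by (auto simp: U_def)
      then show ?thesis
        using window_integral_change[OF \<epsilon>, of x m "S (z m)" \<eta>] window_integral_change[OF \<epsilon>, of m x "S (z m)" \<eta>] between
        by (cases "x \<le> m") (auto simp: P_def abs_minus_commute)
    qed
    have F: "pi_eps b \<epsilon> x * exp (- H / \<epsilon>) = exp ((S m - S x) / \<epsilon>) * P \<epsilon> x" for x
    proof -
      have "exp ((S m - S x) / \<epsilon>) * P \<epsilon> x =
          integral {x..x + 1} (\<lambda>y. exp ((S m - S x) / \<epsilon>) * exp ((S y - S (z m)) / \<epsilon>))"
        by (simp add: P_def)
      also have "\<dots> = integral {x..x + 1} (\<lambda>y. exp ((S y - S x) / \<epsilon>) * exp (- H / \<epsilon>))"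
        using Sm(2) by (intro integral_cong) (auto simp: exp_add[symmetric] add_divide_distrib[symmetric] diff_divide_distrib[symmetric])
      also have "\<dots> = pi_eps b \<epsilon> x * exp (- H / \<epsilon>)" by (simp add: pi_eps_def)
      finally show ?thesis by simp
    qed
    have Iint: "((\<lambda>x. exp ((S m - S x) / \<epsilon>) * P \<epsilon> x) has_integral I \<epsilon>) U"
      unfolding F[symmetric] I_def U_def using \<epsilon>
      by (intro integrable_integral integrable_continuous_real continuous_intros pi_eps_continuous) auto
    have diff: "((\<lambda>x. exp ((S m - S x) / \<epsilon>) * P \<epsilon> x - P \<epsilon> m * exp ((S m - S x) / \<epsilon>)) has_integral I \<epsilon> - P \<epsilon> m * X \<epsilon>) U"
      by (intro has_integral_diff Iint has_integral_mult_right Xint)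
    have dom: "((\<lambda>x. exp (- \<eta> / \<epsilon>) * exp ((S m - S x) / \<epsilon>)) has_integral exp (- \<eta> / \<epsilon>) * X \<epsilon>) U"
      by (intro has_integral_mult_right Xint)
    have "norm (I \<epsilon> - P \<epsilon> m * X \<epsilon>) \<le> exp (- \<eta> / \<epsilon>) * X \<epsilon>"
      unfolding integral_unique[OF diff, symmetric] integral_unique[OF dom, symmetric]
    proof (rule integral_norm_bound_integral[OF has_integral_integrable[OF diff] has_integral_integrable[OF dom]])
      fix x assume "x \<in> U"
      from close[OF this] have "exp ((S m - S x) / \<epsilon>) * \<bar>P \<epsilon> x - P \<epsilon> m\<bar> \<le> exp ((S m - S x) / \<epsilon>) * exp (- \<eta> / \<epsilon>)"
        by (rule mult_left_mono) simp
      then show "norm (exp ((S m - S x) / \<epsilon>) * P \<epsilon> x - P \<epsilon> m * exp ((S m - S x) / \<epsilon>)) \<le> exp (- \<eta> / \<epsilon>) * exp ((S m - S x) / \<epsilon>)"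
        unfolding right_diff_distrib[symmetric] mult.commute[of "P \<epsilon> m"] real_norm_def abs_mult
        by (simp add: mult.commute)
    qed
    then have "\<bar>I \<epsilon> - P \<epsilon> m * X \<epsilon>\<bar> / X \<epsilon> \<le> exp (- \<eta> / \<epsilon>)"
      using Xpos by (simp add: pos_divide_le_eq)
    moreover have "I \<epsilon> / X \<epsilon> - P \<epsilon> m = (I \<epsilon> - P \<epsilon> m * X \<epsilon>) / X \<epsilon>" using Xpos by (simp add: field_simps)
    ultimately show "\<bar>I \<epsilon> / X \<epsilon> - P \<epsilon> m\<bar> \<le> exp (- \<eta> / \<epsilon>)" using Xpos by (simp add: abs_divide)
  qed
  have "((\<lambda>\<epsilon>. (I \<epsilon> / X \<epsilon> - P \<epsilon> m) / sqrt \<epsilon>) \<longlongrightarrow> 0) (at_right 0)"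
  proof (rule Lim_null_comparison[OF _ exp_neg_inverse_small(2)[OF \<eta>(1)]])
    show "\<forall>\<^sub>F \<epsilon> in at_right 0. norm ((I \<epsilon> / X \<epsilon> - P \<epsilon> m) / sqrt \<epsilon>) \<le> exp (- \<eta> / \<epsilon>) / sqrt \<epsilon>"
      using eventually_at_right_less[of 0]
    proof eventually_elim
      case (elim \<epsilon>)
      then show ?case using est[OF elim] by (simp add: abs_divide divide_right_mono)
    qed
  qed
  from tendsto_add[OF this win(1)]
  have "((\<lambda>\<epsilon>. (I \<epsilon> / X \<epsilon> - G0 b M\<^sub>p J m) / sqrt \<epsilon>) \<longlongrightarrow> G1 b M\<^sub>m M\<^sub>p J m) (at_right 0)"
    by (simp add: P_def add_divide_distrib[symmetric])
  then have 1: "(\<lambda>\<epsilon>. I \<epsilon> / X \<epsilon>) \<sim>[at_right 0] (\<lambda>\<epsilon>. G0 b M\<^sub>p J m + sqrt \<epsilon> * G1 b M\<^sub>m M\<^sub>p J m)"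
    using win(2,3) by (rule asymp_equiv_of_expansion)
  have 2: "X \<sim>[at_right 0] (\<lambda>\<epsilon>. (m\<^sub>p j - m\<^sub>m j) + sqrt \<epsilon> * sigma b m\<^sub>m m\<^sub>p j)"
    using X m_le[OF jq] sigma by (intro asymp_equiv_of_expansion) auto
  have "(\<lambda>\<epsilon>. I \<epsilon> / X \<epsilon> * X \<epsilon>) \<sim>[at_right 0] well_term j"
    using asymp_equiv_mult[OF 1 2] by (simp add: well_term_def[abs_def] m_def)
  moreover have "\<forall>\<^sub>F \<epsilon> in at_right 0. I \<epsilon> / X \<epsilon> * X \<epsilon> = I \<epsilon>"
    using eventually_at_right_less[of 0]
  proof eventually_elim
    case (elim \<epsilon>)
    then show ?case using est[OF elim] by simp
  qed
  ultimately have "I \<sim>[at_right 0] well_term j"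
    by (rule asymp_equiv_cong[THEN iffD1, rotated -1]) (rule always_eventually, simp)
  then show ?thesis unfolding I_def[abs_def] U_def .
qed

end

context torus_drift
begin

lemma eventually_below_near_block:
  assumes "u \<le> v" and below: "\<And>x. x \<in> {u..v} \<Longrightarrow> S x < L"
  shows "\<forall>\<^sub>F \<delta> in at_right 0. \<forall>x\<in>{u - \<delta>..v + \<delta>}. S x < L"
proof -
  have "open (S -` {..<L})" by (rule open_vimage[OF open_lessThan S_continuous_on])
  then have near: "\<exists>e>0. \<forall>y. dist y x < e \<longrightarrow> S y < L" if "x \<in> {u..v}" for x
    using below[OF that] by (auto simp: open_dist)
  obtain e1 e2 where e: "0 < e1" "\<And>y. dist y u < e1 \<Longrightarrow> S y < L" "0 < e2" "\<And>y. dist y v < e2 \<Longrightarrow> S y < L"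
    using near[of u] near[of v] assms(1) by auto
  have "\<forall>\<^sub>F \<delta> in at_right 0. \<delta> \<in> {0<..<min e1 e2}" using e by (intro eventually_at_right_real) auto
  then show ?thesis
  proof eventually_elim
    case (elim \<delta>)
    show ?case
    proof
      fix x assume "x \<in> {u - \<delta>..v + \<delta>}"
      then consider "x \<in> {u - \<delta>..u}" | "x \<in> {u..v}" | "x \<in> {v..v + \<delta>}" by fastforce
      then show "S x < L"
        using elim e(2)[of x] e(4)[of x] below[of x] by cases (auto simp: dist_real_def)
    qed
  qed
qed

end

context landscapes
begin

text \<open>
  The error made by localising at the deepest minima is exponentially small, so a lower bound for
  \<open>Z_\<epsilon>\<close> that is linear in \<open>\<epsilon>\<close> suffices to absorb it.
\<close>

lemma Z_eps_lower: "\<exists>w>0. \<forall>\<epsilon>>0. w * \<epsilon> \<le> Z_eps b q M\<^sub>m M\<^sub>p m\<^sub>m m\<^sub>p J \<epsilon>"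
  and well_term_pos: "j \<in> deepest \<Longrightarrow> 0 < \<epsilon> \<Longrightarrow> 0 < well_term j \<epsilon>"
proof -
  have sigma: "0 < sigma b m\<^sub>m m\<^sub>p j" if j: "j \<in> deepest" for j
  proof -
    have "vector_derivative b (at_right (m\<^sub>p j)) \<noteq> 0" "vector_derivative b (at_left (m\<^sub>m j)) \<noteq> 0"
      using zero_block_derivatives[OF m_zero_block[OF deepest_index[OF j]]] vector_derivative_one_sided by blast+
    then show ?thesis by (simp add: sigma_def omega_plus_def omega_minus_def add_pos_pos)
  qed
  have low: "G1 b M\<^sub>m M\<^sub>p J (m\<^sub>p j) * sigma b m\<^sub>m m\<^sub>p j * \<epsilon> \<le> well_term j \<epsilon>"
    and G1_pos: "0 < G1 b M\<^sub>m M\<^sub>p J (m\<^sub>p j)" if j: "j \<in> deepest" and "0 < \<epsilon>" for j \<epsilon>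
  proof -
    note win = window_expansion[OF deepest_below[OF j]]
    show "0 < G1 b M\<^sub>m M\<^sub>p J (m\<^sub>p j)" by (rule win(3))
    have "(sqrt \<epsilon> * G1 b M\<^sub>m M\<^sub>p J (m\<^sub>p j)) * (sqrt \<epsilon> * sigma b m\<^sub>m m\<^sub>p j) \<le> well_term j \<epsilon>"
      unfolding well_term_def using win(2,3) sigma[OF j] m_le[OF deepest_index[OF j]] \<open>0 < \<epsilon>\<close>
      by (intro mult_mono) auto
    moreover have "sqrt \<epsilon> * sqrt \<epsilon> = \<epsilon>" using \<open>0 < \<epsilon>\<close> by simp
    ultimately show "G1 b M\<^sub>m M\<^sub>p J (m\<^sub>p j) * sigma b m\<^sub>m m\<^sub>p j * \<epsilon> \<le> well_term j \<epsilon>"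
      by (metis (no_types, opaque_lifting) mult.assoc mult.commute)
  qed
  show pos: "0 < well_term j \<epsilon>" if "j \<in> deepest" "0 < \<epsilon>" for j \<epsilon>
  proof -
    have "0 < G1 b M\<^sub>m M\<^sub>p J (m\<^sub>p j) * sigma b m\<^sub>m m\<^sub>p j * \<epsilon>"
      using G1_pos[OF that] sigma[OF that(1)] that(2) by simp
    also have "\<dots> \<le> well_term j \<epsilon>" by (rule low[OF that])
    finally show ?thesis .
  qed
  obtain j where j: "j \<in> deepest" using deepest_nonempty by blast
  show "\<exists>w>0. \<forall>\<epsilon>>0. w * \<epsilon> \<le> Z_eps b q M\<^sub>m M\<^sub>p m\<^sub>m m\<^sub>p J \<epsilon>"
  proof (intro exI conjI allI impI)
    show "0 < G1 b M\<^sub>m M\<^sub>p J (m\<^sub>p j) * sigma b m\<^sub>m m\<^sub>p j"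
      using G1_pos[OF j, of 1] sigma[OF j] by simp
    fix \<epsilon> :: real assume "0 < \<epsilon>"
    have "G1 b M\<^sub>m M\<^sub>p J (m\<^sub>p j) * sigma b m\<^sub>m m\<^sub>p j * \<epsilon> \<le> well_term j \<epsilon>" using low[OF j \<open>0 < \<epsilon>\<close>] .
    also have "\<dots> \<le> (\<Sum>j\<in>deepest. well_term j \<epsilon>)"
      using pos \<open>0 < \<epsilon>\<close> by (intro member_le_sum j finite_deepest) (auto intro: less_imp_le)
    finally show "G1 b M\<^sub>m M\<^sub>p J (m\<^sub>p j) * sigma b m\<^sub>m m\<^sub>p j * \<epsilon> \<le> Z_eps b q M\<^sub>m M\<^sub>p m\<^sub>m m\<^sub>p J \<epsilon>"
      by (simp add: Z_eps_eq)
  qed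
qed

text \<open>
  Away from the deepest minima the climb \<open>S y - S x\<close> stays below \<open>H\<close> by a fixed amount, by compactness;
  the neighbourhoods of the deepest minima contribute the terms of \<open>Z_\<epsilon>\<close>.
\<close>

lemma c_eps_asymp:
  "(\<lambda>\<epsilon>. c_eps b \<epsilon> * exp (- H / \<epsilon>)) \<sim>[at_right 0] Z_eps b q M\<^sub>m M\<^sub>p m\<^sub>m m\<^sub>p J"
proof -
  let ?U = "\<lambda>\<delta> j. {m\<^sub>m j - \<delta>..m\<^sub>p j + \<delta>}"
  have sep: "\<forall>\<^sub>F \<delta> in at_right 0. (\<forall>i\<in>deepest. \<forall>j\<in>deepest. i \<noteq> j \<longrightarrow> ?U \<delta> i \<inter> ?U \<delta> j = {}) \<and>
      (\<forall>j\<in>deepest. ?U \<delta> j \<subseteq> {0..1})"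
    by (rule eventually_separated_neighbourhoods[OF finite_deepest])
       (use m_le m_disjoint m_bounds deepest_index in \<open>blast+\<close>)
  have near: "\<forall>\<^sub>F \<delta> in at_right 0. \<forall>j\<in>deepest. \<forall>x\<in>?U \<delta> j. S x < S (z (m\<^sub>p j))"
  proof (intro eventually_ball_finite finite_deepest ballI eventually_below_near_block)
    fix j assume j: "j \<in> deepest"
    then show "m\<^sub>m j \<le> m\<^sub>p j" by (intro m_le deepest_index)
    show "S x < S (z (m\<^sub>p j))" if "x \<in> {m\<^sub>m j..m\<^sub>p j}" for x
      using S_constant_on_m[OF deepest_index[OF j] that] deepest_below[OF j] by simp
  qed
  have "\<forall>\<^sub>F \<delta> in at_right 0. 0 < \<delta> \<and> ((\<forall>i\<in>deepest. \<forall>j\<in>deepest. i \<noteq> j \<longrightarrow> ?U \<delta> i \<inter> ?U \<delta> j = {}) \<and>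
      (\<forall>j\<in>deepest. ?U \<delta> j \<subseteq> {0..1})) \<and> (\<forall>j\<in>deepest. \<forall>x\<in>?U \<delta> j. S x < S (z (m\<^sub>p j)))"
    by (rule eventually_conj[OF eventually_at_right_less eventually_conj[OF sep near]])
  then have "\<exists>\<delta>. 0 < \<delta> \<and> ((\<forall>i\<in>deepest. \<forall>j\<in>deepest. i \<noteq> j \<longrightarrow> ?U \<delta> i \<inter> ?U \<delta> j = {}) \<and>
      (\<forall>j\<in>deepest. ?U \<delta> j \<subseteq> {0..1})) \<and> (\<forall>j\<in>deepest. \<forall>x\<in>?U \<delta> j. S x < S (z (m\<^sub>p j)))"
    by (rule eventually_happens'[rotated]) simp
  then obtain \<delta> where *: "0 < \<delta> \<and> ((\<forall>i\<in>deepest. \<forall>j\<in>deepest. i \<noteq> j \<longrightarrow> ?U \<delta> i \<inter> ?U \<delta> j = {}) \<and>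
      (\<forall>j\<in>deepest. ?U \<delta> j \<subseteq> {0..1})) \<and> (\<forall>j\<in>deepest. \<forall>x\<in>?U \<delta> j. S x < S (z (m\<^sub>p j)))" ..
  then have \<delta>: "0 < \<delta>" ..
  have disj: "\<And>i j. i \<in> deepest \<Longrightarrow> j \<in> deepest \<Longrightarrow> i \<noteq> j \<Longrightarrow> ?U \<delta> i \<inter> ?U \<delta> j = {}"
    using *[THEN conjunct2, THEN conjunct1, THEN conjunct1] by metis
  have sub: "\<And>j. j \<in> deepest \<Longrightarrow> ?U \<delta> j \<subseteq> {0..1}"
    using *[THEN conjunct2, THEN conjunct1, THEN conjunct2] by metis
  have below: "\<And>j x. j \<in> deepest \<Longrightarrow> x \<in> ?U \<delta> j \<Longrightarrow> S x < S (z (m\<^sub>p j))"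
    using *[THEN conjunct2, THEN conjunct2] by metis
  have above: "S (m\<^sub>p j) < S x" if j: "j \<in> deepest" and x: "x \<in> ?U \<delta> j" "x \<notin> {m\<^sub>m j..m\<^sub>p j}" for j x
  proof -
    have "x \<le> z (m\<^sub>p j)"
    proof (rule ccontr)
      assume "\<not> x \<le> z (m\<^sub>p j)"
      then have "z (m\<^sub>p j) \<in> ?U \<delta> j"
        using x(1) zmax_ge[of "m\<^sub>p j"] m_le[OF deepest_index[OF j]] \<delta> by auto
      from below[OF j this] show False by simp
    qed
    then have "S (m\<^sub>p j) \<le> S x" by (rule max_climb_min[OF deepest_climb[OF j]])
    moreover have "S (m\<^sub>p j) \<noteq> S x"
    proof
      assume "S (m\<^sub>p j) = S x"
      then have "S (z (m\<^sub>p j)) - S x = H" using deepest_climb[OF j] by simp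
      moreover have "x \<in> {0..1}" using sub[OF j] x(1) by blast
      ultimately obtain i where i: "i \<in> deepest" "x \<in> {m\<^sub>m i..m\<^sub>p i}"
        using max_climb_start \<open>x \<le> z (m\<^sub>p j)\<close> by blast
      then have "i \<noteq> j" using x(2) by blast
      moreover have "x \<in> ?U \<delta> i" using i(2) \<delta> by auto
      ultimately show False using disj[OF i(1) j] x(1) by blast
    qed
    ultimately show ?thesis by simp
  qed
  define rest where "rest = {0..1} - (\<Union>j\<in>deepest. {m\<^sub>m j - \<delta><..<m\<^sub>p j + \<delta>})"
  have "compact (rest \<times> {0..1::real})"
    unfolding rest_def by (intro compact_Times compact_diff compact_Icc open_UN) auto
  moreover have "S (x + t) - S x - H < 0" if xt: "x \<in> rest" "t \<in> {0..1}" for x t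
  proof -
    have "S (x + t) - S x \<noteq> H"
    proof
      assume "S (x + t) - S x = H"
      moreover have "x \<in> {0..1}" using xt(1) unfolding rest_def by blast
      ultimately obtain j where "j \<in> deepest" "x \<in> {m\<^sub>m j..m\<^sub>p j}"
        using max_climb_start[of x "x + t"] xt(2) by auto
      then show False using xt(1) \<delta> unfolding rest_def by force
    qed
    then show ?thesis using climb_le_height[of x "x + t"] xt(2) by auto
  qed
  then have "\<And>p. p \<in> rest \<times> {0..1} \<Longrightarrow> S (fst p + snd p) - S (fst p) - H < 0" by auto
  moreover have "continuous_on (rest \<times> {0..1}) (\<lambda>p. S (fst p + snd p) - S (fst p) - H)"
    by (intro continuous_intros)
  ultimately obtain \<eta> where \<eta>: "0 < \<eta>" "\<And>p. p \<in> rest \<times> {0..1} \<Longrightarrow> S (fst p + snd p) - S (fst p) - H \<le> - \<eta>"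
    using negative_max_on_compact[of "rest \<times> {0..1::real}" "\<lambda>p. S (fst p + snd p) - S (fst p) - H"] by blast
  let ?F = "\<lambda>\<epsilon> x. pi_eps b \<epsilon> x * exp (- H / \<epsilon>)"
  let ?Q = "\<lambda>\<epsilon>. \<Sum>j\<in>deepest. integral (?U \<delta> j) (?F \<epsilon>)"
  have rest_bound: "\<bar>?F \<epsilon> x\<bar> \<le> exp (- \<eta> / \<epsilon>)" if "0 < \<epsilon>" "x \<in> rest" for \<epsilon> x
  proof -
    have "?F \<epsilon> x = integral {x..x + 1} (\<lambda>y. exp ((S y - S x) / \<epsilon>) * exp (- H / \<epsilon>))"
      by (simp add: pi_eps_def)
    also have "\<dots> \<le> integral {x..x + 1} (\<lambda>y. exp (- \<eta> / \<epsilon>))"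
    proof (rule integral_le)
      show "(\<lambda>y. exp ((S y - S x) / \<epsilon>) * exp (- H / \<epsilon>)) integrable_on {x..x + 1}"
        using that(1) by (intro integrable_continuous_real continuous_intros) auto
      show "(\<lambda>y. exp (- \<eta> / \<epsilon>)) integrable_on {x..x + 1}"
        by (rule integrable_continuous_real[OF continuous_on_const])
      fix y assume "y \<in> {x..x + 1}"
      then have "S y - S x - H \<le> - \<eta>" using \<eta>(2)[of "(x, y - x)"] that(2) by auto
      from divide_right_mono[OF this, of \<epsilon>]
      show "exp ((S y - S x) / \<epsilon>) * exp (- H / \<epsilon>) \<le> exp (- \<eta> / \<epsilon>)"
        using that(1) by (simp add: exp_add[symmetric] diff_divide_distrib)
    qed
    finally have "?F \<epsilon> x \<le> exp (- \<eta> / \<epsilon>)" by simp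
    moreover have "0 < ?F \<epsilon> x" using pi_eps_pos[of \<epsilon> x] that(1) by simp
    ultimately show ?thesis by simp
  qed
  have conc: "\<bar>c_eps b \<epsilon> * exp (- H / \<epsilon>) - ?Q \<epsilon>\<bar> \<le> exp (- \<eta> / \<epsilon>)" if "0 < \<epsilon>" for \<epsilon>
  proof -
    have "\<bar>integral {0..1} (?F \<epsilon>) - ?Q \<epsilon>\<bar> \<le> exp (- \<eta> / \<epsilon>) * (1 - 0)"
    proof (rule integral_concentrates[OF finite_deepest _ _ disj sub])
      show "continuous_on {0..1} (?F \<epsilon>)" using that by (intro continuous_intros pi_eps_continuous) auto
      show "\<bar>?F \<epsilon> x\<bar> \<le> exp (- \<eta> / \<epsilon>)" if "x \<in> {0..1}" "\<And>i. i \<in> deepest \<Longrightarrow> x \<notin> ?U \<delta> i" for x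
        using that \<open>0 < \<epsilon>\<close> by (intro rest_bound) (force simp: rest_def)+
    qed auto
    then show ?thesis by (simp add: c_eps_def)
  qed
  have "?Q \<sim>[at_right 0] (\<lambda>\<epsilon>. \<Sum>j\<in>deepest. well_term j \<epsilon>)"
  proof (rule asymp_equiv_sum_pos[OF finite_deepest])
    fix j assume j: "j \<in> deepest"
    show "(\<lambda>\<epsilon>. integral (?U \<delta> j) (?F \<epsilon>)) \<sim>[at_right 0] well_term j"
      by (rule well_contribution[OF j \<delta> sub[OF j] above[OF j] below[OF j]])
    show "\<forall>\<^sub>F \<epsilon> in at_right 0. 0 < well_term j \<epsilon>"
      using eventually_at_right_less[of 0] by eventually_elim (rule well_term_pos[OF j])
  qed
  then have Q: "?Q \<sim>[at_right 0] Z_eps b q M\<^sub>m M\<^sub>p m\<^sub>m m\<^sub>p J" by (simp add: Z_eps_eq[abs_def])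
  obtain w where w: "0 < w" "\<And>\<epsilon>. 0 < \<epsilon> \<Longrightarrow> w * \<epsilon> \<le> Z_eps b q M\<^sub>m M\<^sub>p m\<^sub>m m\<^sub>p J \<epsilon>"
    using Z_eps_lower by blast
  have "(\<lambda>\<epsilon>. c_eps b \<epsilon> * exp (- H / \<epsilon>) - ?Q \<epsilon>) \<in> o[at_right 0](Z_eps b q M\<^sub>m M\<^sub>p m\<^sub>m m\<^sub>p J)"
  proof (rule smalloI_tendsto)
    have Zpos: "\<forall>\<^sub>F \<epsilon> in at_right 0. 0 < \<epsilon> \<and> 0 < Z_eps b q M\<^sub>m M\<^sub>p m\<^sub>m m\<^sub>p J \<epsilon>"
      using eventually_at_right_less[of 0]
    proof eventually_elim
      case (elim \<epsilon>)
      then have "0 < w * \<epsilon>" using w(1) by simp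
      then show ?case using w(2)[OF elim] elim by linarith
    qed
    then show "\<forall>\<^sub>F \<epsilon> in at_right 0. Z_eps b q M\<^sub>m M\<^sub>p m\<^sub>m m\<^sub>p J \<epsilon> \<noteq> 0" by (rule eventually_mono) auto
    show "((\<lambda>\<epsilon>. (c_eps b \<epsilon> * exp (- H / \<epsilon>) - ?Q \<epsilon>) / Z_eps b q M\<^sub>m M\<^sub>p m\<^sub>m m\<^sub>p J \<epsilon>) \<longlongrightarrow> 0) (at_right 0)"
    proof (rule Lim_null_comparison)
      show "((\<lambda>\<epsilon>. exp (- \<eta> / \<epsilon>) / \<epsilon> / w) \<longlongrightarrow> 0) (at_right 0)"
        using tendsto_divide[OF exp_neg_inverse_small(1)[OF \<eta>(1)] tendsto_const[of w]] w(1) by simp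
      show "\<forall>\<^sub>F \<epsilon> in at_right 0. norm ((c_eps b \<epsilon> * exp (- H / \<epsilon>) - ?Q \<epsilon>) / Z_eps b q M\<^sub>m M\<^sub>p m\<^sub>m m\<^sub>p J \<epsilon>)
          \<le> exp (- \<eta> / \<epsilon>) / \<epsilon> / w"
        using Zpos
      proof eventually_elim
        case (elim \<epsilon>)
        have "norm ((c_eps b \<epsilon> * exp (- H / \<epsilon>) - ?Q \<epsilon>) / Z_eps b q M\<^sub>m M\<^sub>p m\<^sub>m m\<^sub>p J \<epsilon>) =
            \<bar>c_eps b \<epsilon> * exp (- H / \<epsilon>) - ?Q \<epsilon>\<bar> / Z_eps b q M\<^sub>m M\<^sub>p m\<^sub>m m\<^sub>p J \<epsilon>"
          using elim by (simp add: abs_divide)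
        also have "\<dots> \<le> exp (- \<eta> / \<epsilon>) / (w * \<epsilon>)"
          using conc[of \<epsilon>] w(1) w(2)[of \<epsilon>] elim by (intro frac_le) auto
        finally show ?case by (simp add: mult.commute)
      qed
    qed
  qed
  from sum_in_smallo(1)[OF this asymp_equiv_imp_diff_smallo[OF Q]]
  show ?thesis unfolding asymp_equiv_altdef by simp
qed

end

section \<open>Harmonic functions and the energy of a gap\<close>

context torus_drift
begin

lemma affine_E_harmonic:
  assumes "\<epsilon> \<noteq> 0" "open U" "x \<in> U" and h: "\<And>y. y \<in> U \<Longrightarrow> h y = \<alpha> + \<beta> * E \<epsilon> (y - of_int k)"
  shows "h differentiable at x" "deriv h x = \<beta> * exp (S (x - of_int k) / \<epsilon>)"
    "deriv h differentiable at x" "generator b \<epsilon> h x = 0"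
proof -
  have D: "(h has_real_derivative \<beta> * exp (S (y - of_int k) / \<epsilon>)) (at y)" if "y \<in> U" for y
  proof (rule has_field_derivative_transform_within_open[OF _ assms(2) that h[symmetric]])
    have "((\<lambda>y. E \<epsilon> (y - of_int k)) has_real_derivative exp (S (y - of_int k) / \<epsilon>) * (1 - 0)) (at y)"
      by (rule DERIV_chain2[OF E_deriv[OF assms(1)]]) (intro DERIV_diff DERIV_ident DERIV_const)
    then show "((\<lambda>y. \<alpha> + \<beta> * E \<epsilon> (y - of_int k)) has_real_derivative \<beta> * exp (S (y - of_int k) / \<epsilon>)) (at y)"
      by (auto intro!: derivative_eq_intros)
  qed
  then have dh: "deriv h y = \<beta> * exp (S (y - of_int k) / \<epsilon>)" if "y \<in> U" for y
    using that DERIV_imp_deriv by blast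
  have "((\<lambda>y. S (y - of_int k)) has_real_derivative - b (x - of_int k) * (1 - 0)) (at x)"
    by (rule DERIV_chain2[OF S_deriv]) (intro DERIV_diff DERIV_ident DERIV_const)
  moreover have "b (x - of_int k) = b x" using b_periodic_int[of "x - of_int k" k] by simp
  ultimately have DS: "((\<lambda>y. S (y - of_int k)) has_real_derivative - b x) (at x)" by simp
  have D2: "(deriv h has_real_derivative \<beta> * exp (S (x - of_int k) / \<epsilon>) * (- b x / \<epsilon>)) (at x)"
  proof (rule has_field_derivative_transform_within_open[OF _ assms(2,3) dh[symmetric]])
    show "((\<lambda>y. \<beta> * exp (S (y - of_int k) / \<epsilon>)) has_real_derivative \<beta> * exp (S (x - of_int k) / \<epsilon>) * (- b x / \<epsilon>)) (at x)"
      using assms(1) by (auto intro!: derivative_eq_intros DS)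
  qed
  show "h differentiable at x" "deriv h differentiable at x"
    using D[OF assms(3)] D2 by (auto simp: real_differentiable_def)
  show d: "deriv h x = \<beta> * exp (S (x - of_int k) / \<epsilon>)" by (rule dh[OF assms(3)])
  show "generator b \<epsilon> h x = 0"
    unfolding generator_def d DERIV_imp_deriv[OF D2] using assms(1) by simp
qed

text \<open>
  \<open>L h = 0\<close> says that \<open>h' exp (- S / \<epsilon>)\<close> has derivative zero.
\<close>

lemma harmonic_is_affine_E:
  assumes "0 < \<epsilon>" "p < r" and cont: "continuous_on {p..r} h"
    and h: "\<And>x. x \<in> {p<..<r} \<Longrightarrow> h differentiable at x \<and> deriv h differentiable at x \<and> generator b \<epsilon> h x = 0"
    and x: "x \<in> {p..r}"
  shows "h x = h p + (h r - h p) / (E \<epsilon> r - E \<epsilon> p) * (E \<epsilon> x - E \<epsilon> p)"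
proof -
  have \<epsilon>: "\<epsilon> \<noteq> 0" using assms(1) by simp
  let ?w = "\<lambda>x. deriv h x * exp (- S x / \<epsilon>)"
  have D1: "(h has_real_derivative deriv h y) (at y)" if "y \<in> {p<..<r}" for y
    using h[OF that] DERIV_deriv_iff_real_differentiable by blast
  have D2: "(?w has_real_derivative 0) (at y)" if "y \<in> {p<..<r}" for y
  proof -
    have "(deriv h has_real_derivative deriv (deriv h) y) (at y)"
      using h[OF that] DERIV_deriv_iff_real_differentiable by blast
    moreover have "((\<lambda>x. exp (- S x / \<epsilon>)) has_real_derivative exp (- S y / \<epsilon>) * (b y / \<epsilon>)) (at y)"
      using \<epsilon> by (auto intro!: derivative_eq_intros S_deriv)
    ultimately have "(?w has_real_derivative deriv h y * (exp (- S y / \<epsilon>) * (b y / \<epsilon>)) + deriv (deriv h) y * exp (- S y / \<epsilon>)) (at y)"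
      by (rule DERIV_mult')
    moreover have "deriv h y * (exp (- S y / \<epsilon>) * (b y / \<epsilon>)) + deriv (deriv h) y * exp (- S y / \<epsilon>) =
        exp (- S y / \<epsilon>) / \<epsilon> * generator b \<epsilon> h y"
      using \<epsilon> by (simp add: generator_def field_simps)
    ultimately show ?thesis using h[OF that] by simp
  qed
  define C where "C = ?w ((p + r) / 2)"
  have mid: "(p + r) / 2 \<in> {p<..<r}" using assms(2) by auto
  have dh: "deriv h y = C * exp (S y / \<epsilon>)" if "y \<in> {p<..<r}" for y
  proof -
    have "?w y = C" unfolding C_def by (rule DERIV_isconst3[OF assms(2) that mid D2])
    then show ?thesis by (simp add: exp_minus field_simps)
  qed
  let ?\<phi> = "\<lambda>x. h x - C * E \<epsilon> x"
  have "(?\<phi> has_real_derivative 0) (at y)" if "p < y" "y < r" for y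
    using DERIV_diff[OF D1 DERIV_cmult[OF E_deriv[OF \<epsilon>]], of y C] dh[of y] that by auto
  moreover have "continuous_on {p..r} ?\<phi>"
    by (intro continuous_intros cont E_continuous \<epsilon>)
  ultimately have const: "?\<phi> y = ?\<phi> p" if "y \<in> {p..r}" for y
    using DERIV_isconst2[OF assms(2), of ?\<phi> y] that by auto
  have hx: "h y = h p + C * (E \<epsilon> y - E \<epsilon> p)" if "y \<in> {p..r}" for y
    using const[OF that] by (simp add: algebra_simps)
  have "E \<epsilon> p < E \<epsilon> r" by (rule E_strict_mono[OF \<epsilon> assms(2)])
  moreover have "h r = h p + C * (E \<epsilon> r - E \<epsilon> p)" using hx[of r] assms(2) by simp
  ultimately have "C = (h r - h p) / (E \<epsilon> r - E \<epsilon> p)" by simp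
  then show ?thesis using hx[OF x] by simp
qed

lemma E_mono: "\<epsilon> \<noteq> 0 \<Longrightarrow> x \<le> y \<Longrightarrow> E \<epsilon> x \<le> E \<epsilon> y"
  using E_strict_mono[of \<epsilon> x y] by (cases "x = y") auto

lemma E_increment_le:
  assumes "0 < \<epsilon>" "x \<le> y" "\<And>w. w \<in> {x..y} \<Longrightarrow> S w \<le> L"
  shows "E \<epsilon> y - E \<epsilon> x \<le> (y - x) * exp (L / \<epsilon>)"
proof (rule has_integral_le[OF E_has_integral])
  show "((\<lambda>_. exp (L / \<epsilon>)) has_integral (y - x) * exp (L / \<epsilon>)) {x..y}"
    using has_integral_const_real[of "exp (L / \<epsilon>)" x y] assms(2) by simp
qed (use assms in \<open>auto intro!: divide_right_mono\<close>)

lemma E_increment_ge: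
  assumes "0 < \<epsilon>" "x \<le> y" "\<And>w. w \<in> {x..y} \<Longrightarrow> L \<le> S w"
  shows "(y - x) * exp (L / \<epsilon>) \<le> E \<epsilon> y - E \<epsilon> x"
proof (rule has_integral_le[OF _ E_has_integral])
  show "((\<lambda>_. exp (L / \<epsilon>)) has_integral (y - x) * exp (L / \<epsilon>)) {x..y}"
    using has_integral_const_real[of "exp (L / \<epsilon>)" x y] assms(2) by simp
qed (use assms in \<open>auto intro!: divide_right_mono\<close>)

text \<open>
  The integral of \<open>(h')\<^sup>2 * \<pi>_\<epsilon>\<close> over \<open>[p, r]\<close> for the harmonic function \<open>h\<close> with boundary values 0 and 1.
\<close>

definition gap_energy :: "real \<Rightarrow> real \<Rightarrow> real \<Rightarrow> real" where
  "gap_energy \<epsilon> p r = integral {p..r} (\<lambda>x. exp (S x / \<epsilon>) * (E \<epsilon> (x + 1) - E \<epsilon> x)) / (E \<epsilon> r - E \<epsilon> p)\<^sup>2"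

text \<open>
  Split \<open>E (x + 1) - E x\<close> at \<open>r\<close>. The part \<open>E r - E x\<close> integrates against \<open>E'\<close> to half of the square
  \<open>(E r - E p)\<^sup>2\<close>; the part \<open>E (x + 1) - E r\<close> is at most \<open>exp (L / \<epsilon>)\<close>.
\<close>

lemma gap_energy_estimate:
  assumes \<epsilon>: "0 < \<epsilon>" and "p < r" "r \<le> p + 1" and L: "\<And>w. r \<le> w \<Longrightarrow> S w \<le> L"
  shows "\<bar>gap_energy \<epsilon> p r - 1 / 2\<bar> \<le> exp (L / \<epsilon>) / (E \<epsilon> r - E \<epsilon> p)"
proof -
  have \<epsilon>': "\<epsilon> \<noteq> 0" using \<epsilon> by simp
  define d where "d = E \<epsilon> r - E \<epsilon> p"
  have d: "0 < d" using E_strict_mono[OF \<epsilon>' \<open>p < r\<close>] by (simp add: d_def)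
  have "((\<lambda>x. exp (S x / \<epsilon>) * (E \<epsilon> r - E \<epsilon> x)) has_integral
      - (E \<epsilon> r - E \<epsilon> r)\<^sup>2 / 2 - (- (E \<epsilon> r - E \<epsilon> p)\<^sup>2 / 2)) {p..r}"
  proof (rule fundamental_theorem_of_calculus)
    fix x assume "x \<in> {p..r}"
    have "((\<lambda>x. - (E \<epsilon> r - E \<epsilon> x)\<^sup>2 / 2) has_real_derivative exp (S x / \<epsilon>) * (E \<epsilon> r - E \<epsilon> x)) (at x)"
      by (auto intro!: derivative_eq_intros E_deriv \<epsilon>')
    then show "((\<lambda>x. - (E \<epsilon> r - E \<epsilon> x)\<^sup>2 / 2) has_vector_derivative exp (S x / \<epsilon>) * (E \<epsilon> r - E \<epsilon> x)) (at x within {p..r})"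
      unfolding has_real_derivative_iff_has_vector_derivative[symmetric] by (rule has_field_derivative_at_within)
  qed (use \<open>p < r\<close> in simp)
  then have main: "((\<lambda>x. exp (S x / \<epsilon>) * (E \<epsilon> r - E \<epsilon> x)) has_integral d\<^sup>2 / 2) {p..r}"
    by (simp add: d_def)
  have Eshift: "continuous_on A (\<lambda>x. E \<epsilon> (x + 1))" for A
    by (rule continuous_on_compose2[OF E_continuous[OF \<epsilon>', of UNIV]]) (auto intro!: continuous_intros)
  define R where "R = integral {p..r} (\<lambda>x. exp (S x / \<epsilon>) * (E \<epsilon> (x + 1) - E \<epsilon> r))"
  have R: "((\<lambda>x. exp (S x / \<epsilon>) * (E \<epsilon> (x + 1) - E \<epsilon> r)) has_integral R) {p..r}"
    unfolding R_def
    by (intro integrable_integral integrable_continuous_real continuous_intros Eshift exp_S_continuous \<epsilon>')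
  have "0 \<le> R"
    by (rule has_integral_nonneg[OF R]) (use \<open>r \<le> p + 1\<close> E_mono[OF \<epsilon>', of r] in auto)
  moreover have "R \<le> d * exp (L / \<epsilon>)"
  proof (rule has_integral_le[OF R])
    show "((\<lambda>x. exp (S x / \<epsilon>) * exp (L / \<epsilon>)) has_integral d * exp (L / \<epsilon>)) {p..r}"
      unfolding d_def using \<open>p < r\<close> by (intro has_integral_mult_left E_has_integral \<epsilon>') simp
    fix x assume x: "x \<in> {p..r}"
    have "E \<epsilon> (x + 1) - E \<epsilon> r \<le> (x + 1 - r) * exp (L / \<epsilon>)"
      using x \<open>r \<le> p + 1\<close> L by (intro E_increment_le \<epsilon>) auto
    also have "\<dots> \<le> 1 * exp (L / \<epsilon>)" using x by (intro mult_right_mono) auto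
    finally show "exp (S x / \<epsilon>) * (E \<epsilon> (x + 1) - E \<epsilon> r) \<le> exp (S x / \<epsilon>) * exp (L / \<epsilon>)"
      by (intro mult_left_mono) auto
  qed
  moreover have "integral {p..r} (\<lambda>x. exp (S x / \<epsilon>) * (E \<epsilon> (x + 1) - E \<epsilon> x)) = d\<^sup>2 / 2 + R"
    using has_integral_add[OF main R] by (intro integral_unique) (simp add: algebra_simps)
  then have "gap_energy \<epsilon> p r - 1 / 2 = R / d\<^sup>2"
    using d by (simp add: gap_energy_def d_def[symmetric] add_divide_distrib)
  ultimately have "\<bar>gap_energy \<epsilon> p r - 1 / 2\<bar> \<le> d * exp (L / \<epsilon>) / d\<^sup>2"
    by (simp add: abs_divide divide_right_mono)
  also have "\<dots> = exp (L / \<epsilon>) / d" using d by (simp add: power2_eq_square)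
  finally show ?thesis by (simp add: d_def)
qed

text \<open>
  Because \<open>z p\<close> differs from \<open>z r\<close>, it lies in \<open>[p, r]\<close>, and there \<open>S\<close> exceeds its maximum over \<open>[r, \<infinity>)\<close>.
\<close>

lemma gap_energy_limit:
  assumes "p < r" "r \<le> p + 1" "z p < z r"
  shows "((\<lambda>\<epsilon>. gap_energy \<epsilon> p r) \<longlongrightarrow> 1 / 2) (at_right 0)"
proof -
  have zp: "p \<le> z p" "z p \<le> r"
    using zmax_ge[of p] zmax_constant[of p r] assms by (auto simp: not_less[symmetric])
  define L where "L = S (z r)"
  define \<eta> where "\<eta> = (S (z p) - L) / 2"
  have \<eta>: "0 < \<eta>" using zmax_greatest[OF assms(3)] by (simp add: \<eta>_def L_def)
  have "open (S -` {L + \<eta><..})" by (rule open_vimage[OF open_greaterThan S_continuous_on])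
  moreover have "z p \<in> S -` {L + \<eta><..}" using \<eta> by (simp add: \<eta>_def field_simps)
  ultimately obtain e where e: "0 < e" "\<And>y. dist y (z p) < e \<Longrightarrow> L + \<eta> < S y"
    by (auto simp: open_dist)
  \<comment> \<open>The point \<open>z p\<close> may be an endpoint of the gap, so the neighbourhood is cut to \<open>[p, r]\<close>.\<close>
  define s t where "s = max p (z p - e / 2)" and "t = min r (z p + e / 2)"
  have st: "p \<le> s" "s < t" "t \<le> r"
    using zp e(1) assms(1) by (auto simp: s_def t_def)
  have high: "L + \<eta> \<le> S w" if "w \<in> {s..t}" for w
  proof -
    have "dist w (z p) < e" using that e(1) by (auto simp: s_def t_def dist_real_def)
    then show ?thesis using e(2)[of w] by simp
  qed
  have "((\<lambda>\<epsilon>. gap_energy \<epsilon> p r - 1 / 2) \<longlongrightarrow> 0) (at_right 0)"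
  proof (rule Lim_null_comparison)
    show "((\<lambda>\<epsilon>. exp (- \<eta> / \<epsilon>) / (t - s)) \<longlongrightarrow> 0) (at_right 0)"
      using tendsto_divide[OF exp_neg_inverse_small(3)[OF \<eta>] tendsto_const[of "t - s"]] st by simp
    show "\<forall>\<^sub>F \<epsilon> in at_right 0. norm (gap_energy \<epsilon> p r - 1 / 2) \<le> exp (- \<eta> / \<epsilon>) / (t - s)"
      using eventually_at_right_less[of 0]
    proof eventually_elim
      case (elim \<epsilon>)
      then have \<epsilon>': "\<epsilon> \<noteq> 0" by simp
      have "(t - s) * exp ((L + \<eta>) / \<epsilon>) \<le> E \<epsilon> t - E \<epsilon> s"
        using st high elim by (intro E_increment_ge) auto
      also have "\<dots> \<le> E \<epsilon> r - E \<epsilon> p"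
        using E_mono[OF \<epsilon>' st(1)] E_mono[OF \<epsilon>' st(3)] by simp
      finally have low: "(t - s) * exp ((L + \<eta>) / \<epsilon>) \<le> E \<epsilon> r - E \<epsilon> p" .
      have "\<bar>gap_energy \<epsilon> p r - 1 / 2\<bar> \<le> exp (L / \<epsilon>) / (E \<epsilon> r - E \<epsilon> p)"
        by (rule gap_energy_estimate) (use elim assms zmax_max in \<open>auto simp: L_def\<close>)
      also have "\<dots> \<le> exp (L / \<epsilon>) / ((t - s) * exp ((L + \<eta>) / \<epsilon>))"
        using low st by (intro divide_left_mono) (auto intro!: mult_pos_pos less_le_trans[OF _ low])
      also have "\<dots> = exp (- \<eta> / \<epsilon>) / (t - s)"
        using st by (simp add: add_divide_distrib exp_add exp_minus field_simps)
      finally show ?case by simp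
    qed
  qed
  from tendsto_add[OF this tendsto_const[of "1 / 2"]] show ?thesis by simp
qed

text \<open>
  In the well \<open>Vhat\<close> is negative, whereas it vanishes at \<open>z p\<close>; so \<open>z p\<close> lies to the right of the well.
\<close>

lemma well_zmax_constant:
  assumes "is_well b p r" "p \<le> r"
  shows "z p = z r"
proof (rule ccontr)
  assume ne: "z p \<noteq> z r"
  have "z p < r"
    using zmax_constant[of p r] assms(2) ne by force
  then have mem: "z p \<in> {p..r}" using zmax_ge[of p] by simp
  have le: "quasipot b \<theta> < H" if "\<theta> \<in> {p..r}" for \<theta>
  proof -
    have "\<And>\<theta>. p < \<theta> \<Longrightarrow> \<theta> < r \<Longrightarrow> quasipot b \<theta> < quasipot b p" "quasipot b p = quasipot b r" "quasipot b r < H"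
      using assms(1) by (auto simp: is_well_def)
    moreover have "\<theta> = p \<or> \<theta> = r \<or> p < \<theta> \<and> \<theta> < r" using that by auto
    ultimately show ?thesis by (metis order.strict_trans)
  qed
  from le[OF mem] show False by (simp add: quasipot_def Vhat_def zmax_idem)
qed

end

section \<open>The equilibrium potential and the capacity\<close>

lemma open_shifted: "open {x. x - of_int k \<in> {u<..<v::real}}"
proof -
  have "{x. x - of_int k \<in> {u<..<v}} = {u + of_int k<..<v + of_int k}" by auto
  then show ?thesis by simp
qed

lemma deriv_periodic:
  fixes f :: "real \<Rightarrow> real"
  assumes "\<And>x. f (x + 1) = f x"
  shows "deriv f (x + 1) = deriv f x"
proof -
  have "(f has_real_derivative D) (at (x + 1)) \<longleftrightarrow> (f has_real_derivative D) (at x)" for D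
    using DERIV_shift[of f D x 1] assms by simp
  then show ?thesis by (simp add: deriv_def)
qed

lemma periodic_extension_continuous:
  fixes g :: "real \<Rightarrow> real"
  assumes cont: "continuous_on {a..a + 1} g" and ends: "g (a + 1) = g a"
  shows "continuous_on UNIV (\<lambda>x. g (x - of_int \<lfloor>x - a\<rfloor>))" (is "continuous_on UNIV ?h")
proof -
  have piece: "continuous_on {a + of_int k..a + 1 + of_int k} ?h" for k
  proof -
    have "continuous_on {a + of_int k..a + 1 + of_int k} (\<lambda>x. g (x - of_int k))"
      by (rule continuous_on_compose2[OF cont]) (auto intro!: continuous_intros)
    moreover have "g (x - of_int k) = ?h x" if "x \<in> {a + of_int k..a + 1 + of_int k}" for x
    proof (cases "x = a + 1 + of_int k")
      case True
      then have "\<lfloor>x - a\<rfloor> = k + 1" by linarith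
      then show ?thesis using True ends by simp
    next
      case False
      then have "\<lfloor>x - a\<rfloor> = k" using that unfolding atLeastAtMost_iff by linarith
      then show ?thesis by simp
    qed
    ultimately show ?thesis by (rule continuous_on_eq)
  qed
  have "isCont ?h x" for x
  proof -
    define k where "k = \<lfloor>x - a\<rfloor>"
    have "continuous_on ({a + of_int (k - 1)..a + 1 + of_int (k - 1)} \<union> {a + of_int k..a + 1 + of_int k}) ?h"
      by (intro continuous_on_closed_Un piece) auto
    then have "continuous_on {a + of_int k - 1<..<a + of_int k + 1} ?h"
      by (rule continuous_on_subset) auto
    moreover have "x \<in> {a + of_int k - 1<..<a + of_int k + 1}"
      unfolding k_def greaterThanLessThan_iff by linarith
    ultimately show ?thesis by (auto simp: continuous_on_eq_continuous_at)
  qed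
  then show ?thesis by (intro continuous_at_imp_continuous_on) auto
qed

lemma has_integral_one_period:
  fixes f :: "real \<Rightarrow> real"
  assumes per: "\<And>x. f (x + 1) = f x" and a: "0 \<le> a" "a \<le> 1" and I: "(f has_integral I) {a..a + 1}"
  shows "(f has_integral I) {0..1}"
proof -
  have int: "f integrable_on {a..1}" "f integrable_on {1..a + 1}"
    using integrable_subinterval_real[OF has_integral_integrable[OF I]] a by auto
  then obtain I1 I2 where I12: "(f has_integral I1) {a..1}" "(f has_integral I2) {1..a + 1}"
    by (auto simp: integrable_on_def)
  have "(f has_integral I1 + I2) {a..a + 1}"
    using has_integral_combine[OF _ _ I12] a by simp
  then have "I = I1 + I2" using I by (simp add: has_integral_unique)
  have "(f \<circ> (+) 1 has_integral I2) {0..a}"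
    using has_integral_shift_Icc_real[of f 1 I2 0 a] I12(2) by (simp add: add.commute)
  moreover have "f \<circ> (+) 1 = f" using per by (auto simp: fun_eq_iff add.commute)
  ultimately have "(f has_integral I2) {0..a}" by simp
  from has_integral_combine[OF a this I12(1)] show ?thesis using \<open>I = I1 + I2\<close> by (simp add: add.commute)
qed

locale two_wells = torus_drift b for b +
  fixes \<epsilon> a\<^sub>1 c\<^sub>1 a\<^sub>2 c\<^sub>2 :: real
  assumes \<epsilon>_pos: "0 < \<epsilon>" and order: "0 \<le> a\<^sub>1" "a\<^sub>1 \<le> c\<^sub>1" "c\<^sub>1 < a\<^sub>2" "a\<^sub>2 \<le> c\<^sub>2" "c\<^sub>2 < 1"
begin

lemma \<epsilon>_ne: "\<epsilon> \<noteq> 0"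
  using \<epsilon>_pos by simp

lemma E_gaps: "E \<epsilon> c\<^sub>1 < E \<epsilon> a\<^sub>2" "E \<epsilon> c\<^sub>2 < E \<epsilon> (a\<^sub>1 + 1)"
  using E_strict_mono[OF \<epsilon>_ne] order by auto

text \<open>
  On \<open>[a\<^sub>1, a\<^sub>1 + 1]\<close> the clamped arguments produce the four pieces 1, descent, 0, ascent by a single formula
  that is continuous by construction.
\<close>

definition profile :: "real \<Rightarrow> real" where
  "profile x = (E \<epsilon> a\<^sub>2 - E \<epsilon> (max c\<^sub>1 (min a\<^sub>2 x))) / (E \<epsilon> a\<^sub>2 - E \<epsilon> c\<^sub>1) +
     (E \<epsilon> (max c\<^sub>2 x) - E \<epsilon> c\<^sub>2) / (E \<epsilon> (a\<^sub>1 + 1) - E \<epsilon> c\<^sub>2)"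

definition potential :: "real \<Rightarrow> real" where
  "potential x = profile (x - of_int \<lfloor>x - a\<^sub>1\<rfloor>)"

lemma profile_simps:
  "x \<le> c\<^sub>1 \<Longrightarrow> profile x = 1"
  "c\<^sub>1 \<le> x \<Longrightarrow> x \<le> a\<^sub>2 \<Longrightarrow> profile x = (E \<epsilon> a\<^sub>2 - E \<epsilon> x) / (E \<epsilon> a\<^sub>2 - E \<epsilon> c\<^sub>1)"
  "a\<^sub>2 \<le> x \<Longrightarrow> x \<le> c\<^sub>2 \<Longrightarrow> profile x = 0"
  "c\<^sub>2 \<le> x \<Longrightarrow> profile x = (E \<epsilon> x - E \<epsilon> c\<^sub>2) / (E \<epsilon> (a\<^sub>1 + 1) - E \<epsilon> c\<^sub>2)"
  using order E_gaps by (auto simp: profile_def max_def min_def)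

lemma profile_continuous: "continuous_on A profile"
proof -
  have 1: "continuous_on A (\<lambda>x. E \<epsilon> (max c\<^sub>1 (min a\<^sub>2 x)))"
    by (rule continuous_on_compose2[OF E_continuous[OF \<epsilon>_ne, of UNIV]]) (auto intro!: continuous_intros)
  have 2: "continuous_on A (\<lambda>x. E \<epsilon> (max c\<^sub>2 x))"
    by (rule continuous_on_compose2[OF E_continuous[OF \<epsilon>_ne, of UNIV]]) (auto intro!: continuous_intros)
  show ?thesis
    unfolding profile_def[abs_def] using E_gaps by (intro continuous_intros 1 2) auto
qed

lemma potential_periodic: "potential (x + 1) = potential x"
proof -
  have "\<lfloor>x + 1 - a\<^sub>1\<rfloor> = \<lfloor>x - a\<^sub>1\<rfloor> + 1" by linarith
  then show ?thesis by (simp add: potential_def)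
qed

lemma potential_continuous: "continuous_on UNIV potential"
  unfolding potential_def[abs_def]
proof (rule periodic_extension_continuous[OF profile_continuous])
  show "profile (a\<^sub>1 + 1) = profile a\<^sub>1"
    using E_gaps order by (simp add: profile_simps(1) profile_simps(4))
qed

lemma potential_eq_profile:
  assumes "a\<^sub>1 + of_int k \<le> x" "x < a\<^sub>1 + 1 + of_int k"
  shows "potential x = profile (x - of_int k)"
proof -
  have "\<lfloor>x - a\<^sub>1\<rfloor> = k" using assms by linarith
  then show ?thesis by (simp add: potential_def)
qed

abbreviation wells :: "real set" where
  "wells \<equiv> periodic_lift {a\<^sub>1..c\<^sub>1} \<union> periodic_lift {a\<^sub>2..c\<^sub>2}"

lemma gap_disjoint_wells:
  assumes "x \<in> {c\<^sub>1<..<a\<^sub>2} \<union> {c\<^sub>2<..<a\<^sub>1 + 1}"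
  shows "x \<notin> wells"
proof
  assume "x \<in> wells"
  then obtain k :: int where k: "x + of_int k \<in> {a\<^sub>1..c\<^sub>1} \<union> {a\<^sub>2..c\<^sub>2}"
    by (auto simp: periodic_lift_def)
  consider "k = 0" | "1 \<le> real_of_int k" | "real_of_int k \<le> -1" by linarith
  then show False using k assms order by cases auto
qed

lemma outside_wells:
  assumes "x \<notin> wells"
  shows "\<exists>k. x - of_int k \<in> {c\<^sub>1<..<a\<^sub>2} \<union> {c\<^sub>2<..<a\<^sub>1 + 1}"
proof
  let ?y = "x - of_int \<lfloor>x - a\<^sub>1\<rfloor>"
  have "a\<^sub>1 \<le> ?y" "?y < a\<^sub>1 + 1" by linarith+
  moreover have "?y \<notin> {a\<^sub>1..c\<^sub>1} \<union> {a\<^sub>2..c\<^sub>2}"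
    using assms unfolding periodic_lift_def by (auto dest: spec[of _ "- \<lfloor>x - a\<^sub>1\<rfloor>"])
  ultimately show "?y \<in> {c\<^sub>1<..<a\<^sub>2} \<union> {c\<^sub>2<..<a\<^sub>1 + 1}" by auto
qed

lemma potential_on_gap1:
  assumes "x \<in> {y. y - of_int k \<in> {c\<^sub>1<..<a\<^sub>2}}"
  shows "potential x = E \<epsilon> a\<^sub>2 / (E \<epsilon> a\<^sub>2 - E \<epsilon> c\<^sub>1) + - 1 / (E \<epsilon> a\<^sub>2 - E \<epsilon> c\<^sub>1) * E \<epsilon> (x - of_int k)"
  using potential_eq_profile[of k x] profile_simps(2)[of "x - of_int k"] assms order
  by (auto simp: diff_divide_distrib)

lemma potential_on_gap2:
  assumes "x \<in> {y. y - of_int k \<in> {c\<^sub>2<..<a\<^sub>1 + 1}}"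
  shows "potential x = - E \<epsilon> c\<^sub>2 / (E \<epsilon> (a\<^sub>1 + 1) - E \<epsilon> c\<^sub>2) + 1 / (E \<epsilon> (a\<^sub>1 + 1) - E \<epsilon> c\<^sub>2) * E \<epsilon> (x - of_int k)"
  using potential_eq_profile[of k x] profile_simps(4)[of "x - of_int k"] assms order
  by (auto simp: diff_divide_distrib)

lemma potential_harmonic1:
  assumes "x - of_int k \<in> {c\<^sub>1<..<a\<^sub>2}"
  shows "potential differentiable at x" "deriv potential x = - 1 / (E \<epsilon> a\<^sub>2 - E \<epsilon> c\<^sub>1) * exp (S (x - of_int k) / \<epsilon>)"
    "deriv potential differentiable at x" "generator b \<epsilon> potential x = 0"
proof -
  have mem: "x \<in> {y. y - of_int k \<in> {c\<^sub>1<..<a\<^sub>2}}" using assms by (rule CollectI)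
  note harm = affine_E_harmonic[OF \<epsilon>_ne open_shifted mem potential_on_gap1]
  show "potential differentiable at x" by (rule harm(1))
  show "deriv potential x = - 1 / (E \<epsilon> a\<^sub>2 - E \<epsilon> c\<^sub>1) * exp (S (x - of_int k) / \<epsilon>)" by (rule harm(2))
  show "deriv potential differentiable at x" by (rule harm(3))
  show "generator b \<epsilon> potential x = 0" by (rule harm(4))
qed

lemma potential_harmonic2:
  assumes "x - of_int k \<in> {c\<^sub>2<..<a\<^sub>1 + 1}"
  shows "potential differentiable at x" "deriv potential x = 1 / (E \<epsilon> (a\<^sub>1 + 1) - E \<epsilon> c\<^sub>2) * exp (S (x - of_int k) / \<epsilon>)"
    "deriv potential differentiable at x" "generator b \<epsilon> potential x = 0"
proof -
  have mem: "x \<in> {y. y - of_int k \<in> {c\<^sub>2<..<a\<^sub>1 + 1}}" using assms by (rule CollectI)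
  note harm = affine_E_harmonic[OF \<epsilon>_ne open_shifted mem potential_on_gap2]
  show "potential differentiable at x" by (rule harm(1))
  show "deriv potential x = 1 / (E \<epsilon> (a\<^sub>1 + 1) - E \<epsilon> c\<^sub>2) * exp (S (x - of_int k) / \<epsilon>)" by (rule harm(2))
  show "deriv potential differentiable at x" by (rule harm(3))
  show "generator b \<epsilon> potential x = 0" by (rule harm(4))
qed

lemma potential_in_wells:
  "x \<in> periodic_lift {a\<^sub>1..c\<^sub>1} \<Longrightarrow> potential x = 1"
  "x \<in> periodic_lift {a\<^sub>2..c\<^sub>2} \<Longrightarrow> potential x = 0"
proof -
  have per: "potential (x + of_int k) = potential x" for k
    by (rule periodic_int) (rule potential_periodic)
  {
    assume "x \<in> periodic_lift {a\<^sub>1..c\<^sub>1}"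
    then obtain k :: int where k: "x + of_int k \<in> {a\<^sub>1..c\<^sub>1}" by (auto simp: periodic_lift_def)
    then have "potential (x + of_int k) = profile (x + of_int k)"
      using potential_eq_profile[of 0 "x + of_int k"] order by auto
    then show "potential x = 1" using k per[of k] by (simp add: profile_simps)
  }
  {
    assume "x \<in> periodic_lift {a\<^sub>2..c\<^sub>2}"
    then obtain k :: int where k: "x + of_int k \<in> {a\<^sub>2..c\<^sub>2}" by (auto simp: periodic_lift_def)
    then have "potential (x + of_int k) = profile (x + of_int k)"
      using potential_eq_profile[of 0 "x + of_int k"] order by auto
    then show "potential x = 0" using k per[of k] by (simp add: profile_simps)
  }
qed

lemma potential_is_equilibrium: "is_equilibrium_potential b \<epsilon> {a\<^sub>1..c\<^sub>1} {a\<^sub>2..c\<^sub>2} potential"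
  unfolding is_equilibrium_potential_def
proof (intro conjI allI impI ballI)
  fix x assume "x \<notin> wells"
  then obtain k where "x - of_int k \<in> {c\<^sub>1<..<a\<^sub>2} \<union> {c\<^sub>2<..<a\<^sub>1 + 1}"
    using outside_wells by blast
  then consider "x - of_int k \<in> {c\<^sub>1<..<a\<^sub>2}" | "x - of_int k \<in> {c\<^sub>2<..<a\<^sub>1 + 1}" by blast
  then have "potential differentiable at x \<and> deriv potential differentiable at x \<and> generator b \<epsilon> potential x = 0"
  proof cases
    case 1
    then show ?thesis using potential_harmonic1(1,3,4) by blast
  next
    case 2
    then show ?thesis using potential_harmonic2(1,3,4) by blast
  qed
  then show "potential differentiable at x" "deriv potential differentiable at x" "generator b \<epsilon> potential x = 0"
    by auto
qed (auto intro: potential_periodic potential_continuous potential_in_wells)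

text \<open>
  On each gap a harmonic function is determined by its values at the two ends.
\<close>

lemma equilibrium_unique:
  assumes "is_equilibrium_potential b \<epsilon> {a\<^sub>1..c\<^sub>1} {a\<^sub>2..c\<^sub>2} h"
  shows "h = potential"
proof
  fix x
  have per: "f (x + of_int k) = f x" if "is_equilibrium_potential b \<epsilon> {a\<^sub>1..c\<^sub>1} {a\<^sub>2..c\<^sub>2} f" for f x k
    using that by (intro periodic_int) (simp add: is_equilibrium_potential_def)
  have well: "f x = 1" if "is_equilibrium_potential b \<epsilon> {a\<^sub>1..c\<^sub>1} {a\<^sub>2..c\<^sub>2} f" "x \<in> {a\<^sub>1..c\<^sub>1}" for f x
  proof -
    have "x \<in> periodic_lift {a\<^sub>1..c\<^sub>1}" using that(2) by (auto simp: periodic_lift_def intro: exI[of _ 0])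
    then show ?thesis using that(1) by (simp add: is_equilibrium_potential_def)
  qed
  have well': "f x = 0" if "is_equilibrium_potential b \<epsilon> {a\<^sub>1..c\<^sub>1} {a\<^sub>2..c\<^sub>2} f" "x \<in> {a\<^sub>2..c\<^sub>2}" for f x
  proof -
    have "x \<in> periodic_lift {a\<^sub>2..c\<^sub>2}" using that(2) by (auto simp: periodic_lift_def intro: exI[of _ 0])
    then show ?thesis using that(1) by (simp add: is_equilibrium_potential_def)
  qed
  have gap: "f x = f p + (f r - f p) / (E \<epsilon> r - E \<epsilon> p) * (E \<epsilon> x - E \<epsilon> p)"
    if f: "is_equilibrium_potential b \<epsilon> {a\<^sub>1..c\<^sub>1} {a\<^sub>2..c\<^sub>2} f" and "p < r" "x \<in> {p..r}"
      and "{p<..<r} \<subseteq> {c\<^sub>1<..<a\<^sub>2} \<union> {c\<^sub>2<..<a\<^sub>1 + 1}" for f p r x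
  proof (rule harmonic_is_affine_E[OF \<epsilon>_pos \<open>p < r\<close> _ _ \<open>x \<in> {p..r}\<close>])
    show "continuous_on {p..r} f"
      using f unfolding is_equilibrium_potential_def by (blast intro: continuous_on_subset)
    show "f differentiable at y \<and> deriv f differentiable at y \<and> generator b \<epsilon> f y = 0" if "y \<in> {p<..<r}" for y
      using f gap_disjoint_wells[of y] that \<open>{p<..<r} \<subseteq> _\<close> unfolding is_equilibrium_potential_def by blast
  qed
  note pot = potential_is_equilibrium
  define y where "y = x - of_int \<lfloor>x - a\<^sub>1\<rfloor>"
  have y: "a\<^sub>1 \<le> y" "y < a\<^sub>1 + 1" unfolding y_def by linarith+
  have ends: "f (a\<^sub>1 + 1) = 1" if "is_equilibrium_potential b \<epsilon> {a\<^sub>1..c\<^sub>1} {a\<^sub>2..c\<^sub>2} f" for f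
    using per[OF that, of a\<^sub>1 1] well[OF that, of a\<^sub>1] order by simp
  consider "y \<in> {a\<^sub>1..c\<^sub>1}" | "y \<in> {c\<^sub>1..a\<^sub>2}" | "y \<in> {a\<^sub>2..c\<^sub>2}" | "y \<in> {c\<^sub>2..a\<^sub>1 + 1}" using y by fastforce
  then have "h y = potential y"
  proof cases
    case 1
    then show ?thesis using well[OF assms] well[OF pot] by simp
  next
    case 2
    have "f y = 1 + (0 - 1) / (E \<epsilon> a\<^sub>2 - E \<epsilon> c\<^sub>1) * (E \<epsilon> y - E \<epsilon> c\<^sub>1)"
      if "is_equilibrium_potential b \<epsilon> {a\<^sub>1..c\<^sub>1} {a\<^sub>2..c\<^sub>2} f" for f
      using gap[OF that order(3) 2] well[OF that, of c\<^sub>1] well'[OF that, of a\<^sub>2] order by auto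
    then show ?thesis using assms pot by metis
  next
    case 3
    then show ?thesis using well'[OF assms] well'[OF pot] by simp
  next
    case 4
    have less: "c\<^sub>2 < a\<^sub>1 + 1" using order by simp
    have "f y = 0 + (1 - 0) / (E \<epsilon> (a\<^sub>1 + 1) - E \<epsilon> c\<^sub>2) * (E \<epsilon> y - E \<epsilon> c\<^sub>2)"
      if "is_equilibrium_potential b \<epsilon> {a\<^sub>1..c\<^sub>1} {a\<^sub>2..c\<^sub>2} f" for f
      using gap[OF that less 4] well'[OF that, of c\<^sub>2] ends[OF that] order by auto
    then show ?thesis using assms pot by metis
  qed
  then show "h x = potential x"
    using per[OF assms, of y "\<lfloor>x - a\<^sub>1\<rfloor>"] per[OF pot, of y "\<lfloor>x - a\<^sub>1\<rfloor>"] by (simp add: y_def)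
qed

lemma equilibrium_potential_eq: "equilibrium_potential b \<epsilon> {a\<^sub>1..c\<^sub>1} {a\<^sub>2..c\<^sub>2} = potential"
  unfolding equilibrium_potential_def
  using potential_is_equilibrium equilibrium_unique by (rule the_equality)

lemma pi_eps_periodic: "pi_eps b \<epsilon> (x + 1) = pi_eps b \<epsilon> x"
proof -
  have "pi_eps b \<epsilon> (x + 1) = integral {x..x + 1} ((\<lambda>y. exp ((S y - S (x + 1)) / \<epsilon>)) \<circ> (+) 1)"
    unfolding pi_eps_def using integral_shift_Icc_real[of x "x + 1" "\<lambda>y. exp ((S y - S (x + 1)) / \<epsilon>)" 1]
    by simp
  also have "((\<lambda>y. exp ((S y - S (x + 1)) / \<epsilon>)) \<circ> (+) 1) = (\<lambda>y. exp ((S y - S x) / \<epsilon>))"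
    using S_shift[of x] S_shift by (simp add: fun_eq_iff add.commute[of 1])
  finally show ?thesis by (simp add: pi_eps_def)
qed

lemma gap_integral:
  assumes "p < r" and dh: "\<And>x. x \<in> {p<..<r} \<Longrightarrow> (deriv h x)\<^sup>2 = (exp (S x / \<epsilon>) / (E \<epsilon> r - E \<epsilon> p))\<^sup>2"
  shows "((\<lambda>x. (deriv h x)\<^sup>2 * m_eps b \<epsilon> x) has_integral gap_energy \<epsilon> p r / c_eps b \<epsilon>) {p..r}"
proof -
  define d where "d = E \<epsilon> r - E \<epsilon> p"
  let ?f = "\<lambda>x. exp (S x / \<epsilon>) * (E \<epsilon> (x + 1) - E \<epsilon> x)"
  have Eshift: "continuous_on A (\<lambda>x. E \<epsilon> (x + 1))" for A
    by (rule continuous_on_compose2[OF E_continuous[OF \<epsilon>_ne, of UNIV]]) (auto intro!: continuous_intros)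
  have "(?f has_integral integral {p..r} ?f) {p..r}"
    by (intro integrable_integral integrable_continuous_real continuous_intros Eshift exp_S_continuous E_continuous \<epsilon>_ne)
  from has_integral_mult_left[OF this, of "1 / d\<^sup>2 / c_eps b \<epsilon>"]
  have "((\<lambda>x. ?f x * (1 / d\<^sup>2 / c_eps b \<epsilon>)) has_integral gap_energy \<epsilon> p r / c_eps b \<epsilon>) (cbox p r)"
    by (simp add: gap_energy_def d_def)
  then have "((\<lambda>x. (deriv h x)\<^sup>2 * m_eps b \<epsilon> x) has_integral gap_energy \<epsilon> p r / c_eps b \<epsilon>) (cbox p r)"
  proof (rule has_integral_spike_interior)
    fix x assume "x \<in> box p r"
    then have "(deriv h x)\<^sup>2 = (exp (S x / \<epsilon>))\<^sup>2 / d\<^sup>2" using dh[of x] by (simp add: d_def power_divide)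
    moreover have "(exp (S x / \<epsilon>))\<^sup>2 * exp (- S x / \<epsilon>) = exp (S x / \<epsilon>)"
      by (simp add: power2_eq_square exp_minus)
    ultimately show "(deriv h x)\<^sup>2 * m_eps b \<epsilon> x = ?f x * (1 / d\<^sup>2 / c_eps b \<epsilon>)"
      by (simp add: m_eps_def pi_eps_eq[OF \<epsilon>_ne] mult.assoc[symmetric])
  qed
  then show ?thesis by simp
qed

lemma constant_integral:
  assumes "p \<le> r" and "\<And>x. x \<in> {p<..<r} \<Longrightarrow> h x = c"
  shows "((\<lambda>x. (deriv h x)\<^sup>2 * m_eps b \<epsilon> x) has_integral 0) {p..r}"
proof -
  have "((\<lambda>x. (deriv h x)\<^sup>2 * m_eps b \<epsilon> x) has_integral 0) (cbox p r)"
  proof (rule has_integral_spike_interior[OF has_integral_0])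
    fix x assume "x \<in> box p r"
    then have x: "x \<in> {p<..<r}" by simp
    have "(h has_real_derivative 0) (at x)"
      by (rule has_field_derivative_transform_within_open[OF DERIV_const[of c] open_greaterThanLessThan x]) (simp add: assms(2))
    then show "(deriv h x)\<^sup>2 * m_eps b \<epsilon> x = 0" by (simp add: DERIV_imp_deriv)
  qed
  then show ?thesis by simp
qed

lemma capacity_eq:
  "capacity b \<epsilon> {a\<^sub>1..c\<^sub>1} {a\<^sub>2..c\<^sub>2} =
    \<epsilon> * ((gap_energy \<epsilon> c\<^sub>1 a\<^sub>2 + gap_energy \<epsilon> c\<^sub>2 (a\<^sub>1 + 1)) / c_eps b \<epsilon>)"
proof -
  let ?f = "\<lambda>x. (deriv potential x)\<^sup>2 * m_eps b \<epsilon> x"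
  have 1: "(?f has_integral 0) {a\<^sub>1..c\<^sub>1}"
    by (rule constant_integral[of _ _ _ 1])
       (use order potential_eq_profile[of 0] in \<open>auto simp: profile_simps\<close>)
  have 2: "(?f has_integral gap_energy \<epsilon> c\<^sub>1 a\<^sub>2 / c_eps b \<epsilon>) {c\<^sub>1..a\<^sub>2}"
  proof (rule gap_integral[OF order(3)])
    fix x assume "x \<in> {c\<^sub>1<..<a\<^sub>2}"
    then have "deriv potential x = - 1 / (E \<epsilon> a\<^sub>2 - E \<epsilon> c\<^sub>1) * exp (S (x - of_int 0) / \<epsilon>)"
      by (intro potential_harmonic1(2)) simp
    then show "(deriv potential x)\<^sup>2 = (exp (S x / \<epsilon>) / (E \<epsilon> a\<^sub>2 - E \<epsilon> c\<^sub>1))\<^sup>2"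
      by (simp add: power_divide power2_commute power_mult_distrib)
  qed
  have 3: "(?f has_integral 0) {a\<^sub>2..c\<^sub>2}"
    by (rule constant_integral[of _ _ _ 0])
       (use order potential_eq_profile[of 0] in \<open>auto simp: profile_simps\<close>)
  have 4: "(?f has_integral gap_energy \<epsilon> c\<^sub>2 (a\<^sub>1 + 1) / c_eps b \<epsilon>) {c\<^sub>2..a\<^sub>1 + 1}"
  proof (rule gap_integral)
    fix x assume "x \<in> {c\<^sub>2<..<a\<^sub>1 + 1}"
    then have "deriv potential x = 1 / (E \<epsilon> (a\<^sub>1 + 1) - E \<epsilon> c\<^sub>2) * exp (S (x - of_int 0) / \<epsilon>)"
      by (intro potential_harmonic2(2)) simp
    then show "(deriv potential x)\<^sup>2 = (exp (S x / \<epsilon>) / (E \<epsilon> (a\<^sub>1 + 1) - E \<epsilon> c\<^sub>2))\<^sup>2"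
      by simp
  qed (use order in simp)
  have 12: "(?f has_integral 0 + gap_energy \<epsilon> c\<^sub>1 a\<^sub>2 / c_eps b \<epsilon>) {a\<^sub>1..a\<^sub>2}"
    by (rule has_integral_combine[OF _ _ 1 2]) (use order in auto)
  have 34: "(?f has_integral 0 + gap_energy \<epsilon> c\<^sub>2 (a\<^sub>1 + 1) / c_eps b \<epsilon>) {a\<^sub>2..a\<^sub>1 + 1}"
    by (rule has_integral_combine[OF _ _ 3 4]) (use order in auto)
  have "(?f has_integral (0 + gap_energy \<epsilon> c\<^sub>1 a\<^sub>2 / c_eps b \<epsilon>) + (0 + gap_energy \<epsilon> c\<^sub>2 (a\<^sub>1 + 1) / c_eps b \<epsilon>)) {a\<^sub>1..a\<^sub>1 + 1}"
    by (rule has_integral_combine[OF _ _ 12 34]) (use order in auto)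
  then have "(?f has_integral (0 + gap_energy \<epsilon> c\<^sub>1 a\<^sub>2 / c_eps b \<epsilon>) + (0 + gap_energy \<epsilon> c\<^sub>2 (a\<^sub>1 + 1) / c_eps b \<epsilon>)) {0..1}"
    by (intro has_integral_one_period[of _ a\<^sub>1])
       (use order in \<open>auto simp: deriv_periodic[where f = potential, OF potential_periodic] m_eps_def pi_eps_periodic\<close>)
  from integral_unique[OF this] show ?thesis
    by (simp add: capacity_def equilibrium_potential_eq add_divide_distrib)
qed

end

section \<open>Capacity between wells of different landscapes\<close>

theorem proposition6p2:
  fixes b :: "real \<Rightarrow> real" and q N :: int
    and M\<^sub>m M\<^sub>p m\<^sub>m m\<^sub>p :: "int \<Rightarrow> real" and J :: "int \<Rightarrow> int"
    and \<theta>\<^sub>1\<^sub>m \<theta>\<^sub>1\<^sub>p \<theta>\<^sub>2\<^sub>m \<theta>\<^sub>2\<^sub>p :: real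
  assumes "admissible_drift b"
    and "local_extrema b q M\<^sub>m M\<^sub>p m\<^sub>m m\<^sub>p"
    and "landscape_maxima b q M\<^sub>p N J"
    and "0 \<le> \<theta>\<^sub>1\<^sub>m" "\<theta>\<^sub>1\<^sub>m \<le> \<theta>\<^sub>1\<^sub>p" "\<theta>\<^sub>1\<^sub>p < \<theta>\<^sub>2\<^sub>m" "\<theta>\<^sub>2\<^sub>m \<le> \<theta>\<^sub>2\<^sub>p" "\<theta>\<^sub>2\<^sub>p < 1"
    and "is_well b \<theta>\<^sub>1\<^sub>m \<theta>\<^sub>1\<^sub>p" "is_well b \<theta>\<^sub>2\<^sub>m \<theta>\<^sub>2\<^sub>p"
    and "in_different_landscapes b \<theta>\<^sub>1\<^sub>p \<theta>\<^sub>2\<^sub>p"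
  shows "(\<lambda>\<epsilon>. capacity b \<epsilon> {\<theta>\<^sub>1\<^sub>m..\<theta>\<^sub>1\<^sub>p} {\<theta>\<^sub>2\<^sub>m..\<theta>\<^sub>2\<^sub>p})
    \<sim>[at_right 0] (\<lambda>\<epsilon>. \<epsilon> / Z_eps b q M\<^sub>m M\<^sub>p m\<^sub>m m\<^sub>p J \<epsilon> * exp (- height b / \<epsilon>))"
proof -
  interpret landscapes b q N M\<^sub>m M\<^sub>p m\<^sub>m m\<^sub>p J
    by unfold_locales (rule assms)+
  note order = assms(4-8)
  have z1: "z \<theta>\<^sub>1\<^sub>m = z \<theta>\<^sub>1\<^sub>p" and z2: "z \<theta>\<^sub>2\<^sub>m = z \<theta>\<^sub>2\<^sub>p"
    using well_zmax_constant assms(9,10) order by blast+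
  have "z \<theta>\<^sub>1\<^sub>p < z \<theta>\<^sub>2\<^sub>m" "z \<theta>\<^sub>2\<^sub>p < z (\<theta>\<^sub>1\<^sub>p + 1)"
    using assms(11) z2 by (simp_all add: in_different_landscapes_def add.commute)
  moreover have "z (\<theta>\<^sub>1\<^sub>m + 1) = z (\<theta>\<^sub>1\<^sub>p + 1)"
    using zmax_shift[of _ 1] z1 by simp
  ultimately have "((\<lambda>\<epsilon>. gap_energy \<epsilon> \<theta>\<^sub>1\<^sub>p \<theta>\<^sub>2\<^sub>m + gap_energy \<epsilon> \<theta>\<^sub>2\<^sub>p (\<theta>\<^sub>1\<^sub>m + 1)) \<longlongrightarrow> 1 / 2 + 1 / 2) (at_right 0)"
    using order by (intro tendsto_add gap_energy_limit) auto
  then have "(\<lambda>\<epsilon>. gap_energy \<epsilon> \<theta>\<^sub>1\<^sub>p \<theta>\<^sub>2\<^sub>m + gap_energy \<epsilon> \<theta>\<^sub>2\<^sub>p (\<theta>\<^sub>1\<^sub>m + 1)) \<sim>[at_right 0] (\<lambda>_. 1)"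
    by (intro asymp_equivI') simp
  then have "(\<lambda>\<epsilon>. \<epsilon> * exp (- height b / \<epsilon>) *
        (gap_energy \<epsilon> \<theta>\<^sub>1\<^sub>p \<theta>\<^sub>2\<^sub>m + gap_energy \<epsilon> \<theta>\<^sub>2\<^sub>p (\<theta>\<^sub>1\<^sub>m + 1)) / (c_eps b \<epsilon> * exp (- height b / \<epsilon>)))
      \<sim>[at_right 0] (\<lambda>\<epsilon>. \<epsilon> * exp (- height b / \<epsilon>) * 1 / Z_eps b q M\<^sub>m M\<^sub>p m\<^sub>m m\<^sub>p J \<epsilon>)"
    by (intro asymp_equiv_divide asymp_equiv_mult asymp_equiv_refl c_eps_asymp)
  moreover have "\<forall>\<^sub>F \<epsilon> in at_right 0. \<epsilon> * exp (- height b / \<epsilon>) *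
        (gap_energy \<epsilon> \<theta>\<^sub>1\<^sub>p \<theta>\<^sub>2\<^sub>m + gap_energy \<epsilon> \<theta>\<^sub>2\<^sub>p (\<theta>\<^sub>1\<^sub>m + 1)) / (c_eps b \<epsilon> * exp (- height b / \<epsilon>)) =
      capacity b \<epsilon> {\<theta>\<^sub>1\<^sub>m..\<theta>\<^sub>1\<^sub>p} {\<theta>\<^sub>2\<^sub>m..\<theta>\<^sub>2\<^sub>p}"
    using eventually_at_right_less[of 0]
  proof eventually_elim
    case (elim \<epsilon>)
    then interpret two_wells b \<epsilon> \<theta>\<^sub>1\<^sub>m \<theta>\<^sub>1\<^sub>p \<theta>\<^sub>2\<^sub>m \<theta>\<^sub>2\<^sub>p
      using order by unfold_locales
    show ?case by (simp add: capacity_eq)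
  qed
  ultimately have "(\<lambda>\<epsilon>. capacity b \<epsilon> {\<theta>\<^sub>1\<^sub>m..\<theta>\<^sub>1\<^sub>p} {\<theta>\<^sub>2\<^sub>m..\<theta>\<^sub>2\<^sub>p})
      \<sim>[at_right 0] (\<lambda>\<epsilon>. \<epsilon> * exp (- height b / \<epsilon>) * 1 / Z_eps b q M\<^sub>m M\<^sub>p m\<^sub>m m\<^sub>p J \<epsilon>)"
    by (rule asymp_equiv_cong[THEN iffD1, rotated -1]) (rule always_eventually, simp)
  then show ?thesis by simp
qed

end
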